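(* Let $p$ be a prime and let $N$ be a closed normal subgroup of a pro-$p$-group $G$. Then \[\widehat{\mathrm{d}}(G)\leq \widehat{\mathrm{d}}(G/N),\] and equality holds if $N\le\widehat{Z}(G)$.
   Context: Conventions: $p$ is a prime, $x^y=y^{-1}xy$. A pro-$p$-group is a projective limit $G=\lim_{N\in\mathcal{P}(G)}G/N$, where $\mathcal{P}(G)$ is the set of closed normal subgroups $N$ of $G$ with $G/N$ a finite $p$-group. For a pro-$p$-group $G$, the complete nonabelian tensor square $G\widehat{\otimes}G$ is the pro-$p$-group topologically generated by symbols $x\widehat{\otimes}y$ ($x,y\in G$) subject to the relations $xy\widehat{\otimes}z=(x^y\widehat{\otimes}z^y)(y\widehat{\otimes}z)$ and $y\widehat{\otimes}tz=(y\widehat{\otimes}z)(y^z\widehat{\otimes}t^z)$ for all $x,y,z,t\in G$; equivalently $G\widehat{\otimes}G=\lim_{(N,M)\in\mathcal{P}(G)\times\mathcal{P}(G)}G/N\otimes G/M$ (projective limit of the ordinary nonabelian tensor products), and $(x,y)\mapsto x\widehat{\otimes}y$ is continuous. Let $\widehat{\nabla}(G)$ be the closed (central) subgroup generated by all $x\widehat{\otimes}x$, $x\in G$. The complete nonabelian exterior square is $G\widehat{\wedge}G=(G\widehat{\otimes}G)/\widehat{\nabla}(G)$, and $x\widehat{\wedge}y$ is the image of $x\widehat{\otimes}y$. The complete exterior center is the subgroup $\widehat{Z}(G)=\{g\in G\mid g\widehat{\wedge}y=1\ \text{for all } y\in G\}$. For any pro-$p$-group $K$ with unique normalized Haar measure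 $\mu$, the exterior degree is $\widehat{\mathrm{d}}(K)=(\mu\times\mu)(\{(x,y)\in K\times K\mid x\widehat{\wedge}y=1_{K\widehat{\wedge}K}\})$. *)

theory Defs
  imports "HOL-Analysis.Analysis" "HOL-Algebra.Product_Groups" "HOL-Algebra.Generated_Groups"
begin

section \<open>Topological groups and inverse limits of quotients\<close>

definition topological_group :: "('a, 'm) monoid_scheme \<Rightarrow> 'a topology \<Rightarrow> bool" where
  "topological_group G T \<longleftrightarrow>
     group G \<and> topspace T = carrier G \<and>
     continuous_map (prod_topology T T) T (\<lambda>(x, y). x \<otimes>\<^bsub>G\<^esub> y) \<and>
     continuous_map T T (\<lambda>x. inv\<^bsub>G\<^esub> x)"

definition finite_p_group :: "nat \<Rightarrow> ('a, 'm) monoid_scheme \<Rightarrow> bool" where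
  "finite_p_group p G \<longleftrightarrow> group G \<and> finite (carrier G) \<and> (\<exists>k. order G = p ^ k)"

definition quotient_topology ::
    "('a, 'm) monoid_scheme \<Rightarrow> 'a topology \<Rightarrow> 'a set \<Rightarrow> 'a set topology" where
  "quotient_topology G T N =
     topology (\<lambda>U. U \<subseteq> carrier (G Mod N) \<and> openin T {x \<in> topspace T. N #>\<^bsub>G\<^esub> x \<in> U})"

lemma openin_quotient_topology:
  "openin (quotient_topology G T N) U \<longleftrightarrow>
     U \<subseteq> carrier (G Mod N) \<and> openin T {x \<in> topspace T. N #>\<^bsub>G\<^esub> x \<in> U}"
proof -
  have "istopology (\<lambda>U. U \<subseteq> carrier (G Mod N) \<and> openin T {x \<in> topspace T. N #>\<^bsub>G\<^esub> x \<in> U})"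
    unfolding istopology_def
  proof (intro conjI allI impI)
    fix U V
    assume U: "U \<subseteq> carrier (G Mod N) \<and> openin T {x \<in> topspace T. N #>\<^bsub>G\<^esub> x \<in> U}"
      and V: "V \<subseteq> carrier (G Mod N) \<and> openin T {x \<in> topspace T. N #>\<^bsub>G\<^esub> x \<in> V}"
    show "U \<inter> V \<subseteq> carrier (G Mod N)" using U by blast
    have "{x \<in> topspace T. N #>\<^bsub>G\<^esub> x \<in> U \<inter> V} =
        {x \<in> topspace T. N #>\<^bsub>G\<^esub> x \<in> U} \<inter> {x \<in> topspace T. N #>\<^bsub>G\<^esub> x \<in> V}" by blast
    then show "openin T {x \<in> topspace T. N #>\<^bsub>G\<^esub> x \<in> U \<inter> V}" using U V by (simp add: openin_Int)
  next
    fix \<K>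
    assume K: "\<forall>U\<in>\<K>. U \<subseteq> carrier (G Mod N) \<and> openin T {x \<in> topspace T. N #>\<^bsub>G\<^esub> x \<in> U}"
    show "\<Union>\<K> \<subseteq> carrier (G Mod N)" using K by blast
    have "{x \<in> topspace T. N #>\<^bsub>G\<^esub> x \<in> \<Union>\<K>} = (\<Union>U\<in>\<K>. {x \<in> topspace T. N #>\<^bsub>G\<^esub> x \<in> U})" by blast
    then show "openin T {x \<in> topspace T. N #>\<^bsub>G\<^esub> x \<in> \<Union>\<K>}"
      using K by (auto intro!: openin_Union)
  qed
  then show ?thesis
    unfolding quotient_topology_def by (simp add: topology_inverse')
qed

text \<open>
  For a family \<open>\<N>\<close> of normal subgroups of a group \<open>A\<close>, the inverse limit of the quotients \<open>A/N\<close>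
  consists of the families \<open>f\<close> with \<open>f N \<in> A/N\<close> that are compatible with the canonical projections
  \<open>A/M \<rightarrow> A/N\<close>, \<open>M \<subseteq> N\<close>; such a projection sends a coset \<open>C\<close> of \<open>M\<close> to the coset \<open>NC\<close> of \<open>N\<close>.
  Each \<open>A/N\<close> is given the discrete topology.
\<close>

definition quotient_limit ::
    "('a, 'm) monoid_scheme \<Rightarrow> 'a set set \<Rightarrow> ('a set \<Rightarrow> 'a set) monoid" where
  "quotient_limit A \<N> =
     (product_group \<N> (\<lambda>N. A Mod N))
       \<lparr>carrier := {f \<in> \<Pi>\<^sub>E N\<in>\<N>. carrier (A Mod N).
                      \<forall>M\<in>\<N>. \<forall>N\<in>\<N>. M \<subseteq> N \<longrightarrow> f N = N <#>\<^bsub>A\<^esub> f M}\<rparr>"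

definition quotient_limit_topology ::
    "('a, 'm) monoid_scheme \<Rightarrow> 'a set set \<Rightarrow> ('a set \<Rightarrow> 'a set) topology" where
  "quotient_limit_topology A \<N> =
     subtopology (product_topology (\<lambda>N. discrete_topology (carrier (A Mod N))) \<N>)
       (carrier (quotient_limit A \<N>))"

definition to_quotient_limit ::
    "('a, 'm) monoid_scheme \<Rightarrow> 'a set set \<Rightarrow> 'a \<Rightarrow> 'a set \<Rightarrow> 'a set" where
  "to_quotient_limit A \<N> a = (\<lambda>N\<in>\<N>. N #>\<^bsub>A\<^esub> a)"


section \<open>Pro-\<open>p\<close>-groups\<close>

definition p_quotients :: "nat \<Rightarrow> ('a, 'm) monoid_scheme \<Rightarrow> 'a topology \<Rightarrow> 'a set set" where
  "p_quotients p G T = {N. N \<lhd> G \<and> closedin T N \<and> finite_p_group p (G Mod N)}"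

definition pro_p_group :: "nat \<Rightarrow> ('a, 'm) monoid_scheme \<Rightarrow> 'a topology \<Rightarrow> bool" where
  "pro_p_group p G T \<longleftrightarrow>
     topological_group G T \<and>
     to_quotient_limit G (p_quotients p G T) \<in> iso G (quotient_limit G (p_quotients p G T)) \<and>
     homeomorphic_map T (quotient_limit_topology G (p_quotients p G T))
       (to_quotient_limit G (p_quotients p G T))"


section \<open>Group presentations\<close>

text \<open>A letter \<open>(True, x)\<close> stands for the generator \<open>x\<close>, and \<open>(False, x)\<close> for its formal inverse.\<close>

type_synonym 'x group_word = "(bool \<times> 'x) list"

definition group_words :: "'x set \<Rightarrow> 'x group_word set" where
  "group_words X = lists (UNIV \<times> X)"

inductive presented_eq ::
    "'x set \<Rightarrow> ('x group_word \<times> 'x group_word) set \<Rightarrow> 'x group_word \<Rightarrow> 'x group_word \<Rightarrow> bool"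
  for X R where
  relator: "(u, v) \<in> R \<Longrightarrow> u \<in> group_words X \<Longrightarrow> v \<in> group_words X \<Longrightarrow> presented_eq X R u v"
| cancel: "x \<in> X \<Longrightarrow> presented_eq X R [(b, x), (\<not> b, x)] []"
| refl: "u \<in> group_words X \<Longrightarrow> presented_eq X R u u"
| sym: "presented_eq X R u v \<Longrightarrow> presented_eq X R v u"
| trans: "presented_eq X R u v \<Longrightarrow> presented_eq X R v w \<Longrightarrow> presented_eq X R u w"
| append: "presented_eq X R u u' \<Longrightarrow> presented_eq X R v v' \<Longrightarrow> presented_eq X R (u @ v) (u' @ v')"

definition presented_class ::
    "'x set \<Rightarrow> ('x group_word \<times> 'x group_word) set \<Rightarrow> 'x group_word \<Rightarrow> 'x group_word set" where
  "presented_class X R u = {v. presented_eq X R u v}"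

definition presented_group ::
    "'x set \<Rightarrow> ('x group_word \<times> 'x group_word) set \<Rightarrow> 'x group_word set monoid" where
  "presented_group X R =
     \<lparr>carrier = presented_class X R ` group_words X,
      monoid.mult = (\<lambda>C D. \<Union>u\<in>C. \<Union>v\<in>D. presented_class X R (u @ v)),
      one = presented_class X R []\<rparr>"


section \<open>The complete nonabelian tensor square\<close>

definition conj_by :: "('a, 'm) monoid_scheme \<Rightarrow> 'a \<Rightarrow> 'a \<Rightarrow> 'a" where
  "conj_by G x y = inv\<^bsub>G\<^esub> y \<otimes>\<^bsub>G\<^esub> x \<otimes>\<^bsub>G\<^esub> y"

definition tensor_relations ::
    "('a, 'm) monoid_scheme \<Rightarrow> (('a \<times> 'a) group_word \<times> ('a \<times> 'a) group_word) set" where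
  "tensor_relations G =
     {([(True, (x \<otimes>\<^bsub>G\<^esub> y, z))],
       [(True, (conj_by G x y, conj_by G z y)), (True, (y, z))])
      | x y z. x \<in> carrier G \<and> y \<in> carrier G \<and> z \<in> carrier G} \<union>
     {([(True, (y, t \<otimes>\<^bsub>G\<^esub> z))],
       [(True, (y, z)), (True, (conj_by G y z, conj_by G t z))])
      | y z t. y \<in> carrier G \<and> z \<in> carrier G \<and> t \<in> carrier G}"

definition tensor_square :: "('a, 'm) monoid_scheme \<Rightarrow> ('a \<times> 'a) group_word set monoid" where
  "tensor_square G = presented_group (carrier G \<times> carrier G) (tensor_relations G)"

definition tensor :: "('a, 'm) monoid_scheme \<Rightarrow> 'a \<Rightarrow> 'a \<Rightarrow> ('a \<times> 'a) group_word set" where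
  "tensor G x y = presented_class (carrier G \<times> carrier G) (tensor_relations G) [(True, (x, y))]"

text \<open>
  The pro-\<open>p\<close>-group topologically generated by continuously varying symbols
  \<open>x \<otimes>^ y\<close> subject to the tensor relations is the inverse limit of those finite \<open>p\<close>-quotients of the
  abstract tensor square in which the image of the symbol depends continuously on \<open>(x, y)\<close>.
  As \<open>G \<times> G\<close> is compact, every such finite quotient factors through
  \<open>G/N \<otimes> G/N\<close> for some open normal \<open>N\<close>, so this agrees with the inverse limit of the tensor squares of
  the finite \<open>p\<close>-quotients of \<open>G\<close>.
\<close>

definition tensor_p_quotients ::
    "nat \<Rightarrow> ('a, 'm) monoid_scheme \<Rightarrow> 'a topology \<Rightarrow> ('a \<times> 'a) group_word set set set" where
  "tensor_p_quotients p G T =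
     {K. K \<lhd> tensor_square G \<and> finite_p_group p (tensor_square G Mod K) \<and>
         continuous_map (prod_topology T T) (discrete_topology (carrier (tensor_square G Mod K)))
           (\<lambda>(x, y). K #>\<^bsub>tensor_square G\<^esub> tensor G x y)}"

type_synonym 'a complete_tensor =
  "('a \<times> 'a) group_word set set \<Rightarrow> ('a \<times> 'a) group_word set set"

definition complete_tensor_square ::
    "nat \<Rightarrow> ('a, 'm) monoid_scheme \<Rightarrow> 'a topology \<Rightarrow> 'a complete_tensor monoid" where
  "complete_tensor_square p G T = quotient_limit (tensor_square G) (tensor_p_quotients p G T)"

definition complete_tensor_topology ::
    "nat \<Rightarrow> ('a, 'm) monoid_scheme \<Rightarrow> 'a topology \<Rightarrow> 'a complete_tensor topology" where
  "complete_tensor_topology p G T =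
     quotient_limit_topology (tensor_square G) (tensor_p_quotients p G T)"

definition complete_tensor ::
    "nat \<Rightarrow> ('a, 'm) monoid_scheme \<Rightarrow> 'a topology \<Rightarrow> 'a \<Rightarrow> 'a \<Rightarrow> 'a complete_tensor" where
  "complete_tensor p G T x y =
     to_quotient_limit (tensor_square G) (tensor_p_quotients p G T) (tensor G x y)"


section \<open>The complete nonabelian exterior square\<close>

definition complete_nabla ::
    "nat \<Rightarrow> ('a, 'm) monoid_scheme \<Rightarrow> 'a topology \<Rightarrow> 'a complete_tensor set" where
  "complete_nabla p G T =
     complete_tensor_topology p G T closure_of
       generate (complete_tensor_square p G T) {complete_tensor p G T x x | x. x \<in> carrier G}"

definition complete_exterior_square ::
    "nat \<Rightarrow> ('a, 'm) monoid_scheme \<Rightarrow> 'a topology \<Rightarrow> 'a complete_tensor set monoid" where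
  "complete_exterior_square p G T = complete_tensor_square p G T Mod complete_nabla p G T"

definition complete_wedge ::
    "nat \<Rightarrow> ('a, 'm) monoid_scheme \<Rightarrow> 'a topology \<Rightarrow> 'a \<Rightarrow> 'a \<Rightarrow> 'a complete_tensor set" where
  "complete_wedge p G T x y =
     complete_nabla p G T #>\<^bsub>complete_tensor_square p G T\<^esub> complete_tensor p G T x y"

definition complete_exterior_center ::
    "nat \<Rightarrow> ('a, 'm) monoid_scheme \<Rightarrow> 'a topology \<Rightarrow> 'a set" where
  "complete_exterior_center p G T =
     {g \<in> carrier G. \<forall>y\<in>carrier G.
        complete_wedge p G T g y = \<one>\<^bsub>complete_exterior_square p G T\<^esub>}"


section \<open>Haar measure and the exterior degree\<close>

definition normalized_haar_measure ::
    "('a, 'm) monoid_scheme \<Rightarrow> 'a topology \<Rightarrow> 'a measure \<Rightarrow> bool" where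
  "normalized_haar_measure G T M \<longleftrightarrow>
     space M = topspace T \<and> sets M = sigma_sets (topspace T) {U. openin T U} \<and>
     emeasure M (carrier G) = 1 \<and>
     (\<forall>x\<in>carrier G. \<forall>A\<in>sets M. emeasure M (x <#\<^bsub>G\<^esub> A) = emeasure M A) \<and>
     (\<forall>A\<in>sets M. emeasure M A = (INF U\<in>{U. openin T U \<and> A \<subseteq> U}. emeasure M U)) \<and>
     (\<forall>U. openin T U \<longrightarrow> emeasure M U = (SUP C\<in>{C. compactin T C \<and> C \<subseteq> U}. emeasure M C))"

definition haar_measure :: "('a, 'm) monoid_scheme \<Rightarrow> 'a topology \<Rightarrow> 'a measure" where
  "haar_measure G T = (THE M. normalized_haar_measure G T M)"

text \<open>
  The set of pairs with trivial wedge is closed in \<open>K \<times> K\<close>. If \<open>K\<close> is not second countable, the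
  Borel sets of \<open>K \<times> K\<close> need not belong to the product \<open>\<sigma>\<close>-algebra on which the library's
  \<open>\<mu> \<Otimes>\<^sub>M \<mu>\<close> is defined. The outer measure of \<open>\<mu> \<Otimes>\<^sub>M \<mu>\<close> extends it, and on closed sets it
  takes the same value as the unique regular Borel measure on \<open>K \<times> K\<close> that extends
  \<open>\<mu> \<Otimes>\<^sub>M \<mu>\<close>, because a closed set is the intersection of the finite unions of clopen rectangles
  containing it. On second countable groups it is just \<open>\<mu> \<Otimes>\<^sub>M \<mu>\<close>.
\<close>

definition exterior_degree :: "nat \<Rightarrow> ('a, 'm) monoid_scheme \<Rightarrow> 'a topology \<Rightarrow> real" where
  "exterior_degree p K T =
     enn2real (outer_measure_of (haar_measure K T \<Otimes>\<^sub>M haar_measure K T)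
       {(x, y). x \<in> carrier K \<and> y \<in> carrier K \<and>
          complete_wedge p K T x y = \<one>\<^bsub>complete_exterior_square p K T\<^esub>})"

end

theory Submission
  imports Defs "HOL-Algebra.SndIsomorphismGrp"
begin

text \<open>
  Write \<open>S(G)\<close> for the set of pairs \<open>(x, y)\<close> with trivial wedge and \<open>\<pi>\<close> for the projection of \<open>G\<close>
  onto \<open>G/N\<close>. The wedge is functorial, so \<open>S(G)\<close> lies in the preimage of \<open>S(G/N)\<close>. If every element of
  \<open>N\<close> has trivial wedge with all of \<open>G\<close>, then \<open>x \<and> y\<close> depends only on \<open>\<pi> x\<close> and \<open>\<pi> y\<close>, hence induces a
  homomorphism back from the exterior square of \<open>G/N\<close>, and \<open>S(G)\<close> is the whole preimage. As \<open>\<pi>\<close> carries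
  Haar measure to Haar measure, the theorem becomes a comparison of the outer measure of \<open>S(G/N)\<close>
  with that of its preimage. What has to be supplied is the algebra behind these two
  relations of \<open>S(G)\<close> to \<open>S(G/N)\<close>, Haar measure itself, and the behaviour of the outer measure under preimages.

  The algebra takes place at finite level. The complete tensor square is the inverse limit of
  certain finite \<open>p\<close>-quotients of the abstract tensor square \<open>G \<otimes> G\<close>, and \<open>x \<and> y\<close> is trivial if and only if
  \<open>x \<otimes> y\<close> lies in each of their kernels \<open>K\<close> that contains all \<open>a \<otimes> a\<close>
  (\<open>complete_wedge_trivial_iff\<close>). This needs the subgroup generated by the \<open>a \<otimes> a\<close> to be normal;
  it is, because conjugation by \<open>y \<otimes> z\<close> acts on tensors as conjugation of both entries by a
  commutator of \<open>y\<close> and \<open>z\<close> (\<open>tensor_conj\<close>). Both comparisons of \<open>S(G)\<close> with \<open>S(G/N)\<close> are then made by pulling such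
  kernels back along homomorphisms given by the universal property of the tensor square
  (\<open>trivial_wedges_hom\<close>, \<open>trivial_wedges_lift\<close>). The criterion also shows that \<open>S(G)\<close> is closed.

  On the side of measure, a pro-\<open>p\<close>-group and its quotients are compact groups in which the open
  normal subgroups form a base at \<open>1\<close>. For an open normal subgroup \<open>M\<close>, an invariant probability
  measure gives each coset of \<open>M\<close> the same mass, so it is determined on unions of
  cosets; by compactness and inner regularity it is determined on open sets. The
  same counting, followed by Caratheodory's construction, produces the measure
  (\<open>haar_measure_eq\<close>). The groups may fail to be second countable, so Borel sets are obtained from an
  outer measure defined through open sets.

  Measurable covers of \<open>S(G/N)\<close> pull back to measurable covers of \<open>S(G)\<close>, which gives the
  inequality. Conversely a measurable cover of the preimage of \<open>S(G/N)\<close> need not be a preimage. But it lies in an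
  open set of almost the same measure (\<open>haar2_outer_regular\<close>), and as \<open>S(G)\<close> is compact, that
  open set contains the union of all \<open>Mx \<times> My\<close> with \<open>(x, y) \<in> S(G)\<close> for a single open normal
  subgroup \<open>M\<close>. This union is the preimage of a finite union of rectangles
  covering \<open>S(G/N)\<close> (\<open>outer_measure_preimage_ge\<close>).
\<close>

section \<open>Finite \<open>p\<close>-groups and cosets\<close>

lemma finite_p_group_inj_hom:
  assumes p: "prime p" and A: "group A" and B: "finite_p_group p B"
    and h: "h \<in> hom A B" and inj: "inj_on h (carrier A)"
  shows "finite_p_group p A"
proof -
  interpret A: group A by fact
  interpret B: group B using B by (simp add: finite_p_group_def)
  interpret h: group_hom A B h using h by unfold_locales
  obtain k where k: "order B = p ^ k" and fin: "finite (carrier B)"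
    using B by (auto simp: finite_p_group_def)
  have sub: "h ` carrier A \<subseteq> carrier B" using h by (auto simp: hom_def)
  have "card (h ` carrier A) dvd order B"
    using B.lagrange[OF h.img_is_subgroup] by (metis dvd_triv_right)
  then have "order A dvd p ^ k" using k inj by (simp add: order_def card_image)
  then obtain j where "order A = p ^ j" using p divides_primepow_nat by blast
  moreover have "finite (carrier A)"
    using finite_subset[OF sub fin] inj finite_imageD by blast
  ultimately show ?thesis using A by (auto simp: finite_p_group_def)
qed

lemma finite_p_group_surj_hom:
  assumes p: "prime p" and A: "finite_p_group p A" and B: "group B"
    and h: "h \<in> hom A B" and surj: "h ` carrier A = carrier B"
  shows "finite_p_group p B"
proof -
  interpret A: group A using A by (simp add: finite_p_group_def)
  interpret B: group B by fact
  interpret h: group_hom A B h using h by unfold_locales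
  obtain k where k: "order A = p ^ k" and fin: "finite (carrier A)"
    using A by (auto simp: finite_p_group_def)
  have "card (carrier (A Mod kernel A B h)) = card (carrier B)"
    using iso_same_card[OF h.FactGroup_iso[OF surj]] .
  moreover have "card (rcosets\<^bsub>A\<^esub> (kernel A B h)) dvd order A"
    using A.lagrange[OF h.subgroup_kernel] by (metis dvd_triv_left)
  ultimately have "order B dvd p ^ k" using k by (simp add: order_def FactGroup_def)
  then obtain j where "order B = p ^ j" using p divides_primepow_nat by blast
  moreover have "finite (carrier B)" using fin surj by (metis finite_imageI)
  ultimately show ?thesis using B by (auto simp: finite_p_group_def)
qed

text \<open>A homomorphism into a finite \<open>p\<close>-group, surjective or not, certifies that its kernel has finite
  \<open>p\<close>-quotient.\<close>

lemma finite_p_group_Mod_kernel: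
  assumes p: "prime p" and A: "group A" and B: "finite_p_group p B" and h: "h \<in> hom A B"
  shows "finite_p_group p (A Mod kernel A B h)"
proof -
  interpret A: group A by fact
  interpret B: group B using B by (simp add: finite_p_group_def)
  interpret h: group_hom A B h using h by unfold_locales
  show ?thesis
    using finite_p_group_inj_hom[OF p _ B h.FactGroup_hom h.FactGroup_inj_on]
      normal.factorgroup_is_group[OF h.normal_kernel] by blast
qed

lemma finite_p_group_DirProd:
  assumes "finite_p_group p A" "finite_p_group p B"
  shows "finite_p_group p (A \<times>\<times> B)"
proof -
  have "order (A \<times>\<times> B) = order A * order B"
    by (simp add: order_def DirProd_def card_cartesian_product)
  with assms show ?thesis
    unfolding finite_p_group_def
    by (metis DirProd_group carrier_DirProd finite_cartesian_product power_add)
qed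

lemma (in group) rcos_eq_iff:
  assumes K: "subgroup K G" and "a \<in> carrier G" "b \<in> carrier G"
  shows "K #> a = K #> b \<longleftrightarrow> a \<otimes> inv b \<in> K"
  using assms
  by (metis coset_join1 coset_join2 coset_mult_inv1 coset_mult_inv2 inv_closed m_closed
      subgroup.subset)

lemma (in group) rcos_eq_self_iff:
  assumes K: "subgroup K G" and "a \<in> carrier G"
  shows "K #> a = K \<longleftrightarrow> a \<in> K"
  using assms coset_join1 coset_join2 by blast

section \<open>Groups given by generators and relations\<close>

primrec word_value :: "('b, 'n) monoid_scheme \<Rightarrow> ('x \<Rightarrow> 'b) \<Rightarrow> 'x group_word \<Rightarrow> 'b" where
  "word_value H f [] = \<one>\<^bsub>H\<^esub>"
| "word_value H f (l # w) =
     (if fst l then f (snd l) else inv\<^bsub>H\<^esub> f (snd l)) \<otimes>\<^bsub>H\<^esub> word_value H f w"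

lemma word_value_closed:
  assumes "group H" "f \<in> X \<rightarrow> carrier H" "w \<in> group_words X"
  shows "word_value H f w \<in> carrier H"
proof -
  interpret group H by fact
  show ?thesis using assms(2,3)
    by (induct w) (auto simp: group_words_def intro!: m_closed inv_closed)
qed

lemma word_value_append:
  assumes "group H" "f \<in> X \<rightarrow> carrier H" "v \<in> group_words X" "w \<in> group_words X"
  shows "word_value H f (v @ w) = word_value H f v \<otimes>\<^bsub>H\<^esub> word_value H f w"
proof -
  interpret group H by fact
  have w: "word_value H f w \<in> carrier H" using assms word_value_closed by blast
  show ?thesis using assms(3)
  proof (induct v)
    case Nil then show ?case using w by simp
  next
    case (Cons l v)
    then have v: "v \<in> group_words X" and l: "f (snd l) \<in> carrier H"
      using assms(2) by (auto simp: group_words_def)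
    have "word_value H f v \<in> carrier H" using word_value_closed[OF assms(1,2) v] .
    then show ?case using Cons.hyps[OF v] w l
      by (simp add: m_assoc)
  qed
qed

lemma presented_eq_in_words:
  "presented_eq X R u v \<Longrightarrow> u \<in> group_words X \<and> v \<in> group_words X"
  by (induct rule: presented_eq.induct) (auto simp: group_words_def)

text \<open>Von Dyck: evaluation in a group that satisfies the relations respects every rule that
  generates the congruence.\<close>

lemma word_value_cong:
  assumes H: "group H" and f: "f \<in> X \<rightarrow> carrier H"
    and R: "\<And>u v. (u, v) \<in> R \<Longrightarrow> u \<in> group_words X \<Longrightarrow> v \<in> group_words X \<Longrightarrow>
              word_value H f u = word_value H f v"
    and uv: "presented_eq X R u v"
  shows "word_value H f u = word_value H f v"
proof -
  interpret group H by fact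
  show ?thesis using uv
  proof (induct rule: presented_eq.induct)
    case (cancel x b)
    then have "f x \<in> carrier H" using f by auto
    then show ?case by (cases b) auto
  next
    case (append u u' v v')
    then show ?case using word_value_append[OF H f] presented_eq_in_words by metis
  qed (use R in auto)
qed

lemma presented_class_eq_iff:
  assumes "u \<in> group_words X"
  shows "presented_class X R u = presented_class X R v \<longleftrightarrow> presented_eq X R u v"
  using assms unfolding presented_class_def
  by (blast intro: presented_eq.refl presented_eq.sym presented_eq.trans)

text \<open>The product of classes is defined as a union over all representatives; by compatibility of the
  congruence with concatenation all members of that union coincide.\<close>

lemma presented_mult:
  assumes u: "u \<in> group_words X" and v: "v \<in> group_words X"
  shows "presented_class X R u \<otimes>\<^bsub>presented_group X R\<^esub> presented_class X R v =
    presented_class X R (u @ v)"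
proof -
  have "presented_class X R (u' @ v') = presented_class X R (u @ v)"
    if "u' \<in> presented_class X R u" "v' \<in> presented_class X R v" for u' v'
  proof -
    have "presented_eq X R u u'" "presented_eq X R v v'"
      using that by (auto simp: presented_class_def)
    then have "presented_eq X R (u @ v) (u' @ v')" by (rule presented_eq.append)
    moreover have "u @ v \<in> group_words X" using u v by (simp add: group_words_def)
    ultimately show ?thesis using presented_class_eq_iff by metis
  qed
  moreover have "u \<in> presented_class X R u" "v \<in> presented_class X R v"
    using u v by (auto simp: presented_class_def intro: presented_eq.refl)
  ultimately have "(\<Union>u'\<in>presented_class X R u. \<Union>v'\<in>presented_class X R v.
      presented_class X R (u' @ v')) = presented_class X R (u @ v)"
    by blast
  then show ?thesis by (simp add: presented_group_def)
qed

lemma presented_class_carrier: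
  "u \<in> group_words X \<Longrightarrow> presented_class X R u \<in> carrier (presented_group X R)"
  by (simp add: presented_group_def)

lemma presented_one: "\<one>\<^bsub>presented_group X R\<^esub> = presented_class X R []"
  by (simp add: presented_group_def)

lemma presented_letter_cancel:
  assumes "x \<in> X"
  shows "presented_class X R [(b, x)] \<otimes>\<^bsub>presented_group X R\<^esub> presented_class X R [(\<not> b, x)]
    = \<one>\<^bsub>presented_group X R\<^esub>"
proof -
  have w: "[(b, x), (\<not> b, x)] \<in> group_words X" "[(b, x)] \<in> group_words X"
    "[(\<not> b, x)] \<in> group_words X" using assms by (auto simp: group_words_def)
  then show ?thesis
    using presented_class_eq_iff[of "[(b, x), (\<not> b, x)]"] presented_eq.cancel[OF assms]
    by (simp add: presented_mult presented_one)
qed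

lemma presented_group_is_group: "group (presented_group X R)"
proof (rule groupI)
  let ?P = "presented_group X R"
  have car: "carrier ?P = presented_class X R ` group_words X" by (simp add: presented_group_def)
  show "a \<otimes>\<^bsub>?P\<^esub> b \<in> carrier ?P" if "a \<in> carrier ?P" "b \<in> carrier ?P" for a b
    using that unfolding car by (auto simp: presented_mult) (auto simp: group_words_def)
  show "\<one>\<^bsub>?P\<^esub> \<in> carrier ?P"
    unfolding presented_one by (rule presented_class_carrier) (simp add: group_words_def)
  show "a \<otimes>\<^bsub>?P\<^esub> b \<otimes>\<^bsub>?P\<^esub> c = a \<otimes>\<^bsub>?P\<^esub> (b \<otimes>\<^bsub>?P\<^esub> c)"
    if "a \<in> carrier ?P" "b \<in> carrier ?P" "c \<in> carrier ?P" for a b c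
  proof -
    have app: "u @ v \<in> group_words X" if "u \<in> group_words X" "v \<in> group_words X" for u v :: "'a group_word"
      using that by (simp add: group_words_def)
    show ?thesis using that unfolding car by (auto simp: presented_mult app)
  qed
  have nil: "[] \<in> group_words X" by (simp add: group_words_def)
  show one: "\<one>\<^bsub>?P\<^esub> \<otimes>\<^bsub>?P\<^esub> a = a" if "a \<in> carrier ?P" for a
    using that nil unfolding car presented_one by (auto simp: presented_mult)
  have "\<exists>b\<in>group_words X. presented_class X R b \<otimes>\<^bsub>?P\<^esub> presented_class X R w = \<one>\<^bsub>?P\<^esub>"
    if "w \<in> group_words X" for w
    using that
  proof (induct w)
    case Nil then show ?case using nil by (intro bexI[of _ "[]"]) (auto simp: presented_mult presented_one)
  next
    case (Cons l w)
    obtain b x where l: "l = (b, x)" by (cases l)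
    have x: "x \<in> X" and w: "w \<in> group_words X" using Cons.prems by (auto simp: group_words_def l)
    obtain v where v: "v \<in> group_words X" "presented_eq X R (v @ w) []"
      using Cons.hyps w presented_class_eq_iff[of _ X R "[]"]
      by (force simp: presented_mult presented_one group_words_def)
    have c: "presented_eq X R [(\<not> b, x), (b, x)] []" using presented_eq.cancel[OF x, of R "\<not> b"] by simp
    have "presented_eq X R (v @ ([(\<not> b, x), (b, x)] @ w)) (v @ ([] @ w))"
      by (intro presented_eq.append presented_eq.refl v w c)
    then have "presented_eq X R ((v @ [(\<not> b, x)]) @ (l # w)) []"
      using v(2) presented_eq.trans by (fastforce simp: l)
    moreover have "v @ [(\<not> b, x)] \<in> group_words X" using v x by (simp add: group_words_def)
    ultimately show ?case using Cons.prems
        presented_class_eq_iff[of "(v @ [(\<not> b, x)]) @ (l # w)" X R "[]"] presented_eq_in_words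
      by (intro bexI[of _ "v @ [(\<not> b, x)]"]) (auto simp only: presented_mult presented_one)
  qed
  then show "\<exists>b\<in>carrier ?P. b \<otimes>\<^bsub>?P\<^esub> a = \<one>\<^bsub>?P\<^esub>" if "a \<in> carrier ?P" for a
    using that unfolding car by blast
qed

lemma presented_group_universal:
  assumes H: "group H" and f: "f \<in> X \<rightarrow> carrier H"
    and R: "\<And>u v. (u, v) \<in> R \<Longrightarrow> u \<in> group_words X \<Longrightarrow> v \<in> group_words X \<Longrightarrow>
              word_value H f u = word_value H f v"
  obtains h where "h \<in> hom (presented_group X R) H"
    and "\<And>x. x \<in> X \<Longrightarrow> h (presented_class X R [(True, x)]) = f x"
proof -
  interpret group H by fact
  define h where "h C = the_elem (word_value H f ` C)" for C
  have h: "h (presented_class X R w) = word_value H f w" if "w \<in> group_words X" for w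
  proof -
    have "word_value H f ` presented_class X R w = {word_value H f w}"
      using word_value_cong[OF H f R] presented_eq.refl[OF that]
      by (auto simp: presented_class_def intro!: image_eqI)
    then show ?thesis by (simp add: h_def)
  qed
  show thesis
  proof
    show "h \<in> hom (presented_group X R) H"
    proof (rule homI)
      fix a b assume "a \<in> carrier (presented_group X R)" "b \<in> carrier (presented_group X R)"
      then obtain u v where "u \<in> group_words X" "v \<in> group_words X"
        "a = presented_class X R u" "b = presented_class X R v"
        by (auto simp: presented_group_def)
      then show "h a \<in> carrier H" "h (a \<otimes>\<^bsub>presented_group X R\<^esub> b) = h a \<otimes>\<^bsub>H\<^esub> h b"
        using h word_value_closed[OF H f] word_value_append[OF H f]
        by (simp_all add: presented_mult group_words_def)
    qed
    show "h (presented_class X R [(True, x)]) = f x" if "x \<in> X" for x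
      using h[of "[(True, x)]"] that f funcset_mem[OF f that] by (simp add: group_words_def)
  qed
qed

lemma presented_group_generated:
  "carrier (presented_group X R) =
     generate (presented_group X R) {presented_class X R [(True, x)] | x. x \<in> X}"
    (is "carrier ?P = generate ?P ?S")
proof
  interpret P: group ?P by (rule presented_group_is_group)
  have S: "?S \<subseteq> carrier ?P" by (auto intro!: presented_class_carrier simp: group_words_def)
  show "generate ?P ?S \<subseteq> carrier ?P" using P.generate_incl[OF S] .
  have "presented_class X R w \<in> generate ?P ?S" if "w \<in> group_words X" for w
    using that
  proof (induct w)
    case Nil show ?case unfolding presented_one[symmetric] by (rule generate.one)
  next
    case (Cons l w)
    obtain b x where l: "l = (b, x)" by (cases l)
    have x: "x \<in> X" and w: "w \<in> group_words X" using Cons.prems by (auto simp: group_words_def l)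
    have letters: "[(c, x)] \<in> group_words X" for c using x by (simp add: group_words_def)
    have "presented_class X R [(b, x)] \<in> generate ?P ?S"
    proof (cases b)
      case True then show ?thesis using x by (auto intro: generate.incl)
    next
      case False
      have "presented_class X R [(False, x)] = inv\<^bsub>?P\<^esub> presented_class X R [(True, x)]"
        using presented_letter_cancel[OF x, of R False] letters
        by (intro P.inv_equality[symmetric]) (auto intro: presented_class_carrier)
      then show ?thesis using x False by (auto intro: generate.inv)
    qed
    then have "presented_class X R [(b, x)] \<otimes>\<^bsub>?P\<^esub> presented_class X R w \<in> generate ?P ?S"
      using Cons w by (auto intro: generate.eng)
    then show ?case using w letters by (simp add: presented_mult l)
  qed
  then show "carrier ?P \<subseteq> generate ?P ?S" by (auto simp: presented_group_def)
qed

section \<open>The tensor square\<close>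

context group
begin

lemma conj_by_closed: "x \<in> carrier G \<Longrightarrow> y \<in> carrier G \<Longrightarrow> conj_by G x y \<in> carrier G"
  by (simp add: conj_by_def)

lemma conj_by_conj_by:
  "x \<in> carrier G \<Longrightarrow> y \<in> carrier G \<Longrightarrow> z \<in> carrier G \<Longrightarrow>
     conj_by G (conj_by G x y) z = conj_by G x (y \<otimes> z)"
  by (simp add: conj_by_def inv_mult_group m_assoc)

lemma conj_by_mult:
  "x \<in> carrier G \<Longrightarrow> y \<in> carrier G \<Longrightarrow> z \<in> carrier G \<Longrightarrow>
     conj_by G (x \<otimes> y) z = conj_by G x z \<otimes> conj_by G y z"
  by (simp add: conj_by_def m_assoc inv_solve_left' ) (simp add: m_assoc[symmetric])

lemma conj_by_self: "x \<in> carrier G \<Longrightarrow> conj_by G x x = x"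
  by (simp add: conj_by_def)

lemma conj_by_inv_cancel:
  "x \<in> carrier G \<Longrightarrow> y \<in> carrier G \<Longrightarrow> conj_by G (conj_by G x (inv y)) y = x"
  by (simp add: conj_by_def m_assoc) (simp add: m_assoc[symmetric])

lemma conjugate_eqI:
  assumes "a \<otimes> g = g \<otimes> d" "a \<in> carrier G" "g \<in> carrier G" "d \<in> carrier G"
  shows "g \<otimes> d \<otimes> inv g = a" "inv g \<otimes> a \<otimes> g = d"
proof -
  have "g \<otimes> d \<otimes> inv g = a \<otimes> g \<otimes> inv g" using assms(1) by simp
  then show "g \<otimes> d \<otimes> inv g = a" using assms(2,3) by (simp add: m_assoc)
  have "inv g \<otimes> (a \<otimes> g) = inv g \<otimes> (g \<otimes> d)" using assms(1) by simp
  then show "inv g \<otimes> a \<otimes> g = d" using assms(2-4) by (simp add: m_assoc[symmetric])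
qed

lemma mult_conj_by_swap:
  "x \<in> carrier G \<Longrightarrow> y \<in> carrier G \<Longrightarrow> y \<otimes> conj_by G x y = x \<otimes> y"
  by (simp add: conj_by_def m_assoc[symmetric])

end

lemma tensor_square_group: "group (tensor_square G)"
  unfolding tensor_square_def by (rule presented_group_is_group)

lemma tensor_carrier:
  "x \<in> carrier G \<Longrightarrow> y \<in> carrier G \<Longrightarrow> tensor G x y \<in> carrier (tensor_square G)"
  unfolding tensor_square_def tensor_def
  by (rule presented_class_carrier) (simp add: group_words_def)

lemma tensor_square_generated:
  "carrier (tensor_square G) =
     generate (tensor_square G) {tensor G x y | x y. x \<in> carrier G \<and> y \<in> carrier G}"
  using presented_group_generated[of "carrier G \<times> carrier G" "tensor_relations G"]
  unfolding tensor_square_def tensor_def by simp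

lemma tensor_relation:
  assumes R: "([(True, a)], [(True, b), (True, c)]) \<in> tensor_relations G"
    and abc: "a \<in> carrier G \<times> carrier G" "b \<in> carrier G \<times> carrier G" "c \<in> carrier G \<times> carrier G"
  shows "tensor G (fst a) (snd a) =
    tensor G (fst b) (snd b) \<otimes>\<^bsub>tensor_square G\<^esub> tensor G (fst c) (snd c)"
proof -
  have w: "[(True, a)] \<in> group_words (carrier G \<times> carrier G)"
    "[(True, b)] \<in> group_words (carrier G \<times> carrier G)"
    "[(True, c)] \<in> group_words (carrier G \<times> carrier G)"
    "[(True, b), (True, c)] \<in> group_words (carrier G \<times> carrier G)"
    using abc by (auto simp: group_words_def)
  have "presented_eq (carrier G \<times> carrier G) (tensor_relations G) [(True, a)] [(True, b), (True, c)]"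
    using R w by (intro presented_eq.relator)
  then show ?thesis
    unfolding tensor_square_def tensor_def prod.collapse
    using w by (simp add: presented_mult presented_class_eq_iff)
qed

lemma tensor_mult_left:
  assumes "group G" "x \<in> carrier G" "y \<in> carrier G" "z \<in> carrier G"
  shows "tensor G (x \<otimes>\<^bsub>G\<^esub> y) z =
    tensor G (conj_by G x y) (conj_by G z y) \<otimes>\<^bsub>tensor_square G\<^esub> tensor G y z"
  using tensor_relation[of "(x \<otimes>\<^bsub>G\<^esub> y, z)" "(conj_by G x y, conj_by G z y)" "(y, z)" G] assms
  by (auto simp: tensor_relations_def group.conj_by_closed group.is_monoid monoid.m_closed)

lemma tensor_mult_right:
  assumes "group G" "y \<in> carrier G" "z \<in> carrier G" "t \<in> carrier G"
  shows "tensor G y (t \<otimes>\<^bsub>G\<^esub> z) =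
    tensor G y z \<otimes>\<^bsub>tensor_square G\<^esub> tensor G (conj_by G y z) (conj_by G t z)"
  using tensor_relation[of "(y, t \<otimes>\<^bsub>G\<^esub> z)" "(y, z)" "(conj_by G y z, conj_by G t z)" G] assms
  by (auto simp: tensor_relations_def group.conj_by_closed group.is_monoid monoid.m_closed)

lemma tensor_square_universal:
  assumes G: "group G" and H: "group H"
    and f: "\<And>x y. x \<in> carrier G \<Longrightarrow> y \<in> carrier G \<Longrightarrow> f x y \<in> carrier H"
    and left: "\<And>x y z. x \<in> carrier G \<Longrightarrow> y \<in> carrier G \<Longrightarrow> z \<in> carrier G \<Longrightarrow>
      f (x \<otimes>\<^bsub>G\<^esub> y) z = f (conj_by G x y) (conj_by G z y) \<otimes>\<^bsub>H\<^esub> f y z"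
    and right: "\<And>y z t. y \<in> carrier G \<Longrightarrow> z \<in> carrier G \<Longrightarrow> t \<in> carrier G \<Longrightarrow>
      f y (t \<otimes>\<^bsub>G\<^esub> z) = f y z \<otimes>\<^bsub>H\<^esub> f (conj_by G y z) (conj_by G t z)"
  obtains h where "h \<in> hom (tensor_square G) H"
    and "\<And>x y. x \<in> carrier G \<Longrightarrow> y \<in> carrier G \<Longrightarrow> h (tensor G x y) = f x y"
proof -
  interpret H: group H by fact
  interpret G: group G by fact
  let ?X = "carrier G \<times> carrier G"
  have f': "case_prod f \<in> ?X \<rightarrow> carrier H" using f by auto
  have "word_value H (case_prod f) u = word_value H (case_prod f) v"
    if "(u, v) \<in> tensor_relations G" for u v
    using that unfolding tensor_relations_def
  proof (elim UnE CollectE exE conjE)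
    fix x y z
    assume "x \<in> carrier G" "y \<in> carrier G" "z \<in> carrier G" and uv: "(u, v) =
      ([(True, x \<otimes>\<^bsub>G\<^esub> y, z)], [(True, conj_by G x y, conj_by G z y), (True, y, z)])"
    then show ?thesis using left f G.conj_by_closed by simp
  next
    fix y z t
    assume "y \<in> carrier G" "z \<in> carrier G" "t \<in> carrier G" and uv: "(u, v) =
      ([(True, y, t \<otimes>\<^bsub>G\<^esub> z)], [(True, y, z), (True, conj_by G y z, conj_by G t z)])"
    then show ?thesis using right f G.conj_by_closed by simp
  qed
  from presented_group_universal[OF H f' this] obtain h
    where h: "h \<in> hom (presented_group ?X (tensor_relations G)) H"
      "\<And>a. a \<in> ?X \<Longrightarrow> h (presented_class ?X (tensor_relations G) [(True, a)]) = case_prod f a"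
    by blast
  show thesis
    using that[of h] h unfolding tensor_square_def tensor_def by auto
qed

text \<open>Expand \<open>xy \<otimes> tz\<close>, splitting the left entry first or the right entry first. The two results
  begin and end with the same factors, and cancelling these leaves the claim. It says that \<open>y \<otimes> z\<close>
  conjugates a tensor \<open>a \<otimes> b\<close> into the tensor whose entries are \<open>a\<close> and \<open>b\<close> conjugated by a commutator of \<open>y\<close> and \<open>z\<close>.\<close>

lemma tensor_conj:
  assumes G: "group G"
    and c: "x \<in> carrier G" "y \<in> carrier G" "z \<in> carrier G" "t \<in> carrier G"
  shows "tensor G (conj_by G x (z \<otimes>\<^bsub>G\<^esub> y)) (conj_by G t (z \<otimes>\<^bsub>G\<^esub> y)) \<otimes>\<^bsub>tensor_square G\<^esub> tensor G y z =
    tensor G y z \<otimes>\<^bsub>tensor_square G\<^esub> tensor G (conj_by G x (y \<otimes>\<^bsub>G\<^esub> z)) (conj_by G t (y \<otimes>\<^bsub>G\<^esub> z))"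
proof -
  let ?T = "tensor_square G"
  interpret G: group G by fact
  interpret T: group "tensor_square G" by (rule tensor_square_group)
  note cl = c G.conj_by_closed G.m_closed tensor_carrier T.m_closed
  let ?x = "tensor G (conj_by G x y) (conj_by G z y)"
  let ?t = "tensor G (conj_by G y z) (conj_by G t z)"
  let ?yz = "tensor G y z"
  have "tensor G (x \<otimes>\<^bsub>G\<^esub> y) (t \<otimes>\<^bsub>G\<^esub> z) =
      tensor G (conj_by G x y) (conj_by G t y \<otimes>\<^bsub>G\<^esub> conj_by G z y) \<otimes>\<^bsub>?T\<^esub>
      (?yz \<otimes>\<^bsub>?T\<^esub> ?t)"
    using tensor_mult_left[OF G c(1,2), of "t \<otimes>\<^bsub>G\<^esub> z"] tensor_mult_right[OF G c(2,3,4)]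
      G.conj_by_mult[OF c(4,3,2)] c by simp
  also have "tensor G (conj_by G x y) (conj_by G t y \<otimes>\<^bsub>G\<^esub> conj_by G z y) =
      ?x \<otimes>\<^bsub>?T\<^esub> tensor G (conj_by G x (z \<otimes>\<^bsub>G\<^esub> y)) (conj_by G t (z \<otimes>\<^bsub>G\<^esub> y))"
    using tensor_mult_right[OF G, of "conj_by G x y" "conj_by G z y" "conj_by G t y"] c
    by (simp add: G.conj_by_conj_by G.mult_conj_by_swap G.conj_by_closed)
  finally have 1: "tensor G (x \<otimes>\<^bsub>G\<^esub> y) (t \<otimes>\<^bsub>G\<^esub> z) = ?x \<otimes>\<^bsub>?T\<^esub>
      tensor G (conj_by G x (z \<otimes>\<^bsub>G\<^esub> y)) (conj_by G t (z \<otimes>\<^bsub>G\<^esub> y)) \<otimes>\<^bsub>?T\<^esub>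
      (?yz \<otimes>\<^bsub>?T\<^esub> ?t)" .
  have "tensor G (x \<otimes>\<^bsub>G\<^esub> y) (t \<otimes>\<^bsub>G\<^esub> z) =
      (?x \<otimes>\<^bsub>?T\<^esub> ?yz) \<otimes>\<^bsub>?T\<^esub>
      tensor G (conj_by G x z \<otimes>\<^bsub>G\<^esub> conj_by G y z) (conj_by G t z)"
    using tensor_mult_right[OF G _ c(3,4), of "x \<otimes>\<^bsub>G\<^esub> y"] tensor_mult_left[OF G c(1,2,3)]
      G.conj_by_mult[OF c(1,2,3)] c by simp
  also have "tensor G (conj_by G x z \<otimes>\<^bsub>G\<^esub> conj_by G y z) (conj_by G t z) =
      tensor G (conj_by G x (y \<otimes>\<^bsub>G\<^esub> z)) (conj_by G t (y \<otimes>\<^bsub>G\<^esub> z)) \<otimes>\<^bsub>?T\<^esub> ?t"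
    using tensor_mult_left[OF G, of "conj_by G x z" "conj_by G y z" "conj_by G t z"] c
    by (simp add: G.conj_by_conj_by G.mult_conj_by_swap G.conj_by_closed)
  finally have 2: "tensor G (x \<otimes>\<^bsub>G\<^esub> y) (t \<otimes>\<^bsub>G\<^esub> z) = ?x \<otimes>\<^bsub>?T\<^esub> ?yz \<otimes>\<^bsub>?T\<^esub>
      (tensor G (conj_by G x (y \<otimes>\<^bsub>G\<^esub> z)) (conj_by G t (y \<otimes>\<^bsub>G\<^esub> z)) \<otimes>\<^bsub>?T\<^esub> ?t)" .
  let ?l = "tensor G (conj_by G x (z \<otimes>\<^bsub>G\<^esub> y)) (conj_by G t (z \<otimes>\<^bsub>G\<^esub> y))"
  let ?r = "tensor G (conj_by G x (y \<otimes>\<^bsub>G\<^esub> z)) (conj_by G t (y \<otimes>\<^bsub>G\<^esub> z))"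
  have m: "?x \<in> carrier (tensor_square G)" "?t \<in> carrier (tensor_square G)"
    "?yz \<in> carrier (tensor_square G)" "?l \<in> carrier (tensor_square G)" "?r \<in> carrier (tensor_square G)"
    using c by (simp_all add: tensor_carrier G.conj_by_closed)
  have "?x \<otimes>\<^bsub>?T\<^esub> ((?l \<otimes>\<^bsub>?T\<^esub> ?yz) \<otimes>\<^bsub>?T\<^esub> ?t) =
      ?x \<otimes>\<^bsub>?T\<^esub> ((?yz \<otimes>\<^bsub>?T\<^esub> ?r) \<otimes>\<^bsub>?T\<^esub> ?t)"
    using HOL.trans[OF 1[symmetric] 2] m by (simp only: T.m_assoc T.m_closed)
  then have "(?l \<otimes>\<^bsub>?T\<^esub> ?yz) \<otimes>\<^bsub>?T\<^esub> ?t =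
      (?yz \<otimes>\<^bsub>?T\<^esub> ?r) \<otimes>\<^bsub>?T\<^esub> ?t"
    using m T.Units_l_cancel T.Units_eq T.m_closed by metis
  then show ?thesis using m T.right_cancel T.m_closed by metis
qed

definition diagonal_tensors :: "('a, 'm) monoid_scheme \<Rightarrow> ('a \<times> 'a) group_word set set" where
  "diagonal_tensors G = generate (tensor_square G) {tensor G x x | x. x \<in> carrier G}"

text \<open>By \<open>tensor_conj\<close> with \<open>x = t\<close>, a generator \<open>y \<otimes> z\<close> and its inverse conjugate \<open>a \<otimes> a\<close> into
  another tensor of this form. The property passes to products, hence to the whole group.\<close>

lemma diagonal_tensors_normal:
  assumes G: "group G"
  shows "diagonal_tensors G \<lhd> tensor_square G"
proof -
  interpret G: group G by fact
  interpret T: group "tensor_square G" by (rule tensor_square_group)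
  let ?T = "tensor_square G"
  let ?D = "{tensor G x x | x. x \<in> carrier G}"
  have D: "?D \<subseteq> carrier ?T" by (auto intro: tensor_carrier)
  have gens: "g \<otimes>\<^bsub>?T\<^esub> d \<otimes>\<^bsub>?T\<^esub> inv\<^bsub>?T\<^esub> g \<in> ?D \<and> inv\<^bsub>?T\<^esub> g \<otimes>\<^bsub>?T\<^esub> d \<otimes>\<^bsub>?T\<^esub> g \<in> ?D"
    if "d \<in> ?D" "y \<in> carrier G" "z \<in> carrier G" "g = tensor G y z" for d g y z
  proof -
    obtain a where a: "a \<in> carrier G" "d = tensor G a a" using \<open>d \<in> ?D\<close> by blast
    have g: "g \<in> carrier ?T" using that(2-4) tensor_carrier by simp
    have dc: "d \<in> carrier ?T" using a tensor_carrier by simp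
    \<comment> \<open>the conjugates to which \<open>tensor_conj\<close> is applied so that \<open>a\<close> itself appears on one side\<close>
    let ?u = "conj_by G a (inv\<^bsub>G\<^esub> (y \<otimes>\<^bsub>G\<^esub> z))" and ?v = "conj_by G a (inv\<^bsub>G\<^esub> (z \<otimes>\<^bsub>G\<^esub> y))"
    have uv: "?u \<in> carrier G" "?v \<in> carrier G" using a that by (simp_all add: G.conj_by_closed)
    let ?u' = "conj_by G ?u (z \<otimes>\<^bsub>G\<^esub> y)" and ?v' = "conj_by G ?v (y \<otimes>\<^bsub>G\<^esub> z)"
    have uv': "?u' \<in> carrier G" "?v' \<in> carrier G" using uv that by (simp_all add: G.conj_by_closed)
    have "tensor G ?u' ?u' \<otimes>\<^bsub>?T\<^esub> g = g \<otimes>\<^bsub>?T\<^esub> d"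
      using tensor_conj[OF G uv(1) _ _ uv(1), of y z] that a by (simp add: G.conj_by_inv_cancel)
    then have "g \<otimes>\<^bsub>?T\<^esub> d \<otimes>\<^bsub>?T\<^esub> inv\<^bsub>?T\<^esub> g = tensor G ?u' ?u'"
      using g dc tensor_carrier[OF uv'(1) uv'(1)] by (intro T.conjugate_eqI)
    moreover have "d \<otimes>\<^bsub>?T\<^esub> g = g \<otimes>\<^bsub>?T\<^esub> tensor G ?v' ?v'"
      using tensor_conj[OF G uv(2) _ _ uv(2), of y z] that a by (simp add: G.conj_by_inv_cancel)
    then have "inv\<^bsub>?T\<^esub> g \<otimes>\<^bsub>?T\<^esub> d \<otimes>\<^bsub>?T\<^esub> g = tensor G ?v' ?v'"
      using g dc tensor_carrier[OF uv'(2) uv'(2)] by (intro T.conjugate_eqI)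
    ultimately show ?thesis using uv' by blast
  qed
  have "\<forall>d\<in>?D. g \<otimes>\<^bsub>?T\<^esub> d \<otimes>\<^bsub>?T\<^esub> inv\<^bsub>?T\<^esub> g \<in> ?D \<and> inv\<^bsub>?T\<^esub> g \<otimes>\<^bsub>?T\<^esub> d \<otimes>\<^bsub>?T\<^esub> g \<in> ?D"
    if "g \<in> generate ?T {tensor G x y | x y. x \<in> carrier G \<and> y \<in> carrier G}" for g
    using that
  proof (induct g rule: generate.induct)
    case one
    show ?case
    proof
      fix d assume d: "d \<in> ?D"
      then have "d \<in> carrier ?T" using D by blast
      then show "\<one>\<^bsub>?T\<^esub> \<otimes>\<^bsub>?T\<^esub> d \<otimes>\<^bsub>?T\<^esub> inv\<^bsub>?T\<^esub> \<one>\<^bsub>?T\<^esub> \<in> ?D \<and> inv\<^bsub>?T\<^esub> \<one>\<^bsub>?T\<^esub> \<otimes>\<^bsub>?T\<^esub> d \<otimes>\<^bsub>?T\<^esub> \<one>\<^bsub>?T\<^esub> \<in> ?D"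
        using d by (simp del: mem_Collect_eq)
    qed
  next
    case (incl g)
    then show ?case using gens by blast
  next
    case (inv g)
    then have g: "g \<in> carrier ?T" by (auto intro: tensor_carrier)
    obtain y z where "y \<in> carrier G" "z \<in> carrier G" "g = tensor G y z" using inv by blast
    then show ?case using gens g by (auto simp del: mem_Collect_eq)
  next
    case (eng g h)
    then have c: "g \<in> carrier ?T" "h \<in> carrier ?T" using tensor_square_generated by metis+
    show ?case
    proof (intro ballI conjI)
      fix d assume d: "d \<in> ?D"
      then have dc: "d \<in> carrier ?T" using D by blast
      have "g \<otimes>\<^bsub>?T\<^esub> (h \<otimes>\<^bsub>?T\<^esub> d \<otimes>\<^bsub>?T\<^esub> inv\<^bsub>?T\<^esub> h) \<otimes>\<^bsub>?T\<^esub> inv\<^bsub>?T\<^esub> g \<in> ?D" using eng d by blast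
      then show "g \<otimes>\<^bsub>?T\<^esub> h \<otimes>\<^bsub>?T\<^esub> d \<otimes>\<^bsub>?T\<^esub> inv\<^bsub>?T\<^esub> (g \<otimes>\<^bsub>?T\<^esub> h) \<in> ?D"
        using c dc by (simp only: T.inv_mult_group T.m_assoc T.m_closed T.inv_closed)
      have "inv\<^bsub>?T\<^esub> h \<otimes>\<^bsub>?T\<^esub> (inv\<^bsub>?T\<^esub> g \<otimes>\<^bsub>?T\<^esub> d \<otimes>\<^bsub>?T\<^esub> g) \<otimes>\<^bsub>?T\<^esub> h \<in> ?D" using eng d by blast
      then show "inv\<^bsub>?T\<^esub> (g \<otimes>\<^bsub>?T\<^esub> h) \<otimes>\<^bsub>?T\<^esub> d \<otimes>\<^bsub>?T\<^esub> (g \<otimes>\<^bsub>?T\<^esub> h) \<in> ?D"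
        using c dc by (simp only: T.inv_mult_group T.m_assoc T.m_closed T.inv_closed)
    qed
  qed
  then have "g \<otimes>\<^bsub>?T\<^esub> d \<otimes>\<^bsub>?T\<^esub> inv\<^bsub>?T\<^esub> g \<in> ?D" if "g \<in> carrier ?T" "d \<in> ?D" for g d
    using that tensor_square_generated by blast
  then show ?thesis unfolding diagonal_tensors_def using T.normal_generateI[OF D] by blast
qed

text \<open>The wedge is antisymmetric: expanding \<open>uy \<otimes> uy\<close> gives \<open>x \<otimes> y\<close> and \<open>y \<otimes> x\<close>, separated only by diagonal tensors.\<close>

lemma tensor_swap_mem:
  assumes G: "group G" and K: "K \<lhd> tensor_square G"
    and diag: "\<And>a. a \<in> carrier G \<Longrightarrow> tensor G a a \<in> K"
    and c: "x \<in> carrier G" "y \<in> carrier G" and xy: "tensor G x y \<in> K"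
  shows "tensor G y x \<in> K"
proof -
  let ?T = "tensor_square G"
  interpret G: group G by fact
  interpret T: group "tensor_square G" by (rule tensor_square_group)
  interpret K: normal K "tensor_square G" by fact
  \<comment> \<open>chosen so that \<open>u\<close> conjugated by \<open>y\<close> is \<open>x\<close>, which makes \<open>x \<otimes> y\<close> appear\<close>
  define u where "u = conj_by G x (inv\<^bsub>G\<^esub> y)"
  have u: "u \<in> carrier G" "conj_by G u y = x" using c by (simp_all add: u_def G.conj_by_closed G.conj_by_inv_cancel)
  note cl = c u G.conj_by_closed G.m_closed tensor_carrier T.m_closed
  have "tensor G (u \<otimes>\<^bsub>G\<^esub> y) (u \<otimes>\<^bsub>G\<^esub> y) =
      tensor G x (x \<otimes>\<^bsub>G\<^esub> y) \<otimes>\<^bsub>?T\<^esub> tensor G y (u \<otimes>\<^bsub>G\<^esub> y)"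
    by (simp add: tensor_mult_left[OF G] cl G.conj_by_mult G.conj_by_self)
  also have "\<dots> = (tensor G x y \<otimes>\<^bsub>?T\<^esub> tensor G (conj_by G x y) (conj_by G x y))
      \<otimes>\<^bsub>?T\<^esub> (tensor G y y \<otimes>\<^bsub>?T\<^esub> tensor G y x)"
    by (simp add: tensor_mult_right[OF G] cl G.conj_by_self)
  finally have "tensor G (u \<otimes>\<^bsub>G\<^esub> y) (u \<otimes>\<^bsub>G\<^esub> y) = \<dots>" .
  moreover have "tensor G (u \<otimes>\<^bsub>G\<^esub> y) (u \<otimes>\<^bsub>G\<^esub> y) \<in> K" by (intro diag cl)
  moreover have 1: "tensor G x y \<otimes>\<^bsub>?T\<^esub> tensor G (conj_by G x y) (conj_by G x y) \<in> K"
    by (intro K.m_closed xy diag cl)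
  moreover have yy: "tensor G y y \<in> K" by (intro diag cl)
  have cancel: "b \<in> K" if "a \<otimes>\<^bsub>?T\<^esub> b \<in> K" "a \<in> K" "b \<in> carrier (tensor_square G)" for a b
  proof -
    have "inv\<^bsub>?T\<^esub> a \<otimes>\<^bsub>?T\<^esub> (a \<otimes>\<^bsub>?T\<^esub> b) \<in> K"
      by (intro K.m_closed K.m_inv_closed that)
    then show ?thesis using K.mem_carrier[OF that(2)] that(3) by (simp add: T.m_assoc[symmetric])
  qed
  ultimately have "tensor G y y \<otimes>\<^bsub>?T\<^esub> tensor G y x \<in> K"
    using cancel[OF _ 1] T.m_closed[OF tensor_carrier[OF c(2,2)] tensor_carrier[OF c(2,1)]] by metis
  then show ?thesis using cancel[OF _ yy] tensor_carrier[OF c(2,1)] by metis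
qed

section \<open>Inverse limits of quotients\<close>

lemma quotient_limit_mem:
  "f \<in> carrier (quotient_limit A \<N>) \<longleftrightarrow>
     f \<in> (\<Pi>\<^sub>E N\<in>\<N>. carrier (A Mod N)) \<and> (\<forall>M\<in>\<N>. \<forall>N\<in>\<N>. M \<subseteq> N \<longrightarrow> f N = N <#>\<^bsub>A\<^esub> f M)"
  by (simp add: quotient_limit_def)

lemma quotient_limit_PiE:
  "f \<in> carrier (quotient_limit A \<N>) \<Longrightarrow> f \<in> (\<Pi>\<^sub>E N\<in>\<N>. carrier (A Mod N))"
  by (simp add: quotient_limit_def)

lemma quotient_limit_coordinate:
  "f \<in> carrier (quotient_limit A \<N>) \<Longrightarrow> N \<in> \<N> \<Longrightarrow> f N \<in> carrier (A Mod N)"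
  using PiE_mem[OF quotient_limit_PiE] .

lemma quotient_limit_compat:
  "f \<in> carrier (quotient_limit A \<N>) \<Longrightarrow> M \<in> \<N> \<Longrightarrow> N \<in> \<N> \<Longrightarrow> M \<subseteq> N \<Longrightarrow> f N = N <#>\<^bsub>A\<^esub> f M"
  unfolding quotient_limit_mem by blast

lemma set_mult_rcos_of_smaller:
  assumes A: "group A" and "M \<lhd> A" "N \<lhd> A" "M \<subseteq> N" and a: "a \<in> carrier A"
  shows "N <#>\<^bsub>A\<^esub> (M #>\<^bsub>A\<^esub> a) = N #>\<^bsub>A\<^esub> a"
proof -
  interpret A: group A by fact
  interpret M: normal M A by fact
  interpret N: normal N A by fact
  have "N <#>\<^bsub>A\<^esub> M = N"
  proof
    show "N <#>\<^bsub>A\<^esub> M \<subseteq> N" using \<open>M \<subseteq> N\<close> by (auto simp: set_mult_def)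
    have "x \<otimes>\<^bsub>A\<^esub> \<one>\<^bsub>A\<^esub> \<in> N <#>\<^bsub>A\<^esub> M" if "x \<in> N" for x
      using that M.one_closed unfolding set_mult_def by blast
    then show "N \<subseteq> N <#>\<^bsub>A\<^esub> M" using A.r_one N.mem_carrier by (metis subsetI)
  qed
  then show ?thesis using A.setmult_rcos_assoc[OF N.subset M.subset a] by simp
qed

lemma quotient_limit_subgroup:
  assumes A: "group A" and normals: "\<And>N. N \<in> \<N> \<Longrightarrow> N \<lhd> A"
  shows "subgroup (carrier (quotient_limit A \<N>)) (product_group \<N> (\<lambda>N. A Mod N))"
proof -
  interpret A: group A by fact
  let ?P = "product_group \<N> (\<lambda>N. A Mod N)"
  have Mod: "group (A Mod N)" if "N \<in> \<N>" for N
    using normal.factorgroup_is_group[OF normals[OF that]] .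
  interpret P: group ?P by (rule product_group) (rule Mod)
  note proj = set_mult_rcos_of_smaller[OF A normals normals]
  show ?thesis
  proof (rule P.subgroupI)
    show "carrier (quotient_limit A \<N>) \<subseteq> carrier ?P"
      by (auto simp: quotient_limit_def)
    have "\<one>\<^bsub>?P\<^esub> \<in> carrier (quotient_limit A \<N>)"
      unfolding quotient_limit_mem
    proof (intro conjI ballI impI)
      show "\<one>\<^bsub>?P\<^esub> \<in> (\<Pi>\<^sub>E N\<in>\<N>. carrier (A Mod N))" using P.one_closed by simp
      fix M N assume "M \<in> \<N>" "N \<in> \<N>" "M \<subseteq> N"
      then show "\<one>\<^bsub>?P\<^esub> N = N <#>\<^bsub>A\<^esub> \<one>\<^bsub>?P\<^esub> M"
        using proj[of M N "\<one>\<^bsub>A\<^esub>"] normals[of M] normals[of N]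
        by (simp add: normal_imp_subgroup subgroup.subset)
    qed
    then show "carrier (quotient_limit A \<N>) \<noteq> {}" by blast
  next
    fix f assume f: "f \<in> carrier (quotient_limit A \<N>)"
    then have fP: "f \<in> carrier ?P" by (simp add: quotient_limit_PiE)
    show "inv\<^bsub>?P\<^esub> f \<in> carrier (quotient_limit A \<N>)"
      unfolding quotient_limit_mem
    proof (intro conjI ballI impI)
      show "inv\<^bsub>?P\<^esub> f \<in> (\<Pi>\<^sub>E N\<in>\<N>. carrier (A Mod N))" using P.inv_closed[OF fP] by simp
      fix M N assume MN: "M \<in> \<N>" "N \<in> \<N>" "M \<subseteq> N"
      obtain a where a: "a \<in> carrier A" "f M = M #>\<^bsub>A\<^esub> a"
        using fP MN(1) by (auto simp: carrier_FactGroup PiE_iff)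
      have fN: "f N = N #>\<^bsub>A\<^esub> a" using quotient_limit_compat[OF f MN] MN a proj by simp
      then show "(inv\<^bsub>?P\<^esub> f) N = N <#>\<^bsub>A\<^esub> (inv\<^bsub>?P\<^esub> f) M"
        using MN a proj fP normals Mod
        by (simp add: inv_product_group normal.inv_FactGroup carrier_FactGroup normal.rcos_inv)
    qed
  next
    fix f g assume f: "f \<in> carrier (quotient_limit A \<N>)" and g: "g \<in> carrier (quotient_limit A \<N>)"
    then have fP: "f \<in> carrier ?P" and gP: "g \<in> carrier ?P" by (simp_all add: quotient_limit_PiE)
    show "f \<otimes>\<^bsub>?P\<^esub> g \<in> carrier (quotient_limit A \<N>)"
      unfolding quotient_limit_mem
    proof (intro conjI ballI impI)
      show "f \<otimes>\<^bsub>?P\<^esub> g \<in> (\<Pi>\<^sub>E N\<in>\<N>. carrier (A Mod N))" using P.m_closed[OF fP gP] by simp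
      fix M N assume MN: "M \<in> \<N>" "N \<in> \<N>" "M \<subseteq> N"
      obtain a where a: "a \<in> carrier A" "f M = M #>\<^bsub>A\<^esub> a"
        using fP MN(1) by (auto simp: carrier_FactGroup PiE_iff)
      obtain b where b: "b \<in> carrier A" "g M = M #>\<^bsub>A\<^esub> b"
        using gP MN(1) by (auto simp: carrier_FactGroup PiE_iff)
      have "f N = N #>\<^bsub>A\<^esub> a" "g N = N #>\<^bsub>A\<^esub> b"
        using quotient_limit_compat[OF f MN] quotient_limit_compat[OF g MN] MN a b proj by simp_all
      then show "(f \<otimes>\<^bsub>?P\<^esub> g) N = N <#>\<^bsub>A\<^esub> (f \<otimes>\<^bsub>?P\<^esub> g) M"
        using MN a b proj normals by (simp add: normal.rcos_sum)
    qed
  qed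
qed

lemma quotient_limit_group:
  assumes A: "group A" and normals: "\<And>N. N \<in> \<N> \<Longrightarrow> N \<lhd> A"
  shows "group (quotient_limit A \<N>)"
proof -
  have "group (product_group \<N> (\<lambda>N. A Mod N))"
    using normals normal.factorgroup_is_group by (intro product_group) blast
  from subgroup.subgroup_is_group[OF quotient_limit_subgroup[OF A normals] this]
  show ?thesis by (simp add: quotient_limit_def)
qed

lemma quotient_limit_mult:
  "N \<in> \<N> \<Longrightarrow> (f \<otimes>\<^bsub>quotient_limit A \<N>\<^esub> g) N = f N <#>\<^bsub>A\<^esub> g N"
  by (simp add: quotient_limit_def)

lemma to_quotient_limit_hom:
  assumes A: "group A" and normals: "\<And>N. N \<in> \<N> \<Longrightarrow> N \<lhd> A"
  shows "to_quotient_limit A \<N> \<in> hom A (quotient_limit A \<N>)"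
proof (rule homI)
  interpret A: group A by fact
  show "to_quotient_limit A \<N> a \<in> carrier (quotient_limit A \<N>)" if a: "a \<in> carrier A" for a
    unfolding quotient_limit_mem
  proof (intro conjI ballI impI)
    show "to_quotient_limit A \<N> a \<in> (\<Pi>\<^sub>E N\<in>\<N>. carrier (A Mod N))"
      using a by (auto simp: to_quotient_limit_def carrier_FactGroup)
    fix M N assume MN: "M \<in> \<N>" "N \<in> \<N>" "M \<subseteq> N"
    show "to_quotient_limit A \<N> a N = N <#>\<^bsub>A\<^esub> to_quotient_limit A \<N> a M"
      using set_mult_rcos_of_smaller[OF A normals normals _ a] MN by (simp add: to_quotient_limit_def)
  qed
  show "to_quotient_limit A \<N> (a \<otimes>\<^bsub>A\<^esub> b) =
      to_quotient_limit A \<N> a \<otimes>\<^bsub>quotient_limit A \<N>\<^esub> to_quotient_limit A \<N> b"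
    if "a \<in> carrier A" "b \<in> carrier A" for a b
    using that normals by (auto simp: to_quotient_limit_def quotient_limit_def normal.rcos_sum fun_eq_iff)
qed

lemma topspace_quotient_limit_topology:
  "topspace (quotient_limit_topology A \<N>) = carrier (quotient_limit A \<N>)"
proof -
  have "carrier (quotient_limit A \<N>) \<subseteq> (\<Pi>\<^sub>E N\<in>\<N>. carrier (A Mod N))"
    using quotient_limit_PiE by blast
  then show ?thesis unfolding quotient_limit_topology_def topspace_subtopology by simp blast
qed

lemma openin_quotient_limit_coordinate:
  assumes "N \<in> \<N>"
  shows "openin (quotient_limit_topology A \<N>) {f \<in> carrier (quotient_limit A \<N>). f N \<in> S}"
proof -
  let ?X = "product_topology (\<lambda>N. discrete_topology (carrier (A Mod N))) \<N>"
  have "openin ?X {f \<in> topspace ?X. f N \<in> S \<inter> carrier (A Mod N)}"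
    by (rule openin_continuous_map_preimage[OF continuous_map_product_projection[OF assms]]) simp
  moreover have "f \<in> topspace ?X \<and> f N \<in> carrier (A Mod N)"
    if "f \<in> carrier (quotient_limit A \<N>)" for f
    using quotient_limit_PiE[OF that] quotient_limit_coordinate[OF that assms] by simp
  then have "{f \<in> carrier (quotient_limit A \<N>). f N \<in> S} =
      {f \<in> topspace ?X. f N \<in> S \<inter> carrier (A Mod N)} \<inter> carrier (quotient_limit A \<N>)"
    by blast
  ultimately show ?thesis unfolding quotient_limit_topology_def openin_subtopology by blast
qed

text \<open>A basic open set of the product restricts only finitely many coordinates.\<close>

lemma quotient_limit_neighbourhood:
  assumes U: "openin (quotient_limit_topology A \<N>) U" and f: "f \<in> U"
  obtains F where "finite F" "F \<subseteq> \<N>"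
    "\<forall>g\<in>carrier (quotient_limit A \<N>). (\<forall>N\<in>F. g N = f N) \<longrightarrow> g \<in> U"
proof -
  let ?X = "product_topology (\<lambda>N. discrete_topology (carrier (A Mod N))) \<N>"
  obtain W where W: "openin ?X W" "U = W \<inter> carrier (quotient_limit A \<N>)"
    using U unfolding quotient_limit_topology_def openin_subtopology by blast
  then obtain V where V: "finite {N \<in> \<N>. V N \<noteq> carrier (A Mod N)}"
      "f \<in> Pi\<^sub>E \<N> V" "Pi\<^sub>E \<N> V \<subseteq> W"
    using f unfolding openin_product_topology_alt by fastforce
  show thesis
  proof (rule that[OF V(1)]; (intro ballI impI)?)
    fix g assume g: "g \<in> carrier (quotient_limit A \<N>)"
      and eq: "\<forall>N\<in>{N \<in> \<N>. V N \<noteq> carrier (A Mod N)}. g N = f N"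
    have "g N \<in> V N" if "N \<in> \<N>" for N
      using quotient_limit_coordinate[OF g that] eq V(2) that by (cases "V N = carrier (A Mod N)") auto
    then have "g \<in> Pi\<^sub>E \<N> V" using quotient_limit_PiE[OF g] by auto
    then show "g \<in> U" using V(3) W(2) g by blast
  qed auto
qed

lemma finite_Inter_in_family:
  assumes "finite F" "F \<subseteq> \<N>" "C \<in> \<N>" "\<And>M N. M \<in> \<N> \<Longrightarrow> N \<in> \<N> \<Longrightarrow> M \<inter> N \<in> \<N>"
  shows "C \<inter> \<Inter>F \<in> \<N>"
  using assms(1,2)
proof (induct F)
  case (insert N F)
  then have "N \<inter> (C \<inter> \<Inter>F) \<in> \<N>" using assms(4) by blast
  moreover have "N \<inter> (C \<inter> \<Inter>F) = C \<inter> \<Inter>(insert N F)" by blast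
  ultimately show ?case by simp
qed (use assms in simp)

text \<open>The closure is read off coordinatewise. Points of the closure agree in any one coordinate with
  an element of the subgroup, which gives one inclusion. Conversely a neighbourhood of \<open>f\<close> looks at finitely many
  members of \<open>\<N>\<close>, hence at a single one, their intersection \<open>M\<close>. The product of \<open>M\<close> with the
  generated subgroup is again in \<open>\<N>\<close> and contains \<open>S\<close>, so the hypothesis on \<open>f\<close> puts \<open>f M\<close> into the image of that subgroup.\<close>

lemma closure_of_generate_quotient_limit:
  assumes A: "group A" and normals: "\<And>N. N \<in> \<N> \<Longrightarrow> N \<lhd> A"
    and whole: "carrier A \<in> \<N>"
    and inter: "\<And>M N. M \<in> \<N> \<Longrightarrow> N \<in> \<N> \<Longrightarrow> M \<inter> N \<in> \<N>"
    and up: "\<And>M N. M \<in> \<N> \<Longrightarrow> N \<lhd> A \<Longrightarrow> M \<subseteq> N \<Longrightarrow> N \<in> \<N>"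
    and S: "S \<subseteq> carrier A" and D: "generate A S \<lhd> A"
  shows "quotient_limit_topology A \<N> closure_of
      generate (quotient_limit A \<N>) (to_quotient_limit A \<N> ` S) =
    {f \<in> carrier (quotient_limit A \<N>). \<forall>N\<in>\<N>. S \<subseteq> N \<longrightarrow> f N = N}"
proof -
  interpret A: group A by fact
  interpret L: group "quotient_limit A \<N>" using quotient_limit_group[OF A normals] .
  interpret i: group_hom A "quotient_limit A \<N>" "to_quotient_limit A \<N>"
    using to_quotient_limit_hom[OF A normals] by unfold_locales
  have gen: "generate (quotient_limit A \<N>) (to_quotient_limit A \<N> ` S) =
      to_quotient_limit A \<N> ` generate A S"
    using i.generate_img[OF S] .
  show ?thesis unfolding gen
  proof (rule equalityI; rule subsetI, (rule CollectI, intro conjI ballI impI)?)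
    fix f assume f: "f \<in> quotient_limit_topology A \<N> closure_of to_quotient_limit A \<N> ` generate A S"
    show fL: "f \<in> carrier (quotient_limit A \<N>)"
      using closure_of_subset_topspace[of "quotient_limit_topology A \<N>"] f
      unfolding topspace_quotient_limit_topology by (rule subsetD)
    fix N assume N: "N \<in> \<N>" "S \<subseteq> N"
    have "f \<in> {g \<in> carrier (quotient_limit A \<N>). g N \<in> {f N}}"
      by (intro CollectI conjI fL singletonI)
    from f[unfolded in_closure_of, THEN conjunct2, THEN spec, THEN mp, OF conjI,
        OF this openin_quotient_limit_coordinate[OF N(1)]]
    obtain y where y: "y \<in> to_quotient_limit A \<N> ` generate A S"
        "y \<in> {g \<in> carrier (quotient_limit A \<N>). g N \<in> {f N}}"
      by (elim exE conjE)
    from y(1) obtain d where d: "y = to_quotient_limit A \<N> d" "d \<in> generate A S" by (rule imageE)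
    have dN: "to_quotient_limit A \<N> d N = f N" using y(2) d(1) by simp
    have sub: "subgroup N A" using normals N normal_imp_subgroup by blast
    have "d \<in> N" using d(2) A.generate_subgroup_incl[OF N(2) sub] by blast
    then have "N #>\<^bsub>A\<^esub> d = N"
      using A.rcos_eq_self_iff[OF sub subgroup.mem_carrier[OF sub]] by blast
    then show "f N = N" using dN N(1) by (simp add: to_quotient_limit_def)
  next
    fix f assume "f \<in> {f \<in> carrier (quotient_limit A \<N>). \<forall>N\<in>\<N>. S \<subseteq> N \<longrightarrow> f N = N}"
    then have f: "f \<in> carrier (quotient_limit A \<N>)"
      and fN: "\<And>N. N \<in> \<N> \<Longrightarrow> S \<subseteq> N \<Longrightarrow> f N = N" by blast+
    show "f \<in> quotient_limit_topology A \<N> closure_of to_quotient_limit A \<N> ` generate A S"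
      unfolding in_closure_of
    proof (intro conjI allI impI)
      show "f \<in> topspace (quotient_limit_topology A \<N>)" using f by (simp add: topspace_quotient_limit_topology)
      fix U assume U: "f \<in> U \<and> openin (quotient_limit_topology A \<N>) U"
      obtain F where F: "finite F" "F \<subseteq> \<N>"
        "\<forall>g\<in>carrier (quotient_limit A \<N>). (\<forall>N\<in>F. g N = f N) \<longrightarrow> g \<in> U"
        by (rule quotient_limit_neighbourhood[OF conjunct2[OF U] conjunct1[OF U]])
      define M where "M = carrier A \<inter> \<Inter>F"
      have M: "M \<in> \<N>" unfolding M_def using finite_Inter_in_family[OF F(1,2) whole inter] .
      interpret M: normal M A using normals M .
      interpret D: normal "generate A S" A by fact
      \<comment> \<open>the smallest member of the family that contains both \<open>M\<close> and \<open>S\<close>\<close>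
      define K where "K = M <#>\<^bsub>A\<^esub> generate A S"
      have KN: "K \<lhd> A" unfolding K_def
        using A.normal_subgroup_set_mult_closed[OF M.normal_axioms D.normal_axioms] .
      have K_mem: "m \<otimes>\<^bsub>A\<^esub> d \<in> K" if "m \<in> M" "d \<in> generate A S" for m d
        using that unfolding K_def set_mult_def by blast
      have MK: "M \<subseteq> K"
      proof
        fix m assume "m \<in> M"
        then show "m \<in> K" using K_mem[OF _ D.one_closed, of m] M.mem_carrier by simp
      qed
      have SK: "S \<subseteq> K"
      proof
        fix s assume "s \<in> S"
        then show "s \<in> K" using K_mem[OF M.one_closed generate.incl, of s] S by auto
      qed
      have K: "K \<in> \<N>" using up[OF M KN MK] .
      obtain a where a: "a \<in> carrier A" "f M = M #>\<^bsub>A\<^esub> a"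
        using quotient_limit_coordinate[OF f M] by (auto simp: carrier_FactGroup)
      have "K = K <#>\<^bsub>A\<^esub> f M" using quotient_limit_compat[OF f M K MK] fN[OF K SK] by simp
      moreover have "\<one>\<^bsub>A\<^esub> \<otimes>\<^bsub>A\<^esub> a \<in> K <#>\<^bsub>A\<^esub> f M"
      proof -
        have "\<one>\<^bsub>A\<^esub> \<otimes>\<^bsub>A\<^esub> a \<in> f M" using M.one_closed unfolding a(2) r_coset_def by blast
        moreover have "\<one>\<^bsub>A\<^esub> \<in> K" using M.one_closed MK by blast
        ultimately have "\<one>\<^bsub>A\<^esub> \<otimes>\<^bsub>A\<^esub> (\<one>\<^bsub>A\<^esub> \<otimes>\<^bsub>A\<^esub> a) \<in> K <#>\<^bsub>A\<^esub> f M" unfolding set_mult_def by blast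
        then show ?thesis using a(1) by simp
      qed
      ultimately have "a \<in> K" using a(1) by simp
      then obtain m d where md: "m \<in> M" "d \<in> generate A S" "a = m \<otimes>\<^bsub>A\<^esub> d"
        unfolding K_def set_mult_def by blast
      have dA: "d \<in> carrier A" using md D.mem_carrier by blast
      have "f M = M #>\<^bsub>A\<^esub> d"
        using md a dA A.coset_mult_assoc[OF M.subset M.mem_carrier[OF md(1)] dA] M.rcos_const[OF _ md(1)] A
        by simp
      then have fM: "f M = to_quotient_limit A \<N> d M" using M by (simp add: to_quotient_limit_def)
      have "to_quotient_limit A \<N> d \<in> U"
      proof (rule F(3)[rule_format])
        show dL: "to_quotient_limit A \<N> d \<in> carrier (quotient_limit A \<N>)" using dA by simp
        fix N assume "N \<in> F"
        then have "N \<in> \<N>" "M \<subseteq> N" using F M_def by auto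
        then show "to_quotient_limit A \<N> d N = f N"
          using quotient_limit_compat[OF dL M] quotient_limit_compat[OF f M] fM by metis
      qed
      then show "\<exists>y. y \<in> to_quotient_limit A \<N> ` generate A S \<and> y \<in> U" using md(2) by blast
    qed
  qed
qed

section \<open>Maps into discrete spaces and open maps\<close>

text \<open>Only the partition of \<open>X\<close> into fibres matters for continuity into a discrete space.\<close>

lemma continuous_map_discrete_factor:
  assumes f: "continuous_map X (discrete_topology D) f"
    and g: "\<And>x. x \<in> topspace X \<Longrightarrow> g x \<in> E"
    and eq: "\<And>x y. x \<in> topspace X \<Longrightarrow> y \<in> topspace X \<Longrightarrow> f x = f y \<Longrightarrow> g x = g y"
  shows "continuous_map X (discrete_topology E) g"
  unfolding continuous_map_def
proof (intro conjI allI impI)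
  show "g \<in> topspace X \<rightarrow> topspace (discrete_topology E)" using g by auto
  fix U assume "openin (discrete_topology E) U"
  have "f \<in> topspace X \<rightarrow> D" using f by (auto simp: continuous_map_def)
  then have "openin X {x \<in> topspace X. f x \<in> f ` {x \<in> topspace X. g x \<in> U}}"
    by (intro openin_continuous_map_preimage[OF f]) auto
  moreover have "{x \<in> topspace X. f x \<in> f ` {x \<in> topspace X. g x \<in> U}} = {x \<in> topspace X. g x \<in> U}"
  proof (intro equalityI subsetI CollectI conjI)
    fix x assume "x \<in> {x \<in> topspace X. f x \<in> f ` {x \<in> topspace X. g x \<in> U}}"
    then obtain y where "x \<in> topspace X" "y \<in> topspace X" "f x = f y" "g y \<in> U" by blast
    then show "x \<in> topspace X" "g x \<in> U" using eq[of x y] by simp_all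
  qed auto
  ultimately show "openin X {x \<in> topspace X. g x \<in> U}" by simp
qed

lemma continuous_map_prod_discrete_factor:
  assumes f: "continuous_map (prod_topology X Y) (discrete_topology D) (\<lambda>(x, y). f x y)"
    and g: "\<And>x y. x \<in> topspace X \<Longrightarrow> y \<in> topspace Y \<Longrightarrow> g x y \<in> E"
    and eq: "\<And>x y x' y'. x \<in> topspace X \<Longrightarrow> y \<in> topspace Y \<Longrightarrow> x' \<in> topspace X \<Longrightarrow> y' \<in> topspace Y \<Longrightarrow>
      f x y = f x' y' \<Longrightarrow> g x y = g x' y'"
  shows "continuous_map (prod_topology X Y) (discrete_topology E) (\<lambda>(x, y). g x y)"
proof (rule continuous_map_discrete_factor[OF f])
  fix z w assume z: "z \<in> topspace (prod_topology X Y)"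
  obtain x y where zxy: "z = (x, y)" by (cases z)
  show "(case z of (x, y) \<Rightarrow> g x y) \<in> E" using z g by (simp add: zxy)
  assume w: "w \<in> topspace (prod_topology X Y)"
    and "(case z of (x, y) \<Rightarrow> f x y) = (case w of (x, y) \<Rightarrow> f x y)"
  moreover obtain x' y' where wxy: "w = (x', y')" by (cases w)
  ultimately show "(case z of (x, y) \<Rightarrow> g x y) = (case w of (x, y) \<Rightarrow> g x y)"
    using eq[of x y x' y'] z w by (simp add: zxy wxy)
qed

lemma open_map_prod:
  assumes f: "open_map X X' f" and g: "open_map Y Y' g"
  shows "open_map (prod_topology X Y) (prod_topology X' Y') (\<lambda>(x, y). (f x, g y))"
  unfolding open_map_def
proof (intro allI impI)
  fix W assume W: "openin (prod_topology X Y) W"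
  show "openin (prod_topology X' Y') ((\<lambda>(x, y). (f x, g y)) ` W)"
    unfolding openin_prod_topology_alt
  proof (intro allI impI)
    fix a b assume "(a, b) \<in> (\<lambda>(x, y). (f x, g y)) ` W"
    then obtain x y where xy: "(x, y) \<in> W" "a = f x" "b = g y" by auto
    then obtain U V where UV: "openin X U" "openin Y V" "x \<in> U" "y \<in> V" "U \<times> V \<subseteq> W"
      using W unfolding openin_prod_topology_alt by meson
    have "f ` U \<times> g ` V \<subseteq> (\<lambda>(x, y). (f x, g y)) ` W" using UV(5) by (auto simp: image_iff)
    then show "\<exists>U V. openin X' U \<and> openin Y' V \<and> a \<in> U \<and> b \<in> V \<and> U \<times> V \<subseteq> (\<lambda>(x, y). (f x, g y)) ` W"
      using f g UV xy unfolding open_map_def by (intro exI[of _ "f ` U"] exI[of _ "g ` V"]) auto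
  qed
qed

lemma quotient_map_prod_open:
  assumes f: "open_map X X' f" "continuous_map X X' f" "f ` topspace X = topspace X'"
    and g: "open_map Y Y' g" "continuous_map Y Y' g" "g ` topspace Y = topspace Y'"
  shows "quotient_map (prod_topology X Y) (prod_topology X' Y') (\<lambda>(x, y). (f x, g y))"
proof (rule continuous_open_imp_quotient_map)
  show "continuous_map (prod_topology X Y) (prod_topology X' Y') (\<lambda>(x, y). (f x, g y))"
    using f(2) g(2) by (simp add: continuous_map_prod_top)
  show "open_map (prod_topology X Y) (prod_topology X' Y') (\<lambda>(x, y). (f x, g y))"
    by (rule open_map_prod[OF f(1) g(1)])
  show "(\<lambda>(x, y). (f x, g y)) ` topspace (prod_topology X Y) = topspace (prod_topology X' Y')"
    unfolding topspace_prod_topology f(3)[symmetric] g(3)[symmetric] by (auto intro!: rev_image_eqI)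
qed

section \<open>The finite quotients of the complete exterior square\<close>

text \<open>The kernels of those finite \<open>p\<close>-quotients of the tensor square that factor through the exterior square.\<close>

definition exterior_p_quotients ::
    "nat \<Rightarrow> ('a, 'm) monoid_scheme \<Rightarrow> 'a topology \<Rightarrow> ('a \<times> 'a) group_word set set set" where
  "exterior_p_quotients p G T =
     {K \<in> tensor_p_quotients p G T. \<forall>x\<in>carrier G. tensor G x x \<in> K}"

lemma tensor_p_quotientsD:
  assumes "K \<in> tensor_p_quotients p G T"
  shows "K \<lhd> tensor_square G" "finite_p_group p (tensor_square G Mod K)"
    "continuous_map (prod_topology T T) (discrete_topology (carrier (tensor_square G Mod K)))
       (\<lambda>(x, y). K #>\<^bsub>tensor_square G\<^esub> tensor G x y)"
  using assms by (auto simp: tensor_p_quotients_def)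

lemma tensor_p_quotients_kernel:
  assumes p: "prime p" and T: "topspace T = carrier G"
    and B: "finite_p_group p B" and h: "h \<in> hom (tensor_square G) B"
    and cont: "continuous_map (prod_topology T T) (discrete_topology (carrier B))
      (\<lambda>(x, y). h (tensor G x y))"
  shows "kernel (tensor_square G) B h \<in> tensor_p_quotients p G T"
proof -
  let ?T = "tensor_square G"
  interpret T: group ?T by (rule tensor_square_group)
  interpret B: group B using B by (simp add: finite_p_group_def)
  interpret h: group_hom ?T B h using h by unfold_locales
  let ?K = "kernel ?T B h"
  have eq: "?K #>\<^bsub>?T\<^esub> a = ?K #>\<^bsub>?T\<^esub> b"
    if "a \<in> carrier ?T" "b \<in> carrier ?T" "h a = h b" for a b
  proof -
    have "h (a \<otimes>\<^bsub>?T\<^esub> inv\<^bsub>?T\<^esub> b) = \<one>\<^bsub>B\<^esub>" using that by simp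
    then have "a \<otimes>\<^bsub>?T\<^esub> inv\<^bsub>?T\<^esub> b \<in> ?K" using that by (simp add: kernel_def)
    then show ?thesis unfolding T.rcos_eq_iff[OF h.subgroup_kernel that(1,2)] .
  qed
  have "continuous_map (prod_topology T T) (discrete_topology (carrier (?T Mod ?K)))
      (\<lambda>(x, y). ?K #>\<^bsub>?T\<^esub> tensor G x y)"
  proof (rule continuous_map_prod_discrete_factor[OF cont])
    show "?K #>\<^bsub>?T\<^esub> tensor G x y \<in> carrier (?T Mod ?K)" if "x \<in> topspace T" "y \<in> topspace T" for x y
      using that unfolding T carrier_FactGroup by (intro imageI tensor_carrier)
    show "?K #>\<^bsub>?T\<^esub> tensor G x y = ?K #>\<^bsub>?T\<^esub> tensor G x' y'"
      if "x \<in> topspace T" "y \<in> topspace T" "x' \<in> topspace T" "y' \<in> topspace T"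
        "h (tensor G x y) = h (tensor G x' y')" for x y x' y'
      using that unfolding T by (intro eq tensor_carrier)
  qed
  then show ?thesis
    using h.normal_kernel finite_p_group_Mod_kernel[OF p tensor_square_group B h]
    by (simp add: tensor_p_quotients_def)
qed

lemma tensor_p_quotients_whole:
  assumes "prime p" and "topspace T = carrier G"
  shows "carrier (tensor_square G) \<in> tensor_p_quotients p G T"
proof -
  let ?B = "singleton_group ()"
  have "finite_p_group p ?B"
    unfolding finite_p_group_def by (auto simp: singleton_group_def order_def intro!: exI[of _ 0])
      (metis singleton_group singleton_group_def)
  moreover have "(\<lambda>_. ()) \<in> hom (tensor_square G) ?B" by (simp add: hom_def singleton_group_def)
  ultimately have "kernel (tensor_square G) ?B (\<lambda>_. ()) \<in> tensor_p_quotients p G T"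
    using assms by (intro tensor_p_quotients_kernel)
      (auto simp: singleton_group_def case_prod_unfold)
  then show ?thesis by (simp add: kernel_def singleton_group_def)
qed

text \<open>\<open>K \<inter> L\<close> is the kernel of the diagonal map into the product of the two quotients.\<close>

lemma tensor_p_quotients_Int:
  assumes p: "prime p" and T: "topspace T = carrier G"
    and K: "K \<in> tensor_p_quotients p G T" and L: "L \<in> tensor_p_quotients p G T"
  shows "K \<inter> L \<in> tensor_p_quotients p G T"
proof -
  let ?T = "tensor_square G"
  interpret T: group ?T by (rule tensor_square_group)
  interpret K: normal K ?T by (rule tensor_p_quotientsD(1)[OF K])
  interpret L: normal L ?T by (rule tensor_p_quotientsD(1)[OF L])
  let ?B = "(?T Mod K) \<times>\<times> (?T Mod L)" and ?h = "\<lambda>a. (K #>\<^bsub>?T\<^esub> a, L #>\<^bsub>?T\<^esub> a)"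
  have "continuous_map (prod_topology T T) (prod_topology (discrete_topology (carrier (?T Mod K)))
      (discrete_topology (carrier (?T Mod L)))) (\<lambda>xy. ((\<lambda>(x, y). K #>\<^bsub>?T\<^esub> tensor G x y) xy, (\<lambda>(x, y). L #>\<^bsub>?T\<^esub> tensor G x y) xy))"
    by (rule continuous_map_pairedI[OF tensor_p_quotientsD(3)[OF K] tensor_p_quotientsD(3)[OF L]])
  then have "continuous_map (prod_topology T T) (discrete_topology (carrier ?B)) (\<lambda>(x, y). ?h (tensor G x y))"
    by (simp add: prod_topology_discrete_topology DirProd_def case_prod_unfold)
  moreover have "?h \<in> hom ?T ?B"
    using K.r_coset_hom_Mod L.r_coset_hom_Mod by (auto simp: hom_def DirProd_def)
  moreover have "finite_p_group p ?B"
    by (rule finite_p_group_DirProd[OF tensor_p_quotientsD(2)[OF K] tensor_p_quotientsD(2)[OF L]])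
  ultimately have "kernel ?T ?B ?h \<in> tensor_p_quotients p G T"
    by (intro tensor_p_quotients_kernel[OF p T])
  moreover have "kernel ?T ?B ?h = K \<inter> L"
  proof (rule Set.set_eqI)
    fix a
    show "a \<in> kernel ?T ?B ?h \<longleftrightarrow> a \<in> K \<inter> L"
      using T.rcos_eq_self_iff[OF K.is_subgroup, of a] T.rcos_eq_self_iff[OF L.is_subgroup, of a]
        K.mem_carrier[of a] by (auto simp: kernel_def DirProd_def)
  qed
  ultimately show ?thesis by simp
qed

lemma tensor_p_quotients_mono:
  assumes p: "prime p" and T: "topspace T = carrier G"
    and K: "K \<in> tensor_p_quotients p G T" and L: "L \<lhd> tensor_square G" and KL: "K \<subseteq> L"
  shows "L \<in> tensor_p_quotients p G T"
proof -
  let ?T = "tensor_square G"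
  interpret T: group ?T by (rule tensor_square_group)
  interpret K: normal K ?T by (rule tensor_p_quotientsD(1)[OF K])
  interpret L: normal L ?T by fact
  have eq: "L #>\<^bsub>?T\<^esub> a = L #>\<^bsub>?T\<^esub> b"
    if "a \<in> carrier ?T" "b \<in> carrier ?T" "K #>\<^bsub>?T\<^esub> a = K #>\<^bsub>?T\<^esub> b" for a b
    using that KL T.rcos_eq_iff[OF K.is_subgroup that(1,2)] T.rcos_eq_iff[OF L.is_subgroup that(1,2)]
    by blast
  obtain g where g: "g \<in> hom (?T Mod K) (?T Mod L)"
    "\<And>a. a \<in> carrier ?T \<Longrightarrow> g (K #>\<^bsub>?T\<^esub> a) = L #>\<^bsub>?T\<^esub> a"
    using FactGroup_universal[OF L.r_coset_hom_Mod K.normal_axioms eq] by blast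
  have "g ` carrier (?T Mod K) = carrier (?T Mod L)"
    using g(2) by (auto simp: carrier_FactGroup image_image)
  then have "finite_p_group p (?T Mod L)"
    using finite_p_group_surj_hom[OF p tensor_p_quotientsD(2)[OF K] L.factorgroup_is_group g(1)] by blast
  moreover have "continuous_map (prod_topology T T) (discrete_topology (carrier (?T Mod L)))
      (\<lambda>(x, y). L #>\<^bsub>?T\<^esub> tensor G x y)"
  proof (rule continuous_map_prod_discrete_factor[OF tensor_p_quotientsD(3)[OF K]])
    show "L #>\<^bsub>?T\<^esub> tensor G x y \<in> carrier (?T Mod L)" if "x \<in> topspace T" "y \<in> topspace T" for x y
      using that unfolding T carrier_FactGroup by (intro imageI tensor_carrier)
    show "L #>\<^bsub>?T\<^esub> tensor G x y = L #>\<^bsub>?T\<^esub> tensor G x' y'"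
      if "x \<in> topspace T" "y \<in> topspace T" "x' \<in> topspace T" "y' \<in> topspace T"
        "K #>\<^bsub>?T\<^esub> tensor G x y = K #>\<^bsub>?T\<^esub> tensor G x' y'" for x y x' y'
      using that unfolding T by (intro eq tensor_carrier)
  qed
  ultimately show ?thesis using L by (simp add: tensor_p_quotients_def)
qed

lemma complete_nabla_eq:
  assumes p: "prime p" and G: "group G" and T: "topspace T = carrier G"
  shows "complete_nabla p G T = {f \<in> carrier (complete_tensor_square p G T).
    \<forall>K\<in>exterior_p_quotients p G T. f K = K}"
proof -
  let ?S = "{tensor G x x | x. x \<in> carrier G}"
  have S: "?S \<subseteq> carrier (tensor_square G)" by (auto intro: tensor_carrier)
  have "{complete_tensor p G T x x | x. x \<in> carrier G} =
      to_quotient_limit (tensor_square G) (tensor_p_quotients p G T) ` ?S"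
    by (auto simp: complete_tensor_def)
  then have "complete_nabla p G T = {f \<in> carrier (complete_tensor_square p G T).
      \<forall>K\<in>tensor_p_quotients p G T. ?S \<subseteq> K \<longrightarrow> f K = K}"
    using closure_of_generate_quotient_limit[OF tensor_square_group tensor_p_quotientsD(1)
        tensor_p_quotients_whole[OF p T] tensor_p_quotients_Int[OF p T]
        tensor_p_quotients_mono[OF p T] S diagonal_tensors_normal[OF G, unfolded diagonal_tensors_def]]
    by (simp add: complete_nabla_def complete_tensor_topology_def complete_tensor_square_def)
  also have "\<dots> = {f \<in> carrier (complete_tensor_square p G T).
      \<forall>K\<in>exterior_p_quotients p G T. f K = K}"
    by (auto simp: exterior_p_quotients_def)
  finally show ?thesis .
qed

text \<open>The closed subgroup generated by the diagonal consists of the families whose coordinate at every \<open>K\<close>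
  containing the diagonal is trivial, so it is a subgroup and membership of \<open>x \<otimes> y\<close> is tested at these \<open>K\<close>.\<close>

lemma complete_wedge_trivial_iff:
  assumes p: "prime p" and G: "group G" and T: "topspace T = carrier G"
    and xy: "x \<in> carrier G" "y \<in> carrier G"
  shows "complete_wedge p G T x y = \<one>\<^bsub>complete_exterior_square p G T\<^esub> \<longleftrightarrow>
    (\<forall>K\<in>exterior_p_quotients p G T. tensor G x y \<in> K)"
proof -
  let ?L = "complete_tensor_square p G T" and ?D = "complete_nabla p G T"
  interpret T: group "tensor_square G" by (rule tensor_square_group)
  have L: "group ?L" unfolding complete_tensor_square_def
    using quotient_limit_group[OF tensor_square_group tensor_p_quotientsD(1)] .
  interpret L: group ?L by fact
  have D: "?D = {f \<in> carrier ?L. \<forall>K\<in>exterior_p_quotients p G T. f K = K}"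
    using complete_nabla_eq[OF p G T] .
  have c: "complete_tensor p G T x y \<in> carrier ?L"
    unfolding complete_tensor_def complete_tensor_square_def
    using hom_in_carrier[OF to_quotient_limit_hom[OF tensor_square_group tensor_p_quotientsD(1)]
        tensor_carrier[OF xy]] .
  have sub: "subgroup ?D ?L"
  proof -
    have mult: "(f \<otimes>\<^bsub>?L\<^esub> g) K = f K <#>\<^bsub>tensor_square G\<^esub> g K" if "K \<in> exterior_p_quotients p G T" for f g K
      using that by (simp add: complete_tensor_square_def quotient_limit_mult exterior_p_quotients_def)
    have KK: "K <#>\<^bsub>tensor_square G\<^esub> K = K" and Mod: "group (tensor_square G Mod K)"
      and co: "f \<in> carrier ?L \<Longrightarrow> f K \<in> carrier (tensor_square G Mod K)"
      if "K \<in> exterior_p_quotients p G T" for K f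
    proof -
      have K: "K \<in> tensor_p_quotients p G T" using that by (simp add: exterior_p_quotients_def)
      show Mod: "group (tensor_square G Mod K)"
        using normal.factorgroup_is_group[OF tensor_p_quotientsD(1)[OF K]] .
      show "K <#>\<^bsub>tensor_square G\<^esub> K = K"
        using group.is_monoid[OF Mod, THEN monoid.l_one, of K] monoid.one_closed[OF group.is_monoid[OF Mod]] by simp
      show "f \<in> carrier ?L \<Longrightarrow> f K \<in> carrier (tensor_square G Mod K)"
        unfolding complete_tensor_square_def using quotient_limit_coordinate[OF _ K] .
    qed
    have one: "\<one>\<^bsub>?L\<^esub> K = K" if "K \<in> exterior_p_quotients p G T" for K
      using that by (simp add: complete_tensor_square_def quotient_limit_def exterior_p_quotients_def)
    show ?thesis
    proof (rule L.subgroupI)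
      show "?D \<subseteq> carrier ?L" using D by blast
      show "?D \<noteq> {}" using D one L.one_closed by blast
      show "f \<otimes>\<^bsub>?L\<^esub> g \<in> ?D" if "f \<in> ?D" "g \<in> ?D" for f g
        using that D mult KK by auto
      show "inv\<^bsub>?L\<^esub> f \<in> ?D" if f: "f \<in> ?D" for f
      proof -
        have fL: "f \<in> carrier ?L" using f D by blast
        have "(inv\<^bsub>?L\<^esub> f) K = K" if K: "K \<in> exterior_p_quotients p G T" for K
        proof -
          have "f K = K" using f D K by blast
          then have "(inv\<^bsub>?L\<^esub> f) K <#>\<^bsub>tensor_square G\<^esub> K = K"
            using mult[OF K, of "inv\<^bsub>?L\<^esub> f" f] one[OF K] L.l_inv[OF fL] by simp
          then show ?thesis
            using monoid.r_one[OF group.is_monoid[OF Mod[OF K]] co[OF K L.inv_closed[OF fL]]] by simp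
        qed
        then show ?thesis using D fL by blast
      qed
    qed
  qed
  have "complete_wedge p G T x y = \<one>\<^bsub>complete_exterior_square p G T\<^esub> \<longleftrightarrow> complete_tensor p G T x y \<in> ?D"
    using L.rcos_eq_self_iff[OF sub c] by (simp add: complete_wedge_def complete_exterior_square_def)
  also have "\<dots> \<longleftrightarrow> (\<forall>K\<in>exterior_p_quotients p G T. complete_tensor p G T x y K = K)"
    using D c by blast
  also have "\<dots> \<longleftrightarrow> (\<forall>K\<in>exterior_p_quotients p G T. tensor G x y \<in> K)"
  proof (rule ball_cong[OF HOL.refl])
    fix K assume "K \<in> exterior_p_quotients p G T"
    then have K: "K \<in> tensor_p_quotients p G T" by (simp add: exterior_p_quotients_def)
    show "complete_tensor p G T x y K = K \<longleftrightarrow> tensor G x y \<in> K"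
      using T.rcos_eq_self_iff[OF normal_imp_subgroup[OF tensor_p_quotientsD(1)[OF K]] tensor_carrier[OF xy]] K
      by (simp add: complete_tensor_def to_quotient_limit_def)
  qed
  finally show ?thesis .
qed

section \<open>Functoriality of trivial wedges\<close>

definition trivial_wedges ::
    "nat \<Rightarrow> ('a, 'm) monoid_scheme \<Rightarrow> 'a topology \<Rightarrow> ('a \<times> 'a) set" where
  "trivial_wedges p G T = {(x, y). x \<in> carrier G \<and> y \<in> carrier G \<and>
     complete_wedge p G T x y = \<one>\<^bsub>complete_exterior_square p G T\<^esub>}"

lemma trivial_wedges_eq:
  assumes p: "prime p" and G: "group G" and T: "topspace T = carrier G"
  shows "trivial_wedges p G T = {(x, y). x \<in> carrier G \<and> y \<in> carrier G \<and>
     (\<forall>K\<in>exterior_p_quotients p G T. tensor G x y \<in> K)}"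
  using complete_wedge_trivial_iff[OF p G T] by (auto simp: trivial_wedges_def)

lemma closedin_trivial_wedges:
  assumes p: "prime p" and G: "group G" and T: "topspace T = carrier G"
  shows "closedin (prod_topology T T) (trivial_wedges p G T)"
proof -
  let ?T = "tensor_square G"
  interpret T: group ?T by (rule tensor_square_group)
  let ?C = "\<lambda>K. {z \<in> topspace (prod_topology T T). (\<lambda>(x, y). K #>\<^bsub>?T\<^esub> tensor G x y) z \<in> {K}}"
  have closed: "closedin (prod_topology T T) (?C K)" if "K \<in> exterior_p_quotients p G T" for K
  proof (rule closedin_continuous_map_preimage)
    have K: "K \<in> tensor_p_quotients p G T" using that by (simp add: exterior_p_quotients_def)
    show "continuous_map (prod_topology T T) (discrete_topology (carrier (?T Mod K)))
        (\<lambda>(x, y). K #>\<^bsub>?T\<^esub> tensor G x y)" by (rule tensor_p_quotientsD(3)[OF K])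
    have "K \<in> carrier (?T Mod K)"
      using monoid.one_closed[OF group.is_monoid[OF normal.factorgroup_is_group[OF tensor_p_quotientsD(1)[OF K]]]]
      by simp
    then show "closedin (discrete_topology (carrier (?T Mod K))) {K}" by simp
  qed
  have mem: "(x, y) \<in> ?C K \<longleftrightarrow> x \<in> carrier G \<and> y \<in> carrier G \<and> tensor G x y \<in> K"
    if "K \<in> exterior_p_quotients p G T" for K x y
  proof -
    have K: "K \<in> tensor_p_quotients p G T" using that by (simp add: exterior_p_quotients_def)
    show ?thesis
      using T.rcos_eq_self_iff[OF normal_imp_subgroup[OF tensor_p_quotientsD(1)[OF K]] tensor_carrier, of x y]
      by (auto simp: T)
  qed
  have "trivial_wedges p G T = \<Inter>(insert (topspace (prod_topology T T)) (?C ` exterior_p_quotients p G T))"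
  proof (intro Set.set_eqI)
    fix z :: "'a \<times> 'a"
    obtain x y where z: "z = (x, y)" by (cases z)
    show "z \<in> trivial_wedges p G T \<longleftrightarrow>
        z \<in> \<Inter>(insert (topspace (prod_topology T T)) (?C ` exterior_p_quotients p G T))"
      using mem[of _ x y] unfolding z trivial_wedges_eq[OF p G T] Inter_iff ball_simps(7) image_iff
      by (auto simp: T simp del: mem_Collect_eq)
  qed
  moreover have "closedin (prod_topology T T) \<dots>"
  proof (rule closedin_Inter)
    fix C assume "C \<in> insert (topspace (prod_topology T T)) (?C ` exterior_p_quotients p G T)"
    then show "closedin (prod_topology T T) C" using closed closedin_topspace by blast
  qed blast
  ultimately show ?thesis by simp
qed

text \<open>The homomorphism \<open>f\<close> induces one of the abstract tensor squares, along which the kernels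
  for \<open>H\<close> pull back to kernels for \<open>G\<close>.\<close>

lemma trivial_wedges_hom:
  assumes p: "prime p" and G: "group G" and T: "topspace T = carrier G"
    and H: "group H" and T': "topspace T' = carrier H"
    and f: "f \<in> hom G H" and cont: "continuous_map T T' f"
    and xy: "(x, y) \<in> trivial_wedges p G T"
  shows "(f x, f y) \<in> trivial_wedges p H T'"
proof -
  interpret G: group G by fact
  interpret H: group H by fact
  interpret f: group_hom G H f using f by unfold_locales
  let ?TG = "tensor_square G" and ?TH = "tensor_square H"
  interpret TG: group ?TG by (rule tensor_square_group)
  interpret TH: group ?TH by (rule tensor_square_group)
  have conj: "f (conj_by G a b) = conj_by H (f a) (f b)" if "a \<in> carrier G" "b \<in> carrier G" for a b
    using that by (simp add: conj_by_def)
  obtain \<phi> where \<phi>: "\<phi> \<in> hom ?TG ?TH"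
    "\<And>a b. a \<in> carrier G \<Longrightarrow> b \<in> carrier G \<Longrightarrow> \<phi> (tensor G a b) = tensor H (f a) (f b)"
    by (rule tensor_square_universal[OF G tensor_square_group, of "\<lambda>a b. tensor H (f a) (f b)" H])
      (simp_all add: tensor_carrier tensor_mult_left[OF H] tensor_mult_right[OF H] conj)
  have xyG: "x \<in> carrier G" "y \<in> carrier G"
    and wedge: "\<And>K. K \<in> exterior_p_quotients p G T \<Longrightarrow> tensor G x y \<in> K"
    using xy trivial_wedges_eq[OF p G T] by auto
  have "tensor H (f x) (f y) \<in> K" if K: "K \<in> exterior_p_quotients p H T'" for K
  proof -
    have K': "K \<in> tensor_p_quotients p H T'" using K by (simp add: exterior_p_quotients_def)
    interpret K: normal K ?TH by (rule tensor_p_quotientsD(1)[OF K'])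
    interpret Q: group "?TH Mod K" by (rule K.factorgroup_is_group)
    define h where "h = (\<lambda>a. K #>\<^bsub>?TH\<^esub> \<phi> a)"
    have h: "h \<in> hom ?TG (?TH Mod K)"
      using hom_compose[OF \<phi>(1) K.r_coset_hom_Mod] by (simp add: h_def comp_def)
    have hK: "h (tensor G a b) = K \<longleftrightarrow> tensor H (f a) (f b) \<in> K"
      if "a \<in> carrier G" "b \<in> carrier G" for a b
      using TH.rcos_eq_self_iff[OF K.is_subgroup tensor_carrier, of "f a" "f b"] that
      by (simp add: h_def \<phi>(2))
    have "continuous_map (prod_topology T T) (discrete_topology (carrier (?TH Mod K)))
        ((\<lambda>(x, y). K #>\<^bsub>?TH\<^esub> tensor H x y) \<circ> (\<lambda>(x, y). (f x, f y)))"
      using cont by (intro continuous_map_compose[OF _ tensor_p_quotientsD(3)[OF K']])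
        (simp add: continuous_map_prod_top)
    then have "continuous_map (prod_topology T T) (discrete_topology (carrier (?TH Mod K)))
        (\<lambda>(x, y). h (tensor G x y))"
    proof (rule continuous_map_eq)
      fix z assume "z \<in> topspace (prod_topology T T)"
      then obtain a b where z: "z = (a, b)" and ab: "a \<in> carrier G" "b \<in> carrier G"
        by (auto simp: T)
      show "((\<lambda>(x, y). K #>\<^bsub>?TH\<^esub> tensor H x y) \<circ> (\<lambda>(x, y). (f x, f y))) z =
          (case z of (a, b) \<Rightarrow> h (tensor G a b))"
        using \<phi>(2)[OF ab] by (simp add: z h_def)
    qed
    then have "kernel ?TG (?TH Mod K) h \<in> tensor_p_quotients p G T"
      by (rule tensor_p_quotients_kernel[OF p T tensor_p_quotientsD(2)[OF K'] h])
    moreover have ker: "tensor G a b \<in> kernel ?TG (?TH Mod K) h \<longleftrightarrow> tensor H (f a) (f b) \<in> K"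
      if "a \<in> carrier G" "b \<in> carrier G" for a b
      using hK[OF that] tensor_carrier[OF that] by (simp add: kernel_def)
    moreover have "tensor H (f a) (f a) \<in> K" if "a \<in> carrier G" for a
      using K f.hom_closed[OF that] by (simp add: exterior_p_quotients_def)
    ultimately have "kernel ?TG (?TH Mod K) h \<in> exterior_p_quotients p G T"
      by (simp add: exterior_p_quotients_def)
    from wedge[OF this] show ?thesis using ker[OF xyG] by simp
  qed
  then show ?thesis using xyG by (simp add: trivial_wedges_eq[OF p H T'])
qed

text \<open>Let \<open>K\<close> be one of the kernels for \<open>G\<close>. Since the kernel of \<open>f\<close> wedges trivially with everything,
  the class of \<open>a \<otimes> b\<close> modulo \<open>K\<close> depends only on \<open>f a\<close> and \<open>f b\<close>. It therefore defines a
  homomorphism from the tensor square of \<open>H\<close> into a finite \<open>p\<close>-group, and its kernel is a test for \<open>H\<close> that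
  \<open>f x \<otimes> f y\<close> passes exactly when \<open>x \<otimes> y\<close> lies in \<open>K\<close>. Continuity descends because \<open>f \<times> f\<close> is open.\<close>

lemma trivial_wedges_lift:
  assumes p: "prime p" and G: "group G" and T: "topspace T = carrier G"
    and H: "group H" and T': "topspace T' = carrier H"
    and f: "f \<in> hom G H" and surj: "f ` carrier G = carrier H"
    and cont: "continuous_map T T' f" and opn: "open_map T T' f"
    and ker: "kernel G H f \<subseteq> complete_exterior_center p G T"
    and xyG: "x \<in> carrier G" "y \<in> carrier G"
    and xy: "(f x, f y) \<in> trivial_wedges p H T'"
  shows "(x, y) \<in> trivial_wedges p G T"
proof -
  interpret G: group G by fact
  interpret H: group H by fact
  interpret f: group_hom G H f using f by unfold_locales
  let ?TG = "tensor_square G" and ?TH = "tensor_square H"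
  interpret TG: group ?TG by (rule tensor_square_group)
  interpret TH: group ?TH by (rule tensor_square_group)
  have surj': "f ` topspace T = topspace T'" using surj by (simp only: T T')
  have conj: "f (conj_by G a b) = conj_by H (f a) (f b)" if "a \<in> carrier G" "b \<in> carrier G" for a b
    using that by (simp add: conj_by_def)
  have fxy: "f x \<in> carrier H" "f y \<in> carrier H"
    and wedge: "\<And>K. K \<in> exterior_p_quotients p H T' \<Longrightarrow> tensor H (f x) (f y) \<in> K"
    using xy trivial_wedges_eq[OF p H T'] by auto
  have "tensor G x y \<in> K" if K: "K \<in> exterior_p_quotients p G T" for K
  proof -
    have K': "K \<in> tensor_p_quotients p G T" and diag: "\<And>a. a \<in> carrier G \<Longrightarrow> tensor G a a \<in> K"
      using K by (simp_all add: exterior_p_quotients_def)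
    interpret K: normal K ?TG by (rule tensor_p_quotientsD(1)[OF K'])
    interpret Q: group "?TG Mod K" by (rule K.factorgroup_is_group)
    define q where "q a b = K #>\<^bsub>?TG\<^esub> tensor G a b" for a b
    have q_closed: "q a b \<in> carrier (?TG Mod K)" if "a \<in> carrier G" "b \<in> carrier G" for a b
      unfolding q_def carrier_FactGroup using that by (intro imageI tensor_carrier)
    have q_left: "q (a \<otimes>\<^bsub>G\<^esub> b) c = q (conj_by G a b) (conj_by G c b) \<otimes>\<^bsub>?TG Mod K\<^esub> q b c"
      if "a \<in> carrier G" "b \<in> carrier G" "c \<in> carrier G" for a b c
      using that by (simp add: q_def tensor_mult_left[OF G] K.rcos_sum tensor_carrier G.conj_by_closed)
    have q_right: "q b (c \<otimes>\<^bsub>G\<^esub> a) = q b a \<otimes>\<^bsub>?TG Mod K\<^esub> q (conj_by G b a) (conj_by G c a)"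
      if "a \<in> carrier G" "b \<in> carrier G" "c \<in> carrier G" for a b c
      using that by (simp add: q_def tensor_mult_right[OF G] K.rcos_sum tensor_carrier G.conj_by_closed)
    have q_self: "q a b = K \<longleftrightarrow> tensor G a b \<in> K" if "a \<in> carrier G" "b \<in> carrier G" for a b
      unfolding q_def by (rule TG.rcos_eq_self_iff[OF K.is_subgroup tensor_carrier[OF that]])
    have central: "tensor G n b \<in> K" "tensor G b n \<in> K"
      if n: "n \<in> carrier G" "f n = \<one>\<^bsub>H\<^esub>" and b: "b \<in> carrier G" for n b
    proof -
      have "n \<in> complete_exterior_center p G T" using ker n by (auto simp: kernel_def)
      then have "complete_wedge p G T n b = \<one>\<^bsub>complete_exterior_square p G T\<^esub>"
        using b by (simp add: complete_exterior_center_def)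
      then show nb: "tensor G n b \<in> K" using complete_wedge_trivial_iff[OF p G T n(1) b] K by blast
      show "tensor G b n \<in> K" by (rule tensor_swap_mem[OF G K.normal_axioms diag n(1) b nb])
    qed
    have q_cong: "q a b = q a' b'"
      if "a \<in> carrier G" "b \<in> carrier G" "a' \<in> carrier G" "b' \<in> carrier G" "f a = f a'" "f b = f b'"
      for a b a' b'
    proof -
      \<comment> \<open>changing the left entry by an element of the kernel, which \<open>tensor_mult_left\<close> splits off on the left\<close>
      have step1: "q (n \<otimes>\<^bsub>G\<^esub> a) b = q a b" if "n \<in> carrier G" "f n = \<one>\<^bsub>H\<^esub>" "a \<in> carrier G" "b \<in> carrier G" for n a b
      proof -
        have "f (conj_by G n a) = \<one>\<^bsub>H\<^esub>" using that by (simp add: conj conj_by_def)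
        then have "q (conj_by G n a) (conj_by G b a) = K"
          using that q_self central(1) by (simp add: G.conj_by_closed)
        then show ?thesis using that q_left Q.l_one[OF q_closed] by simp
      qed
      \<comment> \<open>changing the right entry; antisymmetry enters through \<open>central(2)\<close>\<close>
      have step2: "q a (n \<otimes>\<^bsub>G\<^esub> b) = q a b" if "n \<in> carrier G" "f n = \<one>\<^bsub>H\<^esub>" "a \<in> carrier G" "b \<in> carrier G" for n a b
      proof -
        have "f (conj_by G n b) = \<one>\<^bsub>H\<^esub>" using that by (simp add: conj conj_by_def)
        then have "q (conj_by G a b) (conj_by G n b) = K"
          using that q_self central(2) by (simp add: G.conj_by_closed)
        then show ?thesis using that q_right Q.r_one[OF q_closed] by simp
      qed
      have "q a b = q ((a \<otimes>\<^bsub>G\<^esub> inv\<^bsub>G\<^esub> a') \<otimes>\<^bsub>G\<^esub> a') b" using that by (simp add: G.m_assoc)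
      also have "\<dots> = q a' b" using that by (intro step1) simp_all
      also have "\<dots> = q a' ((b \<otimes>\<^bsub>G\<^esub> inv\<^bsub>G\<^esub> b') \<otimes>\<^bsub>G\<^esub> b')" using that by (simp add: G.m_assoc)
      also have "\<dots> = q a' b'" using that by (intro step2) simp_all
      finally show ?thesis .
    qed
    \<comment> \<open>a set-theoretic section of \<open>f\<close>; \<open>g\<close> does not depend on it by \<open>q_cong\<close>\<close>
    define r where "r = inv_into (carrier G) f"
    have r: "r X \<in> carrier G" "f (r X) = X" if "X \<in> carrier H" for X
      using that surj by (auto simp: r_def inv_into_into f_inv_into_f)
    define g where "g X Y = q (r X) (r Y)" for X Y
    have g_f: "g (f a) (f b) = q a b" if "a \<in> carrier G" "b \<in> carrier G" for a b
      unfolding g_def using that r by (intro q_cong) simp_all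
    obtain \<psi> where \<psi>: "\<psi> \<in> hom ?TH (?TG Mod K)"
      "\<And>X Y. X \<in> carrier H \<Longrightarrow> Y \<in> carrier H \<Longrightarrow> \<psi> (tensor H X Y) = g X Y"
    proof (rule tensor_square_universal[OF H Q.is_group, of g])
      show "g X Y \<in> carrier (?TG Mod K)" if "X \<in> carrier H" "Y \<in> carrier H" for X Y
        unfolding g_def using r that by (intro q_closed) simp_all
      fix X Y Z assume XYZ: "X \<in> carrier H" "Y \<in> carrier H" "Z \<in> carrier H"
      obtain a b c where abc: "a \<in> carrier G" "b \<in> carrier G" "c \<in> carrier G" "X = f a" "Y = f b" "Z = f c"
        using XYZ r by metis
      show "g (X \<otimes>\<^bsub>H\<^esub> Y) Z = g (conj_by H X Y) (conj_by H Z Y) \<otimes>\<^bsub>?TG Mod K\<^esub> g Y Z"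
        using abc(1-3) q_left[of a b c] g_f[of "a \<otimes>\<^bsub>G\<^esub> b" c] g_f[of "conj_by G a b" "conj_by G c b"] g_f[of b c]
        unfolding abc(4-6) by (simp add: conj[symmetric] G.conj_by_closed)
      show "g X (Z \<otimes>\<^bsub>H\<^esub> Y) = g X Y \<otimes>\<^bsub>?TG Mod K\<^esub> g (conj_by H X Y) (conj_by H Z Y)"
        using abc(1-3) q_right[of b a c] g_f[of a "c \<otimes>\<^bsub>G\<^esub> b"] g_f[of "conj_by G a b" "conj_by G c b"] g_f[of a b]
        unfolding abc(4-6) by (simp add: conj[symmetric] G.conj_by_closed)
    qed blast
    have "continuous_map (prod_topology T T) (discrete_topology (carrier (?TG Mod K)))
        ((\<lambda>(X, Y). \<psi> (tensor H X Y)) \<circ> (\<lambda>(x, y). (f x, f y)))"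
    proof (rule continuous_map_eq[OF tensor_p_quotientsD(3)[OF K']])
      fix z assume "z \<in> topspace (prod_topology T T)"
      then obtain a b where z: "z = (a, b)" and ab: "a \<in> carrier G" "b \<in> carrier G"
        by (auto simp: T)
      show "(case z of (a, b) \<Rightarrow> K #>\<^bsub>?TG\<^esub> tensor G a b) =
          ((\<lambda>(X, Y). \<psi> (tensor H X Y)) \<circ> (\<lambda>(x, y). (f x, f y))) z"
        unfolding z comp_def prod.case
        using \<psi>(2)[OF f.hom_closed[OF ab(1)] f.hom_closed[OF ab(2)]] g_f[OF ab]
        by (simp only: q_def)
    qed
    then have "continuous_map (prod_topology T' T') (discrete_topology (carrier (?TG Mod K)))
        (\<lambda>(X, Y). \<psi> (tensor H X Y))"
      by (rule continuous_compose_quotient_map[OF quotient_map_prod_open[OF opn cont surj' opn cont surj']])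
    then have "kernel ?TH (?TG Mod K) \<psi> \<in> tensor_p_quotients p H T'"
      by (rule tensor_p_quotients_kernel[OF p T' tensor_p_quotientsD(2)[OF K'] \<psi>(1)])
    moreover have ker: "tensor H (f a) (f b) \<in> kernel ?TH (?TG Mod K) \<psi> \<longleftrightarrow> tensor G a b \<in> K"
      if "a \<in> carrier G" "b \<in> carrier G" for a b
      using q_self[OF that] g_f[OF that] \<psi>(2) that by (simp add: kernel_def tensor_carrier)
    moreover have "tensor H X X \<in> kernel ?TH (?TG Mod K) \<psi>" if "X \<in> carrier H" for X
      using ker[OF r(1) r(1), OF that that] diag[OF r(1)[OF that]] r(2)[OF that] by simp
    ultimately have "kernel ?TH (?TG Mod K) \<psi> \<in> exterior_p_quotients p H T'"
      unfolding exterior_p_quotients_def by (intro CollectI conjI ballI)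
    from wedge[OF this] show ?thesis using ker[OF xyG] by simp
  qed
  then show ?thesis using xyG by (simp add: trivial_wedges_eq[OF p G T])
qed

section \<open>Compact groups with a base of open normal subgroups\<close>

text \<open>Lebesgue's covering lemma for a directed family of partitions into open sets, with \<open>B i z\<close> the block of
  the \<open>i\<close>-th partition that contains \<open>z\<close>. It serves both the group and its square.\<close>

lemma uniform_neighbourhood_in_cover:
  fixes B :: "'i \<Rightarrow> 'z \<Rightarrow> 'z set"
  assumes C: "compactin X C" and I: "I \<noteq> {}"
    and directed: "\<And>i j. i \<in> I \<Longrightarrow> j \<in> I \<Longrightarrow> \<exists>k\<in>I. \<forall>z\<in>C. B k z \<subseteq> B i z \<inter> B j z"
    and opn: "\<And>i z. i \<in> I \<Longrightarrow> z \<in> C \<Longrightarrow> openin X (B i z)"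
    and self: "\<And>i z. i \<in> I \<Longrightarrow> z \<in> C \<Longrightarrow> z \<in> B i z"
    and part: "\<And>i z w. i \<in> I \<Longrightarrow> z \<in> C \<Longrightarrow> w \<in> C \<Longrightarrow> w \<in> B i z \<Longrightarrow> B i w \<subseteq> B i z"
    and cover: "\<And>z. z \<in> C \<Longrightarrow> \<exists>i\<in>I. \<exists>U\<in>\<U>. B i z \<subseteq> U"
  obtains k where "k \<in> I" "\<And>z. z \<in> C \<Longrightarrow> \<exists>U\<in>\<U>. B k z \<subseteq> U"
proof -
  have "\<forall>z\<in>C. \<exists>i. i \<in> I \<and> (\<exists>U\<in>\<U>. B i z \<subseteq> U)" using cover by blast
  then obtain i where "\<forall>z\<in>C. i z \<in> I \<and> (\<exists>U\<in>\<U>. B (i z) z \<subseteq> U)" by (rule bchoice[THEN exE])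
  then have i: "\<And>z. z \<in> C \<Longrightarrow> i z \<in> I \<and> (\<exists>U\<in>\<U>. B (i z) z \<subseteq> U)" by blast
  let ?V = "\<lambda>z. B (i z) z"
  have "\<exists>F. finite F \<and> F \<subseteq> ?V ` C \<and> C \<subseteq> \<Union>F"
    by (rule compactinD[OF C]) (use opn self i in auto)
  then obtain F where F: "finite F" "F \<subseteq> ?V ` C" "C \<subseteq> \<Union>F" by blast
  obtain D where D: "D \<subseteq> C" "finite D" "F = ?V ` D" using finite_subset_image[OF F(1,2)] by blast
  then have D: "finite D" "D \<subseteq> C" "C \<subseteq> (\<Union>z\<in>D. ?V z)" using F(3) by simp_all
  have "\<exists>k\<in>I. \<forall>z\<in>D. \<forall>w\<in>C. B k w \<subseteq> B (i z) w"
    using D(1,2)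
  proof (induct D)
    case empty then show ?case using I by blast
  next
    case (insert z D)
    then obtain k where k: "k \<in> I" "\<forall>z\<in>D. \<forall>w\<in>C. B k w \<subseteq> B (i z) w" by auto
    obtain l where l: "l \<in> I" "\<forall>w\<in>C. B l w \<subseteq> B k w \<inter> B (i z) w"
      using directed[OF k(1), of "i z"] i insert.prems by blast
    have "B l w \<subseteq> B (i z') w" if "z' \<in> insert z D" "w \<in> C" for z' w
      using that k(2) l(2) by blast
    then show ?case using l(1) by blast
  qed
  then obtain k where k: "k \<in> I" "\<And>z w. z \<in> D \<Longrightarrow> w \<in> C \<Longrightarrow> B k w \<subseteq> B (i z) w" by blast
  show thesis
  proof (rule that[OF k(1)])
    fix w assume w: "w \<in> C"
    then obtain z where z: "z \<in> D" "w \<in> ?V z" using D(3) by blast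
    then have "B k w \<subseteq> ?V z" using k(2)[OF z(1) w] part[of "i z" z w] i D(2) w by blast
    then show "\<exists>U\<in>\<U>. B k w \<subseteq> U" using i[of z] z(1) D(2) by (meson subsetD subset_trans)
  qed
qed

text \<open>For Hausdorff groups these conditions say that \<open>G\<close> is profinite.\<close>

locale profinite_group = group G for G (structure) +
  fixes T :: "'a topology"
  assumes topological: "topological_group G T"
    and compact: "compact_space T"
    and base: "openin T U \<Longrightarrow> \<one> \<in> U \<Longrightarrow> \<exists>M. M \<lhd> G \<and> openin T M \<and> M \<subseteq> U"
begin

definition open_normals :: "'a set set" where
  "open_normals = {M. M \<lhd> G \<and> openin T M}"

lemma topspace_eq: "topspace T = carrier G"
  using topological by (simp add: topological_group_def)

lemma open_normalD:
  assumes "M \<in> open_normals"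
  shows "M \<lhd> G" "subgroup M G" "openin T M" "M \<subseteq> carrier G"
proof -
  show 1: "M \<lhd> G" and "openin T M" using assms by (simp_all add: open_normals_def)
  show 2: "subgroup M G" using normal_imp_subgroup[OF 1] .
  show "M \<subseteq> carrier G" using subgroup.subset[OF 2] .
qed

lemma openin_subset_carrier: "openin T U \<Longrightarrow> U \<subseteq> carrier G"
  using openin_subset topspace_eq by metis

lemma continuous_mult:
  assumes "continuous_map T T f" "continuous_map T T g"
  shows "continuous_map T T (\<lambda>y. f y \<otimes> g y)"
proof -
  have "continuous_map (prod_topology T T) T (\<lambda>(x, y). x \<otimes> y)"
    using topological by (simp add: topological_group_def)
  from continuous_map_compose[OF continuous_map_pairedI[OF assms] this] show ?thesis
    by (simp add: comp_def)
qed

lemma continuous_translation: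
  assumes "x \<in> carrier G"
  shows "continuous_map T T (\<lambda>y. x \<otimes> y)" "continuous_map T T (\<lambda>y. y \<otimes> x)"
proof -
  have "continuous_map T T (\<lambda>_. x)" using assms by (simp add: topspace_eq)
  then show "continuous_map T T (\<lambda>y. x \<otimes> y)" "continuous_map T T (\<lambda>y. y \<otimes> x)"
    using continuous_mult[of "\<lambda>_. x" "\<lambda>y. y"] continuous_mult[of "\<lambda>y. y" "\<lambda>_. x"] by simp_all
qed

lemma l_coset_eq_preimage:
  assumes "x \<in> carrier G" "A \<subseteq> carrier G"
  shows "x <# A = {y \<in> carrier G. inv x \<otimes> y \<in> A}"
proof (intro equalityI subsetI)
  fix y assume "y \<in> x <# A"
  then obtain a where "a \<in> A" "y = x \<otimes> a" by (auto simp: l_coset_def)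
  then show "y \<in> {y \<in> carrier G. inv x \<otimes> y \<in> A}"
    using assms by (auto simp: m_assoc[symmetric])
next
  fix y assume "y \<in> {y \<in> carrier G. inv x \<otimes> y \<in> A}"
  then have y: "y \<in> carrier G" "inv x \<otimes> y \<in> A" by auto
  have "x \<otimes> (inv x \<otimes> y) = y" using assms y(1) by (simp add: m_assoc[symmetric])
  moreover have "x \<otimes> (inv x \<otimes> y) \<in> x <# A" using y(2) unfolding l_coset_def by blast
  ultimately show "y \<in> x <# A" by simp
qed

lemma r_coset_eq_preimage:
  assumes "x \<in> carrier G" "A \<subseteq> carrier G"
  shows "A #> x = {y \<in> carrier G. y \<otimes> inv x \<in> A}"
proof (intro equalityI subsetI)
  fix y assume "y \<in> A #> x"
  then obtain a where "a \<in> A" "y = a \<otimes> x" by (auto simp: r_coset_def)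
  then show "y \<in> {y \<in> carrier G. y \<otimes> inv x \<in> A}"
    using assms by (auto simp: m_assoc)
next
  fix y assume "y \<in> {y \<in> carrier G. y \<otimes> inv x \<in> A}"
  then have y: "y \<in> carrier G" "y \<otimes> inv x \<in> A" by auto
  have "(y \<otimes> inv x) \<otimes> x = y" using assms y(1) by (simp add: m_assoc)
  moreover have "(y \<otimes> inv x) \<otimes> x \<in> A #> x" using y(2) unfolding r_coset_def by blast
  ultimately show "y \<in> A #> x" by simp
qed

lemma openin_l_coset:
  assumes "openin T U" "x \<in> carrier G"
  shows "openin T (x <# U)"
  using openin_continuous_map_preimage[OF continuous_translation(1) assms(1), of "inv x"] assms
  by (simp add: l_coset_eq_preimage openin_subset_carrier topspace_eq)

lemma openin_r_coset:
  assumes "openin T U" "x \<in> carrier G"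
  shows "openin T (U #> x)"
  using openin_continuous_map_preimage[OF continuous_translation(2) assms(1), of "inv x"] assms
  by (simp add: r_coset_eq_preimage openin_subset_carrier topspace_eq)

lemma openin_rcosets: "M \<in> open_normals \<Longrightarrow> C \<in> rcosets M \<Longrightarrow> openin T C"
  using openin_r_coset open_normalD(3) by (auto simp: RCOSETS_def)

text \<open>The cosets form an open cover in which no member is redundant.\<close>

lemma finite_rcosets:
  assumes M: "M \<in> open_normals"
  shows "finite (rcosets M)"
proof -
  have "\<exists>F. finite F \<and> F \<subseteq> rcosets M \<and> topspace T \<subseteq> \<Union>F"
    using compact openin_rcosets[OF M] rcosets_part_G[OF open_normalD(2)[OF M]]
    by (intro compactinD) (auto simp: compact_space_def topspace_eq)
  then obtain F where F: "finite F" "F \<subseteq> rcosets M" "carrier G \<subseteq> \<Union>F" by (auto simp: topspace_eq)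
  have "C \<in> F" if C: "C \<in> rcosets M" for C
  proof -
    obtain x where x: "x \<in> C"
      using subgroup.rcosets_non_empty[OF open_normalD(2)[OF M] C] by blast
    then have "x \<in> carrier G"
      using C rcosets_part_G[OF open_normalD(2)[OF M]] by blast
    then obtain D where "D \<in> F" "x \<in> D" using F(3) by blast
    then show ?thesis
      using x C F(2) rcos_disjoint[OF open_normalD(2)[OF M]] by (metis disjnt_iff pairwiseD subsetD)
  qed
  then show ?thesis by (intro finite_subset[OF _ F(1)] subsetI)
qed

lemma open_normals_Int:
  assumes "M \<in> open_normals" "M' \<in> open_normals"
  shows "M \<inter> M' \<in> open_normals"
  using assms normal_subgroup_intersect openin_Int unfolding open_normals_def by blast

lemma carrier_open_normal: "carrier G \<in> open_normals"
proof -
  have "carrier G \<lhd> G" unfolding normal_inv_iff using subgroup_self by simp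
  moreover have "openin T (carrier G)" using openin_topspace topspace_eq by metis
  ultimately show ?thesis by (simp add: open_normals_def)
qed

text \<open>The base at \<open>\<one>\<close> is moved to \<open>x\<close> by a translation.\<close>

lemma open_neighbourhood:
  assumes U: "openin T U" and x: "x \<in> U"
  obtains M where "M \<in> open_normals" "M #> x \<subseteq> U"
proof -
  have xG: "x \<in> carrier G" using openin_subset_carrier[OF U] x by blast
  have "openin T (U #> inv x)" using U xG by (intro openin_r_coset) simp_all
  moreover have "\<one> \<in> U #> inv x" using x xG by (force simp: r_coset_def)
  ultimately obtain M where M: "M \<lhd> G" "openin T M" "M \<subseteq> U #> inv x" using base by blast
  have "M #> x \<subseteq> U"
  proof
    fix y assume "y \<in> M #> x"
    then obtain u where "u \<in> U" and "y = u \<otimes> inv x \<otimes> x" using M(3) by (auto simp: r_coset_def)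
    moreover have "u \<in> carrier G" using openin_subset_carrier[OF U] \<open>u \<in> U\<close> by (rule subsetD)
    ultimately show "y \<in> U" using xG by (simp add: m_assoc)
  qed
  then show thesis using that M(1,2) by (simp add: open_normals_def)
qed

lemma r_coset_mono: "M \<subseteq> M' \<Longrightarrow> M #> x \<subseteq> M' #> x"
  by (auto simp: r_coset_def)

lemma rcos_of_member:
  assumes "M \<in> open_normals" "x \<in> carrier G" "y \<in> M #> x"
  shows "M #> y = M #> x"
  using repr_independence[OF assms(3,2) open_normalD(2)[OF assms(1)]] by simp

text \<open>Placing the new subgroup inside a given \<open>M0\<close> keeps unions of cosets of \<open>M0\<close> unions of cosets.\<close>

lemma uniform_refinement:
  assumes C: "compactin T C" and M0: "M0 \<in> open_normals"
    and opn: "\<And>U. U \<in> \<U> \<Longrightarrow> openin T U" and cover: "C \<subseteq> \<Union>\<U>"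
  obtains M where "M \<in> open_normals" "M \<subseteq> M0" "\<And>x. x \<in> C \<Longrightarrow> \<exists>U\<in>\<U>. M #> x \<subseteq> U"
proof -
  have CG: "C \<subseteq> carrier G" using C compactin_subset_topspace topspace_eq by metis
  let ?I = "{M \<in> open_normals. M \<subseteq> M0}"
  obtain M where "M \<in> ?I" and "\<And>x. x \<in> C \<Longrightarrow> \<exists>U\<in>\<U>. M #> x \<subseteq> U"
  proof (rule uniform_neighbourhood_in_cover[OF C, of ?I "\<lambda>M x. M #> x" \<U>])
    show "?I \<noteq> {}" using M0 by blast
    show "\<exists>k\<in>?I. \<forall>z\<in>C. k #> z \<subseteq> (M #> z) \<inter> (M' #> z)" if "M \<in> ?I" "M' \<in> ?I" for M M'
    proof -
      have "M \<inter> M' \<in> ?I" using that open_normals_Int[of M M'] by blast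
      moreover have "M \<inter> M' #> z \<subseteq> (M #> z) \<inter> (M' #> z)" for z
        by (intro Int_greatest r_coset_mono) simp_all
      ultimately show ?thesis by (intro bexI[of _ "M \<inter> M'"] ballI)
    qed
    show "openin T (M #> z)" if "M \<in> ?I" "z \<in> C" for M z
      using that CG openin_r_coset open_normalD(3) by auto
    show "z \<in> M #> z" if "M \<in> ?I" "z \<in> C" for M z
      using that CG rcos_self open_normalD(2) by auto
    show "M #> w \<subseteq> M #> z" if "M \<in> ?I" "z \<in> C" "w \<in> C" "w \<in> M #> z" for M z w
      using that CG rcos_of_member[of M z w] by auto
    show "\<exists>M\<in>?I. \<exists>U\<in>\<U>. M #> z \<subseteq> U" if z: "z \<in> C" for z
    proof -
      obtain U where U: "U \<in> \<U>" "z \<in> U" using z cover by blast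
      obtain M where M: "M \<in> open_normals" "M #> z \<subseteq> U" using open_neighbourhood[OF opn[OF U(1)] U(2)] .
      have "M \<inter> M0 \<in> ?I" using open_normals_Int[OF M(1) M0] by simp
      moreover have "M \<inter> M0 #> z \<subseteq> U" using r_coset_mono[of "M \<inter> M0" M z] M(2) by simp
      ultimately show ?thesis using U(1) by (intro bexI[of _ "M \<inter> M0"] bexI[of _ U])
    qed
  qed (rule that)
  then show thesis using that[of M] by simp
qed

lemma uniform_refinement_square:
  assumes C: "compactin (prod_topology T T) C" and U: "openin (prod_topology T T) U" and CU: "C \<subseteq> U"
  obtains M where "M \<in> open_normals" "\<And>x y. (x, y) \<in> C \<Longrightarrow> (M #> x) \<times> (M #> y) \<subseteq> U"
proof -
  have CG: "C \<subseteq> carrier G \<times> carrier G"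
    using compactin_subset_topspace[OF C] by (simp add: topspace_eq)
  let ?B = "\<lambda>M z. (M #> fst z) \<times> (M #> snd z)"
  obtain M where M: "M \<in> open_normals" "\<And>z. z \<in> C \<Longrightarrow> \<exists>V\<in>{U}. ?B M z \<subseteq> V"
  proof (rule uniform_neighbourhood_in_cover[OF C, of open_normals ?B "{U}"])
    show "open_normals \<noteq> {}" using carrier_open_normal by blast
    show "\<exists>k\<in>open_normals. \<forall>z\<in>C. ?B k z \<subseteq> ?B M z \<inter> ?B M' z"
      if "M \<in> open_normals" "M' \<in> open_normals" for M M'
    proof -
      have "?B (M \<inter> M') z \<subseteq> ?B M z \<inter> ?B M' z" for z
        by (intro Int_greatest Sigma_mono r_coset_mono) simp_all
      then show ?thesis using open_normals_Int[OF that] by (intro bexI[of _ "M \<inter> M'"] ballI)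
    qed
    show "openin (prod_topology T T) (?B M z)" if "M \<in> open_normals" "z \<in> C" for M z
      using that CG openin_r_coset open_normalD(3) by (auto simp: openin_prod_Times_iff)
    show "z \<in> ?B M z" if "M \<in> open_normals" "z \<in> C" for M z
      using that CG rcos_self open_normalD(2) by (cases z) auto
    show "?B M w \<subseteq> ?B M z" if "M \<in> open_normals" "z \<in> C" "w \<in> C" "w \<in> ?B M z" for M z w
      using that CG rcos_of_member[of M "fst z" "fst w"] rcos_of_member[of M "snd z" "snd w"] by auto
    show "\<exists>M\<in>open_normals. \<exists>V\<in>{U}. ?B M z \<subseteq> V" if z: "z \<in> C" for z
    proof -
      obtain x y where zxy: "z = (x, y)" by (cases z)
      obtain V W where VW: "openin T V" "openin T W" "x \<in> V" "y \<in> W" "V \<times> W \<subseteq> U"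
        using U z CU unfolding openin_prod_topology_alt zxy by (meson subsetD)
      obtain M where M: "M \<in> open_normals" "M #> x \<subseteq> V" using open_neighbourhood[OF VW(1,3)] .
      obtain M' where M': "M' \<in> open_normals" "M' #> y \<subseteq> W" using open_neighbourhood[OF VW(2,4)] .
      have "(M \<inter> M' #> x) \<times> (M \<inter> M' #> y) \<subseteq> U"
        using M(2) M'(2) VW(5) r_coset_mono[of "M \<inter> M'" M x] r_coset_mono[of "M \<inter> M'" M' y] by blast
      then show ?thesis using open_normals_Int[OF M(1) M'(1)] zxy by auto
    qed
  qed (rule that)
  show thesis
  proof (rule that[OF M(1)])
    show "(M #> x) \<times> (M #> y) \<subseteq> U" if "(x, y) \<in> C" for x y using M(2)[OF that] by simp
  qed
qed

end

section \<open>The content of an open set\<close>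

context profinite_group
begin

text \<open>The largest subset of \<open>U\<close> that is a union of cosets of \<open>M\<close>. For an open normal subgroup \<open>M\<close> it is clopen and compact.\<close>

definition coset_core :: "'a set \<Rightarrow> 'a set \<Rightarrow> 'a set" where
  "coset_core M U = \<Union>{C \<in> rcosets M. C \<subseteq> U}"

definition coset_ratio :: "'a set \<Rightarrow> 'a set \<Rightarrow> ennreal" where
  "coset_ratio M U = ennreal (real (card {C \<in> rcosets M. C \<subseteq> U}) / real (card (rcosets M)))"

text \<open>The supremum is a limit along the open normal subgroups, since the ratios increase as \<open>M\<close> shrinks.\<close>

definition haar_content :: "'a set \<Rightarrow> ennreal" where
  "haar_content U = (SUP M\<in>open_normals. coset_ratio M U)"

lemma rcosetsE:
  assumes "C \<in> rcosets M"
  obtains x where "x \<in> carrier G" "C = M #> x"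
  using assms that unfolding RCOSETS_def by (elim UN_E) (simp only: singleton_iff)

lemma rcosets_nonempty: "M \<in> open_normals \<Longrightarrow> C \<in> rcosets M \<Longrightarrow> C \<noteq> {}"
  using subgroup.rcosets_non_empty[OF open_normalD(2)] .

lemma rcosets_subset_carrier: "M \<in> open_normals \<Longrightarrow> C \<in> rcosets M \<Longrightarrow> C \<subseteq> carrier G"
  using rcosets_part_G[OF open_normalD(2)] by blast

lemma rcosets_eqI:
  assumes "M \<in> open_normals" "C \<in> rcosets M" "D \<in> rcosets M" "x \<in> C" "x \<in> D"
  shows "C = D"
  using rcos_disjoint[OF open_normalD(2)[OF assms(1)]] assms(2-5)
  unfolding pairwise_def disjnt_iff by metis

lemma rcos_of_elem:
  assumes "M \<in> open_normals" "C \<in> rcosets M" "x \<in> C"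
  shows "C = M #> x"
proof -
  have x: "x \<in> carrier G" using rcosets_subset_carrier[OF assms(1,2)] assms(3) by (rule subsetD)
  have "M #> x \<in> rcosets M" using rcosetsI[OF open_normalD(4)[OF assms(1)] x] .
  then show ?thesis using rcosets_eqI[OF assms(1,2) _ assms(3)] rcos_self[OF x open_normalD(2)[OF assms(1)]]
    by blast
qed

lemma card_rcosets_pos: "M \<in> open_normals \<Longrightarrow> 0 < card (rcosets M)"
  using finite_rcosets rcosetsI[OF open_normalD(4) one_closed] by (metis card_gt_0_iff empty_iff)

lemma coset_core_subset: "coset_core M U \<subseteq> U"
  by (auto simp: coset_core_def)

lemma openin_Union_rcosets:
  assumes "M \<in> open_normals" "\<C> \<subseteq> rcosets M"
  shows "openin T (\<Union>\<C>)"
  using assms openin_rcosets by (intro openin_Union) blast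

lemma compactin_Union_rcosets:
  assumes M: "M \<in> open_normals" and C: "\<C> \<subseteq> rcosets M"
  shows "compactin T (\<Union>\<C>)"
proof -
  have eq: "topspace T - \<Union>(rcosets M - \<C>) = \<Union>\<C>"
  proof (intro equalityI subsetI)
    fix x assume x: "x \<in> topspace T - \<Union>(rcosets M - \<C>)"
    then have "x \<in> \<Union>(rcosets M)" using rcosets_part_G[OF open_normalD(2)[OF M]] topspace_eq by blast
    then show "x \<in> \<Union>\<C>" using x by blast
  next
    fix x assume "x \<in> \<Union>\<C>"
    then obtain D where D: "D \<in> \<C>" "x \<in> D" by blast
    then have "x \<in> topspace T" using rcosets_subset_carrier[OF M] C topspace_eq by blast
    moreover have "D' = D" if "D' \<in> rcosets M" "x \<in> D'" for D'
      using rcosets_eqI[OF M that(1) _ that(2) D(2)] D(1) C by blast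
    ultimately show "x \<in> topspace T - \<Union>(rcosets M - \<C>)" using D(1) by blast
  qed
  have "closedin T (topspace T - \<Union>(rcosets M - \<C>))"
    using openin_Union_rcosets[OF M, of "rcosets M - \<C>"] by blast
  then show ?thesis unfolding eq using closedin_compact_space[OF compact] by blast
qed

text \<open>Every coset of \<open>M\<close> splits into the same number of cosets of \<open>M'\<close>, since right translation matches
  those inside \<open>M\<close> with those inside \<open>M #> x\<close>.\<close>

lemma card_refined_rcosets:
  assumes M: "M \<in> open_normals" and M': "M' \<in> open_normals" and sub: "M' \<subseteq> M"
    and C: "\<C> \<subseteq> rcosets M"
  shows "card {D \<in> rcosets M'. D \<subseteq> \<Union>\<C>} = card {D \<in> rcosets M'. D \<subseteq> M} * card \<C>"
proof -
  let ?R = "\<lambda>C. {D \<in> rcosets M'. D \<subseteq> C}"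
  have fin: "finite (?R C)" for C using finite_rcosets[OF M'] by simp
  have finC: "finite \<C>" using finite_subset[OF C finite_rcosets[OF M]] .
  have "?R (\<Union>\<C>) = (\<Union>C\<in>\<C>. ?R C)"
  proof (intro equalityI subsetI)
    fix D assume D: "D \<in> ?R (\<Union>\<C>)"
    then obtain x where x: "x \<in> D" using rcosets_nonempty[OF M'] by blast
    then obtain C' where C': "C' \<in> \<C>" "x \<in> C'" using D by blast
    have "D = M' #> x" "C' = M #> x"
      using rcos_of_elem[OF M' _ x] rcos_of_elem[OF M _ C'(2)] D C' C by blast+
    then have "D \<subseteq> C'" using r_coset_mono[OF sub] by simp
    then show "D \<in> (\<Union>C\<in>\<C>. ?R C)" using D C'(1) by blast
  qed blast
  also have "card \<dots> = (\<Sum>C\<in>\<C>. card (?R C))"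
  proof (rule card_UN_disjoint[OF finC])
    show "\<forall>C\<in>\<C>. finite (?R C)" using fin by blast
    show "\<forall>C\<in>\<C>. \<forall>D\<in>\<C>. C \<noteq> D \<longrightarrow> ?R C \<inter> ?R D = {}"
    proof (intro ballI impI)
      fix C D assume CD: "C \<in> \<C>" "D \<in> \<C>" "C \<noteq> D"
      have "E \<notin> ?R D" if "E \<in> ?R C" for E
      proof
        assume "E \<in> ?R D"
        obtain x where "x \<in> E" using rcosets_nonempty[OF M', of E] \<open>E \<in> ?R C\<close> by blast
        then have "x \<in> C" "x \<in> D" using \<open>E \<in> ?R C\<close> \<open>E \<in> ?R D\<close> by blast+
        then show False using rcosets_eqI[OF M, of C D x] CD C by blast
      qed
      then show "?R C \<inter> ?R D = {}" by blast
    qed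
  qed
  also have "\<dots> = (\<Sum>C\<in>\<C>. card (?R M))"
  proof (rule sum.cong[OF HOL.refl])
    fix C' assume "C' \<in> \<C>"
    then have "C' \<in> rcosets M" using C by blast
    then obtain x where x: "x \<in> carrier G" "C' = M #> x" by (rule rcosetsE)
    have tr: "D #> y \<in> ?R (E #> y)" if "D \<in> ?R E" "y \<in> carrier G" for D E y
    proof -
      have "D \<in> rcosets M'" using that(1) by simp
      then obtain d where d: "d \<in> carrier G" "D = M' #> d" by (rule rcosetsE)
      have "D #> y = M' #> (d \<otimes> y)"
        using d that(2) coset_mult_assoc[OF open_normalD(4)[OF M']] by simp
      then have "D #> y \<in> rcosets M'" using d that(2) rcosetsI[OF open_normalD(4)[OF M']] by simp
      then show ?thesis using that(1) r_coset_mono[of D E y] by simp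
    qed
    have cancel: "(D #> y) #> inv y = D" if "D \<subseteq> carrier G" "y \<in> carrier G" for D y
      using that by (simp add: coset_mult_assoc)
    have "bij_betw (\<lambda>D. D #> x) (?R M) (?R C')"
    proof (rule bij_betw_byWitness[where f' = "\<lambda>D. D #> inv x"])
      show "\<forall>D\<in>?R M. (D #> x) #> inv x = D"
        using cancel x(1) rcosets_subset_carrier[OF M'] by blast
      show "\<forall>D\<in>?R C'. (D #> inv x) #> x = D"
        using cancel[of _ "inv x"] x(1) rcosets_subset_carrier[OF M'] by simp
      show "(\<lambda>D. D #> x) ` ?R M \<subseteq> ?R C'" using tr[of _ M x] x by blast
      have "C' #> inv x = M" using cancel[OF open_normalD(4)[OF M] x(1)] x(2) by simp
      then show "(\<lambda>D. D #> inv x) ` ?R C' \<subseteq> ?R M"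
        using tr[OF _ inv_closed[OF x(1)], of _ C'] by (intro image_subsetI) (simp only:)
    qed
    from bij_betw_same_card[OF this] show "card (?R C') = card (?R M)" by (rule HOL.sym)
  qed
  also have "\<dots> = card (?R M) * card \<C>" by (simp only: sum_constant of_nat_id mult.commute)
  finally show ?thesis .
qed

lemma coset_ratio_refine:
  assumes M: "M \<in> open_normals" and M': "M' \<in> open_normals" and sub: "M' \<subseteq> M"
  shows "coset_ratio M' (coset_core M U) = coset_ratio M U"
proof -
  let ?k = "card {D \<in> rcosets M'. D \<subseteq> M}"
  have "\<Union>(rcosets M) = carrier G" using rcosets_part_G[OF open_normalD(2)[OF M]] .
  then have "{D \<in> rcosets M'. D \<subseteq> \<Union>(rcosets M)} = rcosets M'" using rcosets_subset_carrier[OF M'] by blast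
  then have idx: "card (rcosets M') = ?k * card (rcosets M)"
    using card_refined_rcosets[OF M M' sub subset_refl] by simp
  then have k: "0 < ?k" using card_rcosets_pos[OF M'] by (metis mult_0 not_gr_zero)
  have count: "card {D \<in> rcosets M'. D \<subseteq> coset_core M U} = ?k * card {C \<in> rcosets M. C \<subseteq> U}"
    unfolding coset_core_def by (rule card_refined_rcosets[OF M M' sub]) blast
  have "real k * a / (real k * b) = a / b" if "0 < k" for k :: nat and a b :: real
    using that by simp
  from this[OF k] show ?thesis unfolding coset_ratio_def idx count of_nat_mult by (rule arg_cong)
qed

lemma coset_ratio_mono:
  assumes M: "M \<in> open_normals" and "U \<subseteq> V"
  shows "coset_ratio M U \<le> coset_ratio M V"
proof -
  have "card {C \<in> rcosets M. C \<subseteq> U} \<le> card {C \<in> rcosets M. C \<subseteq> V}"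
    using assms finite_rcosets[OF M] by (intro card_mono) auto
  then show ?thesis unfolding coset_ratio_def
    by (intro ennreal_leI divide_right_mono) simp_all
qed

text \<open>Passing to a smaller subgroup does not change the proportion occupied by the old coset core, and can only
  add further cosets.\<close>

lemma coset_ratio_antimono:
  assumes "M \<in> open_normals" "M' \<in> open_normals" "M' \<subseteq> M"
  shows "coset_ratio M U \<le> coset_ratio M' U"
  using coset_ratio_refine[OF assms] coset_ratio_mono[OF assms(2) coset_core_subset] by metis

lemma coset_ratio_carrier:
  assumes M: "M \<in> open_normals"
  shows "coset_ratio M (carrier G) = 1"
proof -
  have "{C \<in> rcosets M. C \<subseteq> carrier G} = rcosets M" using rcosets_subset_carrier[OF M] by blast
  then show ?thesis using card_rcosets_pos[OF M] by (simp add: coset_ratio_def)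
qed

lemma open_normals_nonempty: "open_normals \<noteq> {}"
  using carrier_open_normal by blast

lemma haar_content_mono: "U \<subseteq> V \<Longrightarrow> haar_content U \<le> haar_content V"
  unfolding haar_content_def by (rule SUP_mono) (blast intro: coset_ratio_mono)

lemma haar_content_carrier: "haar_content (carrier G) = 1"
proof -
  have "haar_content (carrier G) = (SUP M\<in>open_normals. 1)"
    unfolding haar_content_def by (intro SUP_cong HOL.refl coset_ratio_carrier)
  also have "\<dots> = 1" by (rule SUP_const[OF open_normals_nonempty])
  finally show ?thesis .
qed

lemma haar_content_empty: "haar_content {} = 0"
proof -
  have "coset_ratio M {} = 0" if "M \<in> open_normals" for M
  proof -
    have "{C \<in> rcosets M. C \<subseteq> {}} = {}" using rcosets_nonempty[OF that] by blast
    then show ?thesis by (simp add: coset_ratio_def)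
  qed
  then have "haar_content {} = (SUP M\<in>open_normals. 0)"
    unfolding haar_content_def by (intro SUP_cong HOL.refl)
  also have "\<dots> = 0" by (rule SUP_const[OF open_normals_nonempty])
  finally show ?thesis .
qed

lemma coset_ratio_le_content: "M \<in> open_normals \<Longrightarrow> coset_ratio M U \<le> haar_content U"
  unfolding haar_content_def by (rule SUP_upper)

lemma coset_ratio_le_content_core: "M \<in> open_normals \<Longrightarrow> coset_ratio M U \<le> haar_content (coset_core M U)"
  using coset_ratio_refine[of M M U] coset_ratio_le_content by (metis subset_refl)

text \<open>Both ratios can be computed with the cosets of one common subgroup, where they count
  disjoint collections. This is the superadditivity behind Caratheodory measurability of open sets.\<close>

lemma haar_content_disjoint:
  assumes M: "M \<in> open_normals" and sub: "U \<subseteq> W" "V \<subseteq> W" and dis: "coset_core M U \<inter> V = {}"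
  shows "coset_ratio M U + haar_content V \<le> haar_content W"
proof -
  have le: "coset_ratio M U + coset_ratio M1 V \<le> haar_content W" if M1: "M1 \<in> open_normals" for M1
  proof -
    let ?M = "M \<inter> M1"
    have M2: "?M \<in> open_normals" using open_normals_Int[OF M M1] .
    let ?A = "{C \<in> rcosets ?M. C \<subseteq> coset_core M U}" and ?B = "{C \<in> rcosets ?M. C \<subseteq> V}"
      and ?W = "{C \<in> rcosets ?M. C \<subseteq> W}"
    have "coset_ratio M U + coset_ratio M1 V \<le> coset_ratio ?M (coset_core M U) + coset_ratio ?M V"
      using coset_ratio_refine[OF M M2] coset_ratio_antimono[OF M1 M2, of V]
      by (intro add_mono) simp_all
    also have "\<dots> = ennreal (real (card ?A + card ?B) / real (card (rcosets ?M)))"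
      unfolding coset_ratio_def by (simp add: ennreal_plus[symmetric] add_divide_distrib del: ennreal_plus)
    also have "card ?A + card ?B = card (?A \<union> ?B)"
    proof (rule card_Un_disjoint[symmetric])
      have "C \<notin> ?B" if "C \<in> ?A" for C
        using that rcosets_nonempty[OF M2, of C] dis by blast
      then show "?A \<inter> ?B = {}" by blast
    qed (use finite_rcosets[OF M2] in simp_all)
    also have "card (?A \<union> ?B) \<le> card ?W"
    proof (rule card_mono)
      show "finite ?W" using finite_rcosets[OF M2] by simp
      show "?A \<union> ?B \<subseteq> ?W" using sub coset_core_subset[of M U] by blast
    qed
    then have "ennreal (real (card (?A \<union> ?B)) / real (card (rcosets ?M))) \<le> coset_ratio ?M W"
      unfolding coset_ratio_def by (intro ennreal_leI divide_right_mono) simp_all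
    also have "coset_ratio ?M W \<le> haar_content W" by (rule coset_ratio_le_content[OF M2])
    finally show ?thesis .
  qed
  have "coset_ratio M U + haar_content V = (SUP M1\<in>open_normals. coset_ratio M U + coset_ratio M1 V)"
    unfolding haar_content_def[of V] by (rule ennreal_SUP_add_right[OF open_normals_nonempty])
  also have "\<dots> \<le> haar_content W" by (rule SUP_least) (rule le)
  finally show ?thesis .
qed

text \<open>By compactness a coset core of the union is cut by a finer subgroup into cosets each of
  which lies in a single \<open>U i\<close>; only finitely many indices occur.\<close>

lemma haar_content_UN_le:
  fixes U :: "nat \<Rightarrow> 'a set"
  assumes U: "\<And>i. openin T (U i)"
  shows "haar_content (\<Union>i. U i) \<le> (\<Sum>i. haar_content (U i))"
  unfolding haar_content_def[of "\<Union>i. U i"]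
proof (rule SUP_least)
  fix M assume M: "M \<in> open_normals"
  let ?E = "coset_core M (\<Union>i. U i)"
  have comp: "compactin T ?E" unfolding coset_core_def by (rule compactin_Union_rcosets[OF M]) blast
  have cov: "?E \<subseteq> \<Union>(range U)" using coset_core_subset by blast
  obtain M' where M': "M' \<in> open_normals" "M' \<subseteq> M" "\<And>x. x \<in> ?E \<Longrightarrow> \<exists>V\<in>range U. M' #> x \<subseteq> V"
    using uniform_refinement[OF comp M _ cov] U by blast
  let ?A = "{C \<in> rcosets M'. C \<subseteq> ?E}"
  let ?B = "\<lambda>i. {C \<in> rcosets M'. C \<subseteq> U i}"
  have finA: "finite ?A" using finite_rcosets[OF M'(1)] by simp
  have ex: "\<exists>i. C \<in> ?B i" if "C \<in> ?A" for C
  proof -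
    have C: "C \<in> rcosets M'" "C \<subseteq> ?E" using that by simp_all
    obtain x where x: "x \<in> C" using rcosets_nonempty[OF M'(1) C(1)] by blast
    have "C = M' #> x" by (rule rcos_of_elem[OF M'(1) C(1) x])
    moreover obtain i where "M' #> x \<subseteq> U i" using M'(3)[of x] x C(2) by blast
    ultimately show ?thesis using C(1) by blast
  qed
  define j where "j C = (SOME i. C \<in> ?B i)" for C
  have j: "C \<in> ?B (j C)" if "C \<in> ?A" for C unfolding j_def by (rule someI_ex[OF ex[OF that]])
  obtain n where n: "\<And>C. C \<in> ?A \<Longrightarrow> j C < n"
    using finite_nat_set_iff_bounded[of "j ` ?A"] finA by auto
  have "?A \<subseteq> (\<Union>i<n. ?B i)" using j n by blast
  then have "card ?A \<le> card (\<Union>i<n. ?B i)"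
    using finite_rcosets[OF M'(1)] by (intro card_mono) simp_all
  also have "\<dots> \<le> (\<Sum>i<n. card (?B i))" by (rule card_UN_le[OF finite_lessThan])
  finally have "real (card ?A) \<le> real (\<Sum>i<n. card (?B i))" by (rule of_nat_mono)
  then have card: "real (card ?A) \<le> (\<Sum>i<n. real (card (?B i)))" unfolding of_nat_sum .
  have "coset_ratio M (\<Union>i. U i) = coset_ratio M' ?E" using coset_ratio_refine[OF M M'(1,2)] by simp
  also have "\<dots> \<le> ennreal ((\<Sum>i<n. real (card (?B i))) / real (card (rcosets M')))"
    unfolding coset_ratio_def using card by (intro ennreal_leI divide_right_mono) simp_all
  also have "\<dots> = (\<Sum>i<n. coset_ratio M' (U i))"
    unfolding coset_ratio_def sum_divide_distrib by (simp add: sum_ennreal)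
  also have "\<dots> \<le> (\<Sum>i<n. haar_content (U i))"
    by (intro sum_mono coset_ratio_le_content[OF M'(1)])
  also have "\<dots> \<le> (\<Sum>i. haar_content (U i))" by (intro sum_le_suminf) simp_all
  finally show "coset_ratio M (\<Union>i. U i) \<le> (\<Sum>i. haar_content (U i))" .
qed

lemma coset_ratio_translate:
  assumes M: "M \<in> open_normals" and x: "x \<in> carrier G"
  shows "coset_ratio M U \<le> coset_ratio M (x <# U)"
proof -
  have "x <# C \<in> {C \<in> rcosets M. C \<subseteq> x <# U}" if "C \<in> {C \<in> rcosets M. C \<subseteq> U}" for C
  proof -
    have "C \<in> rcosets M" using that by simp
    then obtain c where c: "c \<in> carrier G" "C = M #> c" by (rule rcosetsE)
    have "x <# C = x <# (c <# M)" using c normal.coset_eq[OF open_normalD(1)[OF M]] by simp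
    also have "\<dots> = (x \<otimes> c) <# M" using x c by (intro lcos_m_assoc open_normalD(4)[OF M])
    also have "\<dots> = M #> (x \<otimes> c)" using x c normal.coset_eq[OF open_normalD(1)[OF M]] by simp
    finally have "x <# C \<in> rcosets M" using x c rcosetsI[OF open_normalD(4)[OF M]] by simp
    moreover have "x <# C \<subseteq> x <# U" using that unfolding l_coset_def by blast
    ultimately show ?thesis by blast
  qed
  then have "(\<lambda>C. x <# C) ` {C \<in> rcosets M. C \<subseteq> U} \<subseteq> {C \<in> rcosets M. C \<subseteq> x <# U}" by blast
  moreover have "inj_on (\<lambda>C. x <# C) {C \<in> rcosets M. C \<subseteq> U}"
  proof (rule inj_on_inverseI[where g = "\<lambda>C. inv x <# C"])
    fix C assume "C \<in> {C \<in> rcosets M. C \<subseteq> U}"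
    then have "C \<subseteq> carrier G" using rcosets_subset_carrier[OF M] by blast
    then show "inv x <# (x <# C) = C" using x by (simp add: lcos_m_assoc lcos_mult_one)
  qed
  ultimately have "card {C \<in> rcosets M. C \<subseteq> U} \<le> card {C \<in> rcosets M. C \<subseteq> x <# U}"
    using finite_rcosets[OF M] by (intro card_inj_on_le) simp_all
  then show ?thesis unfolding coset_ratio_def by (intro ennreal_leI divide_right_mono) simp_all
qed

lemma l_coset_inverse: "x \<in> carrier G \<Longrightarrow> A \<subseteq> carrier G \<Longrightarrow> inv x <# (x <# A) = A"
  by (simp add: lcos_m_assoc lcos_mult_one)

lemma haar_content_translate:
  assumes x: "x \<in> carrier G" and U: "U \<subseteq> carrier G"
  shows "haar_content (x <# U) = haar_content U"
proof -
  have le: "haar_content U \<le> haar_content (x <# U)" if "x \<in> carrier G" for x U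
    unfolding haar_content_def by (rule SUP_mono) (blast intro: coset_ratio_translate that)
  show ?thesis
  proof (rule antisym)
    show "haar_content (x <# U) \<le> haar_content U"
      using le[OF inv_closed[OF x], of "x <# U"] unfolding l_coset_inverse[OF x U] .
  qed (rule le[OF x])
qed

end

section \<open>Haar measure\<close>

context profinite_group
begin

definition haar_outer :: "'a set \<Rightarrow> ennreal" where
  "haar_outer A = (INF U\<in>{U. openin T U \<and> A \<subseteq> U}. haar_content U)"

lemma openin_carrier: "openin T (carrier G)"
  using openin_topspace topspace_eq by metis

lemma haar_outer_le: "openin T U \<Longrightarrow> A \<subseteq> U \<Longrightarrow> haar_outer A \<le> haar_content U"
  unfolding haar_outer_def by (intro INF_lower) simp

lemma haar_outer_open:
  assumes "openin T U"
  shows "haar_outer U = haar_content U"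
proof (rule antisym)
  show "haar_outer U \<le> haar_content U" using haar_outer_le[OF assms] by simp
  show "haar_content U \<le> haar_outer U"
    unfolding haar_outer_def by (rule INF_greatest) (simp add: haar_content_mono)
qed

lemma haar_outer_mono: "A \<subseteq> B \<Longrightarrow> haar_outer A \<le> haar_outer B"
  unfolding haar_outer_def by (rule INF_superset_mono) auto

lemma haar_outer_close:
  assumes "haar_outer A < e"
  obtains U where "openin T U" "A \<subseteq> U" "haar_content U < e"
  using assms that unfolding haar_outer_def INF_less_iff by blast

lemma haar_outer_UN_le:
  fixes A :: "nat \<Rightarrow> 'a set"
  shows "haar_outer (\<Union>i. A i) \<le> (\<Sum>i. haar_outer (A i))"
proof (rule ennreal_le_epsilon)
  fix e :: real assume e: "0 < e" and fin: "(\<Sum>i. haar_outer (A i)) < Orderings.top"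
  have lt: "haar_outer (A n) < haar_outer (A n) + e * (1/2)^Suc n" for n
  proof -
    have "haar_outer (A n) < Orderings.top" using fin ennreal_suminf_lessD by blast
    moreover have "0 < ennreal (e * (1/2)^Suc n)" using e by simp
    ultimately show ?thesis by (simp add: less_top)
  qed
  have "\<exists>U. openin T U \<and> A n \<subseteq> U \<and> haar_content U \<le> haar_outer (A n) + e * (1/2)^Suc n" for n
    using haar_outer_close[OF lt[of n]] less_imp_le by metis
  then obtain U where U: "\<And>n. openin T (U n)" "\<And>n. A n \<subseteq> U n"
    "\<And>n. haar_content (U n) \<le> haar_outer (A n) + e * (1/2)^Suc n" by metis
  have "haar_outer (\<Union>i. A i) \<le> haar_content (\<Union>i. U i)"
    using U(1,2) by (intro haar_outer_le openin_Union) auto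
  also have "\<dots> \<le> (\<Sum>n. haar_content (U n))" by (rule haar_content_UN_le[OF U(1)])
  also have "\<dots> \<le> (\<Sum>n. haar_outer (A n) + e * (1/2) ^ Suc n)"
    by (intro suminf_le U(3)) auto
  also have "... = (\<Sum>n. haar_outer (A n)) + (\<Sum>n. ennreal e * ennreal ((1/2) ^ Suc n))"
    using e by (subst suminf_add[symmetric])
      (auto simp del: ennreal_suminf_cmult simp add: ennreal_mult[symmetric])
  also have "\<dots> = (\<Sum>n. haar_outer (A n)) + e"
    unfolding ennreal_suminf_cmult
    by (subst suminf_ennreal_eq[OF zero_le_power power_half_series]) auto
  finally show "haar_outer (\<Union>i. A i) \<le> (\<Sum>n. haar_outer (A n)) + e" .
qed

lemma haar_outer_empty: "haar_outer {} = 0"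
  using haar_outer_open[of "{}"] haar_content_empty by simp

lemma outer_measure_space_haar_outer: "outer_measure_space (Pow (carrier G)) haar_outer"
  unfolding outer_measure_space_def
proof (intro conjI)
  show "positive (Pow (carrier G)) haar_outer" by (simp add: positive_def haar_outer_empty)
  show "increasing (Pow (carrier G)) haar_outer" by (simp add: increasing_def haar_outer_mono)
  show "countably_subadditive (Pow (carrier G)) haar_outer"
    by (simp add: countably_subadditive_def haar_outer_UN_le)
qed

text \<open>Given an open \<open>W\<close> containing \<open>A\<close>, exhaust \<open>U \<inter> W\<close> by coset cores. These are clopen, so the rest of
  \<open>W\<close> is an open set, and it contains \<open>A - U\<close>.\<close>

lemma haar_outer_split_open:
  assumes U: "openin T U"
  shows "haar_outer (U \<inter> A) + haar_outer (A - U) \<le> haar_outer A"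
  unfolding haar_outer_def[of A]
proof (rule INF_greatest)
  fix W assume "W \<in> {W. openin T W \<and> A \<subseteq> W}"
  then have W: "openin T W" "A \<subseteq> W" by simp_all
  have UW: "openin T (U \<inter> W)" using openin_Int[OF U W(1)] .
  have step: "coset_ratio M (U \<inter> W) + haar_outer (A - U) \<le> haar_content W" if M: "M \<in> open_normals" for M
  proof -
    let ?E = "coset_core M (U \<inter> W)"
    have "topspace T - (carrier G - ?E) = ?E"
      using coset_core_subset[of M "U \<inter> W"] openin_subset_carrier[OF UW] topspace_eq by blast
    have rest: "W - ?E = W \<inter> \<Union>(rcosets M - {C \<in> rcosets M. C \<subseteq> U \<inter> W})"
    proof (intro equalityI subsetI)
      fix x assume x: "x \<in> W - ?E"
      then have "x \<in> \<Union>(rcosets M)"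
        using openin_subset_carrier[OF W(1)] rcosets_part_G[OF open_normalD(2)[OF M]] by blast
      then show "x \<in> W \<inter> \<Union>(rcosets M - {C \<in> rcosets M. C \<subseteq> U \<inter> W})"
        using x unfolding coset_core_def by blast
    next
      fix x assume x: "x \<in> W \<inter> \<Union>(rcosets M - {C \<in> rcosets M. C \<subseteq> U \<inter> W})"
      then obtain C where C: "C \<in> rcosets M" "\<not> C \<subseteq> U \<inter> W" "x \<in> C" by blast
      have "D = C" if "D \<in> rcosets M" "x \<in> D" for D using rcosets_eqI[OF M that(1) C(1) that(2) C(3)] .
      then show "x \<in> W - ?E" using x C unfolding coset_core_def by blast
    qed
    have op: "openin T (W - ?E)"
      unfolding rest by (intro openin_Int W(1) openin_Union_rcosets[OF M]) blast
    have "haar_outer (A - U) \<le> haar_content (W - ?E)"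
      using W(2) coset_core_subset[of M "U \<inter> W"] by (intro haar_outer_le[OF op]) blast
    then have "coset_ratio M (U \<inter> W) + haar_outer (A - U) \<le> coset_ratio M (U \<inter> W) + haar_content (W - ?E)"
      by (rule add_left_mono)
    also have "\<dots> \<le> haar_content W"
      by (rule haar_content_disjoint[OF M]) blast+
    finally show ?thesis .
  qed
  have "haar_outer (U \<inter> A) + haar_outer (A - U) \<le> haar_content (U \<inter> W) + haar_outer (A - U)"
    using W(2) by (intro add_right_mono haar_outer_le[OF UW]) blast
  also have "\<dots> = (SUP M\<in>open_normals. coset_ratio M (U \<inter> W) + haar_outer (A - U))"
    unfolding haar_content_def by (rule ennreal_SUP_add_left[OF open_normals_nonempty, symmetric])
  also have "\<dots> \<le> haar_content W" by (rule SUP_least) (rule step)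
  finally show "haar_outer (U \<inter> A) + haar_outer (A - U) \<le> haar_content W" .
qed

lemma open_in_lambda_system:
  assumes U: "openin T U"
  shows "U \<in> lambda_system (carrier G) (Pow (carrier G)) haar_outer"
  unfolding lambda_system_def
proof (intro CollectI conjI ballI)
  show "U \<in> Pow (carrier G)" using openin_subset_carrier[OF U] by simp
  fix A assume "A \<in> Pow (carrier G)"
  then have A: "(carrier G - U) \<inter> A = A - U" by blast
  have "haar_outer A \<le> haar_outer (U \<inter> A) + haar_outer (A - U)"
  proof -
    have "subadditive (Pow (carrier G)) haar_outer"
      using outer_measure_space_haar_outer unfolding outer_measure_space_def
      by (intro ring_of_sets.countably_subadditive_subadditive[of "carrier G"] ring_of_sets_Pow) blast+
    then have "haar_outer ((U \<inter> A) \<union> (A - U)) \<le> haar_outer (U \<inter> A) + haar_outer (A - U)"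
      using \<open>A \<in> Pow (carrier G)\<close> by (intro subadditiveD) auto
    moreover have "(U \<inter> A) \<union> (A - U) = A" by blast
    ultimately show ?thesis by simp
  qed
  then show "haar_outer (U \<inter> A) + haar_outer ((carrier G - U) \<inter> A) = haar_outer A"
    unfolding A using haar_outer_split_open[OF U] by (intro antisym)
qed

abbreviation borel_sets :: "'a set set" where
  "borel_sets \<equiv> sigma_sets (topspace T) {U. openin T U}"

lemma open_Pow: "{U. openin T U} \<subseteq> Pow (carrier G)"
  using openin_subset_carrier by blast

lemma borel_sets_subset: "A \<in> borel_sets \<Longrightarrow> A \<subseteq> carrier G"
  using sigma_sets_into_sp[of "{U. openin T U}" "carrier G" A] open_Pow topspace_eq by simp

lemma haar_measure_space: "measure_space (carrier G) borel_sets haar_outer"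
proof -
  have L: "measure_space (carrier G) (lambda_system (carrier G) (Pow (carrier G)) haar_outer) haar_outer"
    using sigma_algebra.caratheodory_lemma[OF sigma_algebra_Pow outer_measure_space_haar_outer] .
  then have "sigma_algebra (carrier G) (lambda_system (carrier G) (Pow (carrier G)) haar_outer)"
    by (simp add: measure_space_def)
  from sigma_algebra.sigma_sets_subset[OF this, of "{U. openin T U}"]
  have "borel_sets \<subseteq> lambda_system (carrier G) (Pow (carrier G)) haar_outer"
    using open_in_lambda_system by (auto simp: topspace_eq)
  moreover have "sigma_algebra (carrier G) borel_sets"
    using sigma_algebra_sigma_sets[OF open_Pow] by (simp add: topspace_eq)
  ultimately show ?thesis using measure_down[OF L] by blast
qed

definition haar :: "'a measure" where
  "haar = measure_of (carrier G) {U. openin T U} haar_outer"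

lemma space_haar: "space haar = carrier G"
  using open_Pow by (simp add: haar_def space_measure_of)

lemma sets_haar: "sets haar = borel_sets"
  using open_Pow by (simp add: haar_def sets_measure_of topspace_eq)

lemma emeasure_haar:
  assumes "A \<in> borel_sets"
  shows "emeasure haar A = haar_outer A"
  unfolding haar_def
proof (rule emeasure_measure_of[OF HOL.refl open_Pow])
  show "A \<in> sets (measure_of (carrier G) {U. openin T U} haar_outer)"
    using assms sets_haar by (simp add: haar_def)
  show "positive (sets (measure_of (carrier G) {U. openin T U} haar_outer)) haar_outer"
    "countably_additive (sets (measure_of (carrier G) {U. openin T U} haar_outer)) haar_outer"
    using haar_measure_space sets_haar by (simp_all add: measure_space_def haar_def)
qed

lemma haar_outer_translate:
  assumes x: "x \<in> carrier G" and A: "A \<subseteq> carrier G"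
  shows "haar_outer (x <# A) = haar_outer A"
proof -
  have le: "haar_outer (x <# A) \<le> haar_outer A" if x: "x \<in> carrier G" for x A
    unfolding haar_outer_def[of A]
  proof (rule INF_greatest)
    fix U assume "U \<in> {U. openin T U \<and> A \<subseteq> U}"
    then have U: "openin T U" "A \<subseteq> U" by simp_all
    have "haar_outer (x <# A) \<le> haar_content (x <# U)"
      using U(2) by (intro haar_outer_le openin_l_coset[OF U(1) x]) (auto simp: l_coset_def)
    also have "\<dots> = haar_content U" by (rule haar_content_translate[OF x openin_subset_carrier[OF U(1)]])
    finally show "haar_outer (x <# A) \<le> haar_content U" .
  qed
  show ?thesis
  proof (rule antisym[OF le[OF x]])
    show "haar_outer A \<le> haar_outer (x <# A)"
      using le[OF inv_closed[OF x], of "x <# A"] unfolding l_coset_inverse[OF x A] .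
  qed
qed

lemma l_coset_borel:
  assumes x: "x \<in> carrier G" and A: "A \<in> borel_sets"
  shows "x <# A \<in> borel_sets"
proof -
  have "(\<lambda>y. inv x \<otimes> y) \<in> measurable haar haar"
  proof (rule measurable_measure_of[where \<Omega> = "carrier G" and N = "{U. openin T U}" and \<mu> = haar_outer and M = haar, folded haar_def])
    show "(\<lambda>y. inv x \<otimes> y) -` U \<inter> space haar \<in> sets haar" if "U \<in> {U. openin T U}" for U
    proof -
      have U: "openin T U" using that by simp
      have "(\<lambda>y. inv x \<otimes> y) -` U \<inter> space haar = x <# U"
        unfolding l_coset_eq_preimage[OF x openin_subset_carrier[OF U]] space_haar by blast
      then show ?thesis using openin_l_coset[OF U x] unfolding sets_haar by simp
    qed
  qed (use open_Pow x space_haar in auto)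
  from measurable_sets[OF this, of A] have "(\<lambda>y. inv x \<otimes> y) -` A \<inter> carrier G \<in> borel_sets"
    using A by (simp add: sets_haar space_haar)
  moreover have "(\<lambda>y. inv x \<otimes> y) -` A \<inter> carrier G = x <# A"
    unfolding l_coset_eq_preimage[OF x borel_sets_subset[OF A]] by blast
  ultimately show ?thesis by simp
qed

lemma open_borel: "openin T U \<Longrightarrow> U \<in> borel_sets"
  by (simp add: sigma_sets.Basic)

lemma normalized_haar_measure_haar: "normalized_haar_measure G T haar"
  unfolding normalized_haar_measure_def
proof (intro conjI ballI allI impI)
  show "space haar = topspace T" by (simp add: space_haar topspace_eq)
  show "sets haar = borel_sets" by (rule sets_haar)
  show "emeasure haar (carrier G) = 1"
    using emeasure_haar[OF open_borel[OF openin_carrier]] haar_outer_open[OF openin_carrier] haar_content_carrier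
    by simp
  show "emeasure haar (x <# A) = emeasure haar A" if "x \<in> carrier G" "A \<in> sets haar" for x A
    using that emeasure_haar l_coset_borel haar_outer_translate borel_sets_subset by (simp add: sets_haar)
  show "emeasure haar A = (INF U\<in>{U. openin T U \<and> A \<subseteq> U}. emeasure haar U)" if "A \<in> sets haar" for A
  proof -
    have "emeasure haar A = haar_outer A" using that by (simp add: emeasure_haar sets_haar)
    also have "\<dots> = (INF U\<in>{U. openin T U \<and> A \<subseteq> U}. emeasure haar U)"
      unfolding haar_outer_def by (rule INF_cong) (simp_all add: emeasure_haar open_borel haar_outer_open)
    finally show ?thesis .
  qed
  show "emeasure haar U = (SUP C\<in>{C. compactin T C \<and> C \<subseteq> U}. emeasure haar C)" if U: "openin T U" for U
  proof (rule antisym)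
    have "emeasure haar U = haar_content U"
      using U by (simp add: emeasure_haar open_borel haar_outer_open)
    also have "\<dots> \<le> (SUP C\<in>{C. compactin T C \<and> C \<subseteq> U}. emeasure haar C)"
      unfolding haar_content_def
    proof (rule SUP_least)
      fix M assume M: "M \<in> open_normals"
      have sub: "{C \<in> rcosets M. C \<subseteq> U} \<subseteq> rcosets M" by blast
      have E: "openin T (coset_core M U)" "compactin T (coset_core M U)"
        unfolding coset_core_def by (rule openin_Union_rcosets[OF M sub], rule compactin_Union_rcosets[OF M sub])
      have "coset_ratio M U \<le> emeasure haar (coset_core M U)"
        using coset_ratio_le_content_core[OF M, of U] E(1) by (simp add: emeasure_haar open_borel haar_outer_open)
      also have "\<dots> \<le> (SUP C\<in>{C. compactin T C \<and> C \<subseteq> U}. emeasure haar C)"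
        using E(2) coset_core_subset by (intro SUP_upper) simp
      finally show "coset_ratio M U \<le> (SUP C\<in>{C. compactin T C \<and> C \<subseteq> U}. emeasure haar C)" .
    qed
    finally show "emeasure haar U \<le> (SUP C\<in>{C. compactin T C \<and> C \<subseteq> U}. emeasure haar C)" .
    show "(SUP C\<in>{C. compactin T C \<and> C \<subseteq> U}. emeasure haar C) \<le> emeasure haar U"
      using U by (intro SUP_least emeasure_mono) (simp_all add: sets_haar open_borel)
  qed
qed

text \<open>Invariance gives all cosets of \<open>M\<close> the same mass, which is then the inverse of the index.\<close>

lemma emeasure_coset_core:
  assumes sets: "sets \<nu> = borel_sets" and one: "emeasure \<nu> (carrier G) = 1"
    and inv: "\<And>x A. x \<in> carrier G \<Longrightarrow> openin T A \<Longrightarrow> emeasure \<nu> (x <# A) = emeasure \<nu> A"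
    and M: "M \<in> open_normals"
  shows "emeasure \<nu> (coset_core M U) = coset_ratio M U"
proof -
  have coset: "emeasure \<nu> C = emeasure \<nu> M" if C: "C \<in> rcosets M" for C
  proof -
    obtain x where x: "x \<in> carrier G" "C = M #> x" using C by (rule rcosetsE)
    then have "C = x <# M" using normal.coset_eq[OF open_normalD(1)[OF M]] by simp
    then show ?thesis using inv[OF x(1) open_normalD(3)[OF M]] by simp
  qed
  have union: "emeasure \<nu> (\<Union>\<C>) = of_nat (card \<C>) * emeasure \<nu> M" if C: "\<C> \<subseteq> rcosets M" for \<C>
  proof -
    have opn: "openin T C" if "C \<in> \<C>" for C using openin_rcosets[OF M] C that by blast
    have "(\<Sum>C\<in>\<C>. emeasure \<nu> (id C)) = emeasure \<nu> (\<Union>C\<in>\<C>. id C)"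
    proof (rule sum_emeasure)
      show "id ` \<C> \<subseteq> sets \<nu>" using opn open_borel unfolding sets by auto
      show "disjoint_family_on id \<C>"
        unfolding disjoint_family_on_def using rcosets_eqI[OF M] C by (auto simp: subset_iff)
      show "finite \<C>" using finite_subset[OF C finite_rcosets[OF M]] .
    qed
    moreover have "(\<Sum>C\<in>\<C>. emeasure \<nu> (id C)) = (\<Sum>C\<in>\<C>. emeasure \<nu> M)"
      using C by (intro sum.cong HOL.refl) (simp add: coset subset_iff)
    ultimately show ?thesis by simp
  qed
  have "\<Union>(rcosets M) = carrier G" using rcosets_part_G[OF open_normalD(2)[OF M]] .
  then have total: "of_nat (card (rcosets M)) * emeasure \<nu> M = 1"
    using union[OF subset_refl] one by simp
  then have "emeasure \<nu> M \<noteq> Orderings.top"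
    using card_rcosets_pos[OF M] by (auto simp: ennreal_mult_top)
  then obtain r where r: "emeasure \<nu> M = ennreal r" "0 \<le> r" by (cases "emeasure \<nu> M") auto
  have mult: "of_nat k * emeasure \<nu> M = ennreal (real k * r)" for k
    unfolding r(1) ennreal_of_nat_eq_real_of_nat using r(2) by (simp add: ennreal_mult)
  have "real (card (rcosets M)) * r = 1"
    using total unfolding mult using r(2) by (simp add: ennreal_eq_1)
  then have "r = 1 / real (card (rcosets M))" using card_rcosets_pos[OF M] by (simp add: field_simps)
  then have k: "real k * r = real k / real (card (rcosets M))" for k by simp
  have "emeasure \<nu> (coset_core M U) = of_nat (card {C \<in> rcosets M. C \<subseteq> U}) * emeasure \<nu> M"
    unfolding coset_core_def by (rule union) blast
  then show ?thesis unfolding coset_ratio_def mult k .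
qed

text \<open>A compact subset of an open set is contained in one of its coset cores, so inner regularity by compact
  sets amounts to exhaustion by coset cores.\<close>

lemma emeasure_open_eq_content:
  assumes "normalized_haar_measure G T \<nu>" and U: "openin T U"
  shows "emeasure \<nu> U = haar_content U"
proof (rule antisym)
  have sets: "sets \<nu> = borel_sets" and one: "emeasure \<nu> (carrier G) = 1"
    and inv: "\<And>x A. x \<in> carrier G \<Longrightarrow> A \<in> sets \<nu> \<Longrightarrow> emeasure \<nu> (x <# A) = emeasure \<nu> A"
    and inner: "emeasure \<nu> U = (SUP C\<in>{C. compactin T C \<and> C \<subseteq> U}. emeasure \<nu> C)"
    using assms unfolding normalized_haar_measure_def by blast+
  have core: "emeasure \<nu> (coset_core M U) = coset_ratio M U" if "M \<in> open_normals" for M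
    using that inv by (intro emeasure_coset_core[OF sets one]) (simp_all add: sets open_borel)
  have core_open: "coset_core M U \<in> sets \<nu>" if "M \<in> open_normals" for M
    unfolding sets coset_core_def using that by (intro open_borel openin_Union_rcosets) blast+
  have U_sets: "U \<in> sets \<nu>" unfolding sets using U by (rule open_borel)
  show "haar_content U \<le> emeasure \<nu> U"
    unfolding haar_content_def
  proof (rule SUP_least)
    fix M assume M: "M \<in> open_normals"
    show "coset_ratio M U \<le> emeasure \<nu> U"
      using emeasure_mono[OF coset_core_subset U_sets] core[OF M] by metis
  qed
  show "emeasure \<nu> U \<le> haar_content U"
    unfolding inner
  proof (rule SUP_least)
    fix C assume "C \<in> {C. compactin T C \<and> C \<subseteq> U}"
    then have C: "compactin T C" "C \<subseteq> U" by simp_all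
    have opn: "\<And>V. V \<in> {U} \<Longrightarrow> openin T V" and cover: "C \<subseteq> \<Union>{U}"
      using C(2) U by simp_all
    obtain M where M: "M \<in> open_normals" "M \<subseteq> carrier G" "\<And>x. x \<in> C \<Longrightarrow> \<exists>V\<in>{U}. M #> x \<subseteq> V"
    proof (rule uniform_refinement[OF C(1) carrier_open_normal opn cover])
    qed (assumption, rule that)
    have "C \<subseteq> coset_core M U"
    proof
      fix x assume x: "x \<in> C"
      then have xG: "x \<in> carrier G" using C(2) openin_subset_carrier[OF U] by blast
      have "M #> x \<subseteq> U" using M(3)[OF x] by simp
      then show "x \<in> coset_core M U"
        using rcosetsI[OF open_normalD(4)[OF M(1)] xG] rcos_self[OF xG open_normalD(2)[OF M(1)]]
        unfolding coset_core_def by blast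
    qed
    then have "emeasure \<nu> C \<le> emeasure \<nu> (coset_core M U)"
      by (rule emeasure_mono[OF _ core_open[OF M(1)]])
    also have "\<dots> \<le> haar_content U"
      unfolding core[OF M(1)] by (rule coset_ratio_le_content[OF M(1)])
    finally show "emeasure \<nu> C \<le> haar_content U" .
  qed
qed

text \<open>Open sets are closed under intersection and generate the Borel sets.\<close>

lemma measure_eq_if_eq_on_open:
  assumes "sets \<mu> = borel_sets" "sets \<nu> = borel_sets" "emeasure \<mu> (carrier G) \<noteq> \<infinity>"
    and "\<And>U. openin T U \<Longrightarrow> emeasure \<mu> U = emeasure \<nu> U"
  shows "\<mu> = \<nu>"
proof (rule measure_eqI_generator_eq[where E = "{U. openin T U}" and \<Omega> = "carrier G" and A = "\<lambda>_. carrier G"])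
  show "Int_stable {U. openin T U}" by (auto simp: Int_stable_def)
qed (use assms open_Pow openin_carrier in \<open>simp_all add: topspace_eq\<close>)

lemma haar_measure_eq: "haar_measure G T = haar"
  unfolding haar_measure_def
proof (rule the_equality[of "normalized_haar_measure G T"])
  show "normalized_haar_measure G T haar" by (rule normalized_haar_measure_haar)
  fix \<nu> assume \<nu>: "normalized_haar_measure G T \<nu>"
  then have "sets \<nu> = borel_sets" "emeasure \<nu> (carrier G) \<noteq> \<infinity>"
    unfolding normalized_haar_measure_def by (blast, simp)
  then show "\<nu> = haar"
    using emeasure_open_eq_content[OF \<nu>] emeasure_open_eq_content[OF normalized_haar_measure_haar]
    by (intro measure_eq_if_eq_on_open) (simp_all add: sets_haar)
qed

lemma prob_haar: "emeasure haar (carrier G) = 1"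
  using normalized_haar_measure_haar unfolding normalized_haar_measure_def by blast

end

section \<open>Pro-\<open>p\<close>-groups and their quotients\<close>

text \<open>The inverse limit is cut out of a compact product of finite discrete groups by closed conditions. A
  neighbourhood of \<open>\<one>\<close> involves finitely many coordinates and thus contains the intersection of the corresponding
  subgroups.\<close>

lemma pro_p_group_profinite:
  assumes "pro_p_group p G T"
  shows "profinite_group G T"
proof -
  have top: "topological_group G T"
    and hom: "homeomorphic_map T (quotient_limit_topology G (p_quotients p G T))
       (to_quotient_limit G (p_quotients p G T))"
    using assms unfolding pro_p_group_def by blast+
  have grp: "group G" and topspace: "topspace T = carrier G" using top unfolding topological_group_def by blast+
  interpret group G by fact
  let ?N = "p_quotients p G T"
  let ?X = "product_topology (\<lambda>N. discrete_topology (carrier (G Mod N))) ?N"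
  let ?L = "quotient_limit_topology G ?N" and ?i = "to_quotient_limit G ?N"
  have PD: "N \<lhd> G" "finite (carrier (G Mod N))" if "N \<in> ?N" for N
    using that unfolding p_quotients_def finite_p_group_def by blast+
  have topX: "topspace ?X = (\<Pi>\<^sub>E N\<in>?N. carrier (G Mod N))" by simp
  have "compact_space ?X"
    unfolding compact_space_product_topology using PD(2) by (simp add: compact_space_discrete_topology)
  moreover have "closedin ?X (carrier (quotient_limit G ?N))"
  proof -
    let ?C = "\<lambda>M N. {f \<in> topspace ?X. f N = N <#>\<^bsub>G\<^esub> f M}"
    let ?F = "insert (topspace ?X) {?C M N | M N. M \<in> ?N \<and> N \<in> ?N \<and> M \<subseteq> N}"
    have "closedin ?X (?C M N)" if MN: "M \<in> ?N" "N \<in> ?N" "M \<subseteq> N" for M N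
    proof -
      let ?D = "\<lambda>N. discrete_topology (carrier (G Mod N))"
      have H: "Hausdorff_space (?D N)" by (rule Hausdorff_space_discrete_topology)
      have f: "continuous_map ?X (?D N) (\<lambda>f. f N)" using continuous_map_product_projection[OF MN(2), of ?D] .
      have "N <#>\<^bsub>G\<^esub> C \<in> carrier (G Mod N)" if "C \<in> carrier (G Mod M)" for C
      proof -
        from that obtain x where x: "C = M #>\<^bsub>G\<^esub> x" "x \<in> carrier G"
          unfolding carrier_FactGroup by (rule imageE)
        show ?thesis
          unfolding x(1) set_mult_rcos_of_smaller[OF grp PD(1)[OF MN(1)] PD(1)[OF MN(2)] MN(3) x(2)] carrier_FactGroup
          using x(2) by (rule imageI)
      qed
      then have "continuous_map (?D M) (?D N) (\<lambda>C. N <#>\<^bsub>G\<^esub> C)" by simp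
      from continuous_map_compose[OF continuous_map_product_projection[OF MN(1), of ?D] this]
      have g: "continuous_map ?X (?D N) (\<lambda>f. N <#>\<^bsub>G\<^esub> f M)" by (simp add: comp_def)
      show ?thesis by (rule closedin_continuous_maps_eq[OF H f g])
    qed
    then have "closedin ?X C" if "C \<in> ?F" for C using that closedin_topspace by blast
    then have "closedin ?X (\<Inter>?F)" by (rule closedin_Inter[OF insert_not_empty])
    moreover have "\<Inter>?F = carrier (quotient_limit G ?N)"
    proof (rule Set.set_eqI)
      fix f
      have "f \<in> \<Inter>?F \<longleftrightarrow> f \<in> topspace ?X \<and> (\<forall>M\<in>?N. \<forall>N\<in>?N. M \<subseteq> N \<longrightarrow> f N = N <#>\<^bsub>G\<^esub> f M)" by blast
      then show "f \<in> \<Inter>?F \<longleftrightarrow> f \<in> carrier (quotient_limit G ?N)"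
        unfolding quotient_limit_mem topX .
    qed
    ultimately show ?thesis by (simp only:)
  qed
  ultimately have "compactin ?X (carrier (quotient_limit G ?N))" by (rule closedin_compact_space)
  then have "compact_space ?L" unfolding quotient_limit_topology_def by (rule compact_space_subtopology)
  then have compact: "compact_space T"
    using homeomorphic_compact_space[OF homeomorphic_map_imp_homeomorphic_space[OF hom]] by blast
  have ihom: "continuous_map T ?L ?i" "open_map T ?L ?i" "inj_on ?i (topspace T)"
    using hom homeomorphic_imp_continuous_map homeomorphic_imp_open_map homeomorphic_imp_injective_map by blast+
  have open_N: "openin T N" if N: "N \<in> ?N" for N
  proof -
    have sub: "subgroup N G" using PD(1)[OF N] normal_imp_subgroup by blast
    have "openin T {x \<in> topspace T. ?i x \<in> {f \<in> carrier (quotient_limit G ?N). f N \<in> {N}}}"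
      by (rule openin_continuous_map_preimage[OF ihom(1) openin_quotient_limit_coordinate[OF N]])
    also have "{x \<in> topspace T. ?i x \<in> {f \<in> carrier (quotient_limit G ?N). f N \<in> {N}}} = N"
    proof -
      have car: "?i x \<in> carrier (quotient_limit G ?N)" if "x \<in> carrier G" for x
        using hom_in_carrier[OF to_quotient_limit_hom[OF grp PD(1)] that] .
      have co: "?i x N = N #>\<^bsub>G\<^esub> x" for x using N by (simp add: to_quotient_limit_def)
      have "?i x \<in> {f \<in> carrier (quotient_limit G ?N). f N \<in> {N}} \<longleftrightarrow> x \<in> N" if "x \<in> carrier G" for x
        using car[OF that] co[of x] rcos_eq_self_iff[OF sub that] by (simp only: mem_Collect_eq singleton_iff simp_thms)
      then show ?thesis using subgroup.subset[OF sub] unfolding topspace by blast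
    qed
    finally show ?thesis .
  qed
  show ?thesis
  proof (unfold_locales)
    show "topological_group G T" by (rule top)
    show "compact_space T" by (rule compact)
    fix U assume U: "openin T U" "\<one>\<^bsub>G\<^esub> \<in> U"
    have iU: "openin ?L (?i ` U)" using ihom(2) U(1) unfolding open_map_def by blast
    have i1: "?i \<one>\<^bsub>G\<^esub> \<in> ?i ` U" using U(2) by blast
    obtain F where F: "finite F" "F \<subseteq> ?N"
      "\<forall>g\<in>carrier (quotient_limit G ?N). (\<forall>N\<in>F. g N = ?i \<one>\<^bsub>G\<^esub> N) \<longrightarrow> g \<in> ?i ` U"
      by (rule quotient_limit_neighbourhood[OF iU i1])
    let ?F = "{M. M \<lhd> G \<and> openin T M}"
    have car: "carrier G \<in> ?F"
      using openin_topspace[of T] subgroup_self unfolding topspace normal_inv_iff by simp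
    have FF: "F \<subseteq> ?F" using F(2) PD(1) open_N by blast
    have "carrier G \<inter> \<Inter>F \<in> ?F"
      by (rule finite_Inter_in_family[OF F(1) FF car]) (auto intro: normal_subgroup_intersect openin_Int)
    moreover have "carrier G \<inter> \<Inter>F \<subseteq> U"
    proof
      fix x assume x: "x \<in> carrier G \<inter> \<Inter>F"
      have "?i x \<in> ?i ` U"
      proof (rule F(3)[rule_format])
        show "?i x \<in> carrier (quotient_limit G ?N)"
          using x hom_in_carrier[OF to_quotient_limit_hom[OF grp PD(1)]] by blast
        fix N assume N: "N \<in> F"
        then have NN: "N \<in> ?N" and xN: "x \<in> N" using F(2) x by blast+
        have sub: "subgroup N G" using PD(1)[OF NN] normal_imp_subgroup by blast
        show "?i x N = ?i \<one>\<^bsub>G\<^esub> N"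
          using xN x rcos_eq_self_iff[OF sub, of x] rcos_eq_self_iff[OF sub one_closed] subgroup.one_closed[OF sub] NN
          by (simp add: to_quotient_limit_def)
      qed
      then obtain u where u: "u \<in> U" "?i x = ?i u" by blast
      then have "x = u" using inj_onD[OF ihom(3) u(2)] x openin_subset[OF U(1)] topspace by blast
      then show "x \<in> U" using u(1) by simp
    qed
    ultimately show "\<exists>M. M \<lhd> G \<and> openin T M \<and> M \<subseteq> U" by blast
  qed
qed

locale profinite_quotient = profinite_group +
  fixes N assumes N_normal: "N \<lhd> G"
begin

abbreviation "Q \<equiv> G Mod N"
abbreviation "TQ \<equiv> quotient_topology G T N"
abbreviation "\<pi> \<equiv> (\<lambda>x. N #> x)"

lemma Q_group: "group Q"
  using normal.factorgroup_is_group[OF N_normal] .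

lemma topspace_TQ: "topspace TQ = carrier Q"
proof
  show "topspace TQ \<subseteq> carrier Q"
    using openin_topspace[of TQ] unfolding openin_quotient_topology by blast
  have "{x \<in> topspace T. N #> x \<in> carrier Q} = topspace T"
    unfolding topspace_eq carrier_FactGroup by blast
  then have "openin TQ (carrier Q)" unfolding openin_quotient_topology by simp
  then show "carrier Q \<subseteq> topspace TQ" by (rule openin_subset)
qed

lemma \<pi>_hom: "\<pi> \<in> hom G Q"
  using normal.r_coset_hom_Mod[OF N_normal] .

lemma \<pi>_surj: "\<pi> ` carrier G = carrier Q"
  by (simp add: carrier_FactGroup)

lemma \<pi>_carrier: "x \<in> carrier G \<Longrightarrow> \<pi> x \<in> carrier Q"
  unfolding carrier_FactGroup by (rule imageI)

lemma \<pi>_eq_iff: "x \<in> carrier G \<Longrightarrow> y \<in> carrier G \<Longrightarrow> \<pi> x = \<pi> y \<longleftrightarrow> x \<otimes> inv y \<in> N"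
  using rcos_eq_iff[OF normal_imp_subgroup[OF N_normal]] .

lemma \<pi>_continuous: "continuous_map T TQ \<pi>"
  unfolding continuous_map_def
  by (auto simp: topspace_eq topspace_TQ \<pi>_carrier openin_quotient_topology)

text \<open>The saturation of \<open>U\<close> is a union of translates, so the projection is open.\<close>

lemma \<pi>_preimage_image:
  assumes U: "U \<subseteq> carrier G"
  shows "{x \<in> carrier G. \<pi> x \<in> \<pi> ` U} = (\<Union>n\<in>N. n <# U)"
proof -
  have NG: "N \<subseteq> carrier G" using normal_imp_subgroup[OF N_normal] subgroup.subset by blast
  show ?thesis
  proof (intro Set.set_eqI iffI)
    fix x assume "x \<in> {x \<in> carrier G. \<pi> x \<in> \<pi> ` U}"
    then obtain u where u: "x \<in> carrier G" "u \<in> U" "\<pi> x = \<pi> u" by blast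
    have uG: "u \<in> carrier G" using u(2) U by blast
    have "x \<otimes> inv u \<in> N" using u(3) \<pi>_eq_iff[OF u(1) uG] by simp
    moreover have "x = (x \<otimes> inv u) \<otimes> u" using u(1) uG by (simp add: m_assoc)
    ultimately show "x \<in> (\<Union>n\<in>N. n <# U)" using u(2) unfolding l_coset_def by blast
  next
    fix x assume "x \<in> (\<Union>n\<in>N. n <# U)"
    then obtain n u where nu: "n \<in> N" "u \<in> U" "x = n \<otimes> u" unfolding l_coset_def by blast
    have c: "n \<in> carrier G" "u \<in> carrier G" using nu NG U by blast+
    have "\<pi> x = \<pi> u" using \<pi>_eq_iff[of x u] nu c by (simp add: m_assoc)
    then show "x \<in> {x \<in> carrier G. \<pi> x \<in> \<pi> ` U}" using nu c by blast
  qed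
qed

lemma \<pi>_open: "open_map T TQ \<pi>"
  unfolding open_map_def
proof (intro allI impI)
  fix U assume U: "openin T U"
  have NG: "N \<subseteq> carrier G" using normal_imp_subgroup[OF N_normal] subgroup.subset by blast
  have UG: "U \<subseteq> carrier G" using openin_subset_carrier[OF U] .
  have "openin T (\<Union>n\<in>N. n <# U)" using openin_l_coset[OF U] NG by (intro openin_Union) blast
  then have "openin T {x \<in> topspace T. \<pi> x \<in> \<pi> ` U}"
    using \<pi>_preimage_image[OF UG] unfolding topspace_eq by simp
  moreover have "\<pi> ` U \<subseteq> carrier Q" using UG \<pi>_carrier by blast
  ultimately show "openin TQ (\<pi> ` U)" unfolding openin_quotient_topology by blast
qed

lemma \<pi>_image_normal:
  assumes "M \<lhd> G"
  shows "\<pi> ` M \<lhd> Q"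
  using normal.surj_hom_normal_subgroup[OF assms _ \<pi>_surj] \<pi>_hom Q_group
  by (simp add: group_hom_def group_hom_axioms_def is_group)

text \<open>Multiplication and inversion descend, since \<open>\<pi>\<close> and \<open>\<pi> \<times> \<pi>\<close> are open and therefore quotient maps.\<close>

lemma Q_profinite: "profinite_group Q TQ"
proof -
  interpret Q: group Q by (rule Q_group)
  interpret \<pi>: group_hom G Q \<pi> using \<pi>_hom by unfold_locales
  have surj: "\<pi> ` topspace T = topspace TQ" using \<pi>_surj unfolding topspace_eq topspace_TQ .
  have quot: "quotient_map (prod_topology T T) (prod_topology TQ TQ) (\<lambda>(x, y). (\<pi> x, \<pi> y))"
    by (rule quotient_map_prod_open[OF \<pi>_open \<pi>_continuous surj \<pi>_open \<pi>_continuous surj])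
  have quot1: "quotient_map T TQ \<pi>"
    by (rule continuous_open_imp_quotient_map[OF \<pi>_continuous \<pi>_open surj])
  have mult: "continuous_map (prod_topology T T) T (\<lambda>(x, y). x \<otimes> y)" and inv: "continuous_map T T (\<lambda>x. inv x)"
    using topological unfolding topological_group_def by blast+
  have "continuous_map (prod_topology T T) TQ ((\<lambda>(X, Y). X \<otimes>\<^bsub>Q\<^esub> Y) \<circ> (\<lambda>(x, y). (\<pi> x, \<pi> y)))"
  proof (rule continuous_map_eq[OF continuous_map_compose[OF mult \<pi>_continuous]])
    fix z assume "z \<in> topspace (prod_topology T T)"
    then obtain a b where z: "z = (a, b)" and ab: "a \<in> carrier G" "b \<in> carrier G"
      by (auto simp: topspace_eq)
    show "(\<pi> \<circ> (\<lambda>(x, y). x \<otimes> y)) z = ((\<lambda>(X, Y). X \<otimes>\<^bsub>Q\<^esub> Y) \<circ> (\<lambda>(x, y). (\<pi> x, \<pi> y))) z"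
      unfolding z comp_def prod.case using \<pi>.hom_mult[OF ab] .
  qed
  then have multQ: "continuous_map (prod_topology TQ TQ) TQ (\<lambda>(X, Y). X \<otimes>\<^bsub>Q\<^esub> Y)"
    by (rule continuous_compose_quotient_map[OF quot])
  have "continuous_map T TQ ((\<lambda>X. inv\<^bsub>Q\<^esub> X) \<circ> \<pi>)"
  proof (rule continuous_map_eq[OF continuous_map_compose[OF inv \<pi>_continuous]])
    fix x assume "x \<in> topspace T"
    then show "(\<pi> \<circ> (\<lambda>x. inv x)) x = ((\<lambda>X. inv\<^bsub>Q\<^esub> X) \<circ> \<pi>) x"
      unfolding comp_def topspace_eq by (rule \<pi>.hom_inv)
  qed
  then have invQ: "continuous_map TQ TQ (\<lambda>X. inv\<^bsub>Q\<^esub> X)"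
    by (rule continuous_compose_quotient_map[OF quot1])
  show ?thesis
  proof (unfold_locales)
    show "topological_group Q TQ"
      unfolding topological_group_def using Q_group topspace_TQ multQ invQ by blast
    show "compact_space TQ"
      using image_compactin[OF compact[unfolded compact_space_def] \<pi>_continuous] surj
      unfolding compact_space_def by simp
    fix U assume U: "openin TQ U" "\<one>\<^bsub>Q\<^esub> \<in> U"
    have "openin T {x \<in> topspace T. \<pi> x \<in> U}" using U(1) unfolding openin_quotient_topology by blast
    moreover have "\<one> \<in> {x \<in> topspace T. \<pi> x \<in> U}" using U(2) \<pi>.hom_one by (simp add: topspace_eq)
    ultimately obtain M where M: "M \<lhd> G" "openin T M" "M \<subseteq> {x \<in> topspace T. \<pi> x \<in> U}"
      using base by blast
    have "openin TQ (\<pi> ` M)" using \<pi>_open M(2) unfolding open_map_def by blast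
    then show "\<exists>M. M \<lhd> Q \<and> openin TQ M \<and> M \<subseteq> U" using \<pi>_image_normal[OF M(1)] M(3) by blast
  qed
qed

sublocale Q: profinite_group Q TQ
  by (rule Q_profinite)

end

section \<open>Regularity of the product measure\<close>

context profinite_group
begin

lemma sigma_finite_haar: "sigma_finite_measure haar"
proof -
  interpret finite_measure haar by (rule finite_measureI) (simp add: space_haar prob_haar)
  show ?thesis by (rule sigma_finite_measure_axioms)
qed

abbreviation haar2 :: "('a \<times> 'a) measure" where
  "haar2 \<equiv> haar \<Otimes>\<^sub>M haar"

lemma emeasure_haar2_Times:
  "A \<in> borel_sets \<Longrightarrow> B \<in> borel_sets \<Longrightarrow> emeasure haar2 (A \<times> B) = emeasure haar A * emeasure haar B"
  by (rule sigma_finite_measure.emeasure_pair_measure_Times[OF sigma_finite_haar]) (simp_all add: sets_haar)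

lemma space_haar2: "space haar2 = carrier G \<times> carrier G"
  by (simp add: space_pair_measure space_haar)

lemma emeasure_haar2_space: "emeasure haar2 (carrier G \<times> carrier G) = 1"
  using emeasure_haar2_Times[OF open_borel open_borel, OF openin_carrier openin_carrier] prob_haar by simp

lemma haar_le_1: "emeasure haar A \<le> 1"
  using emeasure_space[of haar A] by (simp add: space_haar prob_haar)

lemma haar2_le_1: "emeasure haar2 A \<le> 1"
  using emeasure_space[of haar2 A] by (simp add: space_haar2 emeasure_haar2_space)

lemma haar_outer_regular:
  assumes A: "A \<in> borel_sets" and e: "0 < (e::real)"
  obtains U where "openin T U" "A \<subseteq> U" "emeasure haar (U - A) < e"
proof -
  have fin: "emeasure haar A \<noteq> \<infinity>" using haar_le_1[of A] by (auto simp: top_unique)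
  have "emeasure haar A = (INF U\<in>{U. openin T U \<and> A \<subseteq> U}. emeasure haar U)"
    using normalized_haar_measure_haar A unfolding normalized_haar_measure_def sets_haar by blast
  moreover have "emeasure haar A < emeasure haar A + e" using fin e by (simp add: less_top)
  ultimately have "(INF U\<in>{U. openin T U \<and> A \<subseteq> U}. emeasure haar U) < emeasure haar A + e" by simp
  then obtain U where U: "openin T U" "A \<subseteq> U" "emeasure haar U < emeasure haar A + e"
    unfolding INF_less_iff by blast
  have "emeasure haar (U - A) = emeasure haar U - emeasure haar A"
    using A U by (intro emeasure_Diff fin) (simp_all add: sets_haar open_borel)
  also have "\<dots> < e"
    using U(3) fin e emeasure_mono[OF U(2), of haar] open_borel[OF U(1)]
    by (simp add: minus_less_iff_ennreal sets_haar add.commute less_top)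
  finally show thesis using that U(1,2) by blast
qed

text \<open>Measurability of the approximating sets has to be demanded: an open subset of the square need not belong to
  the product \<open>\<sigma>\<close>-algebra.\<close>

definition enclosed :: "('a \<times> 'a) set \<Rightarrow> ('a \<times> 'a) set \<Rightarrow> ('a \<times> 'a) set \<Rightarrow> bool" where
  "enclosed F A U \<longleftrightarrow> openin (prod_topology T T) U \<and> U \<in> sets haar2 \<and>
     closedin (prod_topology T T) F \<and> F \<in> sets haar2 \<and> F \<subseteq> A \<and> A \<subseteq> U"

definition haar2_regular :: "('a \<times> 'a) set \<Rightarrow> bool" where
  "haar2_regular A \<longleftrightarrow> (\<forall>e>0::real. \<exists>U F. enclosed F A U \<and> emeasure haar2 (U - F) < e)"

text \<open>The difference of two products is covered by two strips, one for the error in each factor.\<close>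

lemma haar2_regular_Times:
  assumes A: "A \<in> borel_sets" and B: "B \<in> borel_sets"
  shows "haar2_regular (A \<times> B)"
  unfolding haar2_regular_def
proof (intro allI impI)
  have one: "\<exists>U F. openin T U \<and> closedin T F \<and> F \<in> borel_sets \<and> F \<subseteq> A \<and> A \<subseteq> U \<and> emeasure haar (U - F) < ennreal (2 * e)"
    if A: "A \<in> borel_sets" and e: "0 < e" for A and e :: real
  proof -
    have sub: "A \<subseteq> carrier G" using borel_sets_subset[OF A] .
    have Ac: "carrier G - A \<in> borel_sets" using sigma_sets.Compl[OF A] unfolding topspace_eq .
    obtain U where U: "openin T U" "A \<subseteq> U" "emeasure haar (U - A) < e" using haar_outer_regular[OF A e] .
    obtain V where V: "openin T V" "carrier G - A \<subseteq> V" "emeasure haar (V - (carrier G - A)) < e"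
      using haar_outer_regular[OF Ac e] .
    let ?F = "carrier G - V"
    have F: "closedin T ?F" "?F \<in> borel_sets"
      using closedin_diff[OF closedin_topspace V(1)] sigma_sets.Compl[OF open_borel[OF V(1)]] unfolding topspace_eq .
    have "U - ?F \<subseteq> (U - A) \<union> (V - (carrier G - A))" using openin_subset_carrier[OF U(1)] by blast
    then have "emeasure haar (U - ?F) \<le> emeasure haar ((U - A) \<union> (V - (carrier G - A)))"
      using U(1) V(1) A Ac open_borel openin_carrier by (intro emeasure_mono sets.Un sets.Diff) (simp_all add: sets_haar)
    also have "\<dots> \<le> emeasure haar (U - A) + emeasure haar (V - (carrier G - A))"
      using U(1) V(1) A Ac open_borel openin_carrier by (intro emeasure_subadditive sets.Diff) (simp_all add: sets_haar)
    also have "\<dots> < ennreal e + ennreal e" using U(3) V(3) by (rule add_strict_mono)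
    also have "\<dots> = ennreal (2 * e)" using e by (simp add: ennreal_plus[symmetric] del: ennreal_plus)
    finally have "emeasure haar (U - ?F) < ennreal (2 * e)" .
    moreover have "?F \<subseteq> A" using V(2) by blast
    ultimately show ?thesis using U(1,2) F by blast
  qed
  fix e :: real assume e: "0 < e"
  \<comment> \<open>two approximation errors, an outer and an inner one, in each of the two factors\<close>
  then have e4: "0 < e / 4" by simp
  obtain U1 F1 where 1: "openin T U1" "closedin T F1" "F1 \<in> borel_sets" "F1 \<subseteq> A" "A \<subseteq> U1"
    "emeasure haar (U1 - F1) < ennreal (2 * (e / 4))" using one[OF A e4] by blast
  obtain U2 F2 where 2: "openin T U2" "closedin T F2" "F2 \<in> borel_sets" "F2 \<subseteq> B" "B \<subseteq> U2"
    "emeasure haar (U2 - F2) < ennreal (2 * (e / 4))" using one[OF B e4] by blast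
  have D: "U1 - F1 \<in> borel_sets" "U2 - F2 \<in> borel_sets" "carrier G \<in> borel_sets"
    using sets.Diff[of U1 haar F1] sets.Diff[of U2 haar F2] 1 2 open_borel openin_carrier
    by (simp_all add: sets_haar)
  have tm: "X \<times> Y \<in> sets haar2" if "X \<in> borel_sets" "Y \<in> borel_sets" for X Y
    using that by (intro pair_measureI) (simp_all add: sets_haar)
  have "emeasure haar2 (U1 \<times> U2 - F1 \<times> F2) \<le>
      emeasure haar2 ((U1 - F1) \<times> carrier G \<union> carrier G \<times> (U2 - F2))"
    using openin_subset_carrier[OF 1(1)] openin_subset_carrier[OF 2(1)]
    by (intro emeasure_mono sets.Un tm D) blast
  also have "\<dots> \<le> emeasure haar2 ((U1 - F1) \<times> carrier G) + emeasure haar2 (carrier G \<times> (U2 - F2))"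
    by (intro emeasure_subadditive tm D)
  also have "\<dots> = emeasure haar (U1 - F1) + emeasure haar (U2 - F2)"
    using D by (simp add: emeasure_haar2_Times prob_haar)
  also have "\<dots> < ennreal (2 * (e / 4)) + ennreal (2 * (e / 4))" using 1(6) 2(6) by (rule add_strict_mono)
  also have "\<dots> = ennreal e" using e by (simp add: ennreal_plus[symmetric] del: ennreal_plus)
  finally have lt: "emeasure haar2 (U1 \<times> U2 - F1 \<times> F2) < ennreal e" .
  have "openin (prod_topology T T) (U1 \<times> U2)" using 1(1) 2(1) by (simp add: openin_prod_Times_iff)
  moreover have "closedin (prod_topology T T) (F1 \<times> F2)" using 1(2) 2(2) by (simp add: closedin_prod_Times_iff)
  moreover have "U1 \<times> U2 \<in> sets haar2" "F1 \<times> F2 \<in> sets haar2"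
    by (intro tm open_borel 1(1) 2(1) 1(3) 2(3))+
  moreover have "F1 \<times> F2 \<subseteq> A \<times> B" "A \<times> B \<subseteq> U1 \<times> U2" using 1(4,5) 2(4,5) by blast+
  ultimately show "\<exists>U F. enclosed F (A \<times> B) U \<and> emeasure haar2 (U - F) < e"
    unfolding enclosed_def using lt by blast
qed

lemma haar2_regular_Compl:
  assumes "haar2_regular A" and A: "A \<subseteq> carrier G \<times> carrier G"
  shows "haar2_regular (carrier G \<times> carrier G - A)"
  unfolding haar2_regular_def
proof (intro allI impI)
  fix e :: real assume "0 < e"
  then obtain U F where UF: "openin (prod_topology T T) U" "U \<in> sets haar2"
     "closedin (prod_topology T T) F" "F \<in> sets haar2" "F \<subseteq> A" "A \<subseteq> U" "emeasure haar2 (U - F) < e"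
    using assms(1) unfolding haar2_regular_def enclosed_def by blast
  let ?X = "carrier G \<times> carrier G"
  have X: "topspace (prod_topology T T) = ?X" by (simp add: topspace_eq)
  have "openin (prod_topology T T) (?X - F)" using openin_diff[OF openin_topspace UF(3)] unfolding X .
  moreover have "closedin (prod_topology T T) (?X - U)" using closedin_diff[OF closedin_topspace UF(1)] unfolding X .
  moreover have "?X - F \<in> sets haar2" "?X - U \<in> sets haar2"
    using sets.compl_sets[OF UF(4)] sets.compl_sets[OF UF(2)] unfolding space_haar2 .
  moreover have "(?X - F) - (?X - U) = U - F" using openin_subset[OF UF(1)] unfolding X by blast
  moreover have "?X - U \<subseteq> ?X - A" "?X - A \<subseteq> ?X - F" using UF(5,6) by blast+
  ultimately show "\<exists>U F. enclosed F (?X - A) U \<and> emeasure haar2 (U - F) < e"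
    unfolding enclosed_def using UF(7) by (intro exI[of _ "?X - F"] exI[of _ "?X - U"]) simp
qed

text \<open>The union of the inner approximations need not be closed, but by continuity from above finitely many of
  them suffice.\<close>

lemma haar2_regular_UN:
  fixes A :: "nat \<Rightarrow> ('a \<times> 'a) set"
  assumes "\<And>n. haar2_regular (A n)"
  shows "haar2_regular (\<Union>n. A n)"
  unfolding haar2_regular_def
proof (intro allI impI)
  fix e :: real assume e: "0 < e"
  have "\<exists>U F. enclosed F (A n) U \<and> emeasure haar2 (U - F) < (e / 2) * (1/2) ^ Suc n" for n
  proof -
    \<comment> \<open>the factor \<open>e / 2\<close> leaves room for truncating the union of closed sets\<close>
    have "0 < (e / 2) * (1/2) ^ Suc n" using e by simp
    then show ?thesis using assms[of n] unfolding haar2_regular_def by blast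
  qed
  then obtain U F where UF: "\<And>n. enclosed (F n) (A n) (U n) \<and> emeasure haar2 (U n - F n) < (e / 2) * (1/2) ^ Suc n"
    by metis
  have U: "openin (prod_topology T T) (U n)" "U n \<in> sets haar2" "A n \<subseteq> U n"
    and F: "closedin (prod_topology T T) (F n)" "F n \<in> sets haar2" "F n \<subseteq> A n"
    and lt: "emeasure haar2 (U n - F n) < (e / 2) * (1/2) ^ Suc n" for n
    using UF[of n] unfolding enclosed_def by blast+
  let ?U = "\<Union>n. U n" and ?F = "\<lambda>n. \<Union>i<n. F i"
  have Um: "?U \<in> sets haar2" using U(2) by blast
  have Fm: "?F n \<in> sets haar2" for n using F(2) by blast
  have "?U - (\<Union>n. F n) \<subseteq> (\<Union>n. U n - F n)" by blast
  then have "emeasure haar2 (?U - (\<Union>n. F n)) \<le> emeasure haar2 (\<Union>n. U n - F n)"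
    using U(2) F(2) by (intro emeasure_mono) auto
  also have "\<dots> \<le> (\<Sum>n. emeasure haar2 (U n - F n))"
    using U(2) F(2) by (intro emeasure_subadditive_countably) auto
  also have "\<dots> \<le> (\<Sum>n. ennreal (e / 2) * ennreal ((1/2) ^ Suc n))"
  proof (intro suminf_le allI)
    show "emeasure haar2 (U n - F n) \<le> ennreal (e / 2) * ennreal ((1/2) ^ Suc n)" for n
    proof -
      have "ennreal ((e / 2) * (1/2) ^ Suc n) = ennreal (e / 2) * ennreal ((1/2) ^ Suc n)"
        using e by (intro ennreal_mult) simp_all
      then show ?thesis using less_imp_le[OF lt[of n]] by (simp only:)
    qed
  qed auto
  also have "\<dots> = ennreal (e / 2)"
    unfolding ennreal_suminf_cmult
    by (subst suminf_ennreal_eq[OF zero_le_power power_half_series]) auto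
  also have "\<dots> < ennreal e" using e by (simp add: ennreal_less_iff)
  finally have small: "emeasure haar2 (?U - (\<Union>n. F n)) < ennreal e" .
  have "(\<lambda>n. emeasure haar2 (?U - ?F n)) \<longlonglongrightarrow> emeasure haar2 (\<Inter>n. ?U - ?F n)"
  proof (rule Lim_emeasure_decseq)
    show "range (\<lambda>n. ?U - ?F n) \<subseteq> sets haar2" using Um Fm by blast
    show "decseq (\<lambda>n. ?U - ?F n)"
      unfolding decseq_def using order_less_le_trans by blast
    show "emeasure haar2 (?U - ?F n) \<noteq> \<infinity>" for n
      using haar2_le_1[of "?U - ?F n"] by (auto simp: top_unique)
  qed
  moreover have "(\<Inter>n. ?U - ?F n) = ?U - (\<Union>n. F n)" by blast
  ultimately have "(\<lambda>n. emeasure haar2 (?U - ?F n)) \<longlonglongrightarrow> emeasure haar2 (?U - (\<Union>n. F n))" by simp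
  from order_tendstoD(2)[OF this small] obtain n where n: "emeasure haar2 (?U - ?F n) < e"
    by (auto simp: eventually_sequentially)
  have "openin (prod_topology T T) ?U" using U(1) by blast
  moreover have "closedin (prod_topology T T) (?F n)" using F(1) by (intro closedin_Union) auto
  moreover have "?F n \<subseteq> (\<Union>n. A n)" "(\<Union>n. A n) \<subseteq> ?U" using F(3) U(3) by blast+
  ultimately show "\<exists>U F. enclosed F (\<Union>n. A n) U \<and> emeasure haar2 (U - F) < e"
    unfolding enclosed_def using Um Fm n by (intro exI[of _ ?U] exI[of _ "?F n"]) simp
qed

text \<open>The regular sets form a \<open>\<sigma>\<close>-algebra that contains the measurable rectangles.\<close>

lemma sets_haar2_regular:
  assumes "A \<in> sets haar2"
  shows "haar2_regular A"
proof -
  have "A \<in> sigma_sets (carrier G \<times> carrier G) {a \<times> b | a b. a \<in> sets haar \<and> b \<in> sets haar}"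
    using assms unfolding sets_pair_measure space_haar .
  then show ?thesis
  proof (induct rule: sigma_sets.induct)
    case (Basic A)
    then show ?case using haar2_regular_Times unfolding sets_haar by blast
  next
    case Empty
    have "{} \<in> borel_sets" by (rule sigma_sets.Empty)
    from haar2_regular_Times[OF this this] show ?case by simp
  next
    case (Compl A)
    have "A \<subseteq> carrier G \<times> carrier G"
      using sigma_sets_into_sp[OF _ Compl(1)] sets.sets_into_space[of _ haar] unfolding space_haar by blast
    then show ?case using haar2_regular_Compl[OF Compl(2)] by blast
  next
    case (Union A)
    then show ?case using haar2_regular_UN by blast
  qed
qed

lemma haar2_outer_regular:
  assumes A: "A \<in> sets haar2" and e: "0 < (e::real)"
  obtains U where "openin (prod_topology T T) U" "U \<in> sets haar2" "A \<subseteq> U" "emeasure haar2 U \<le> emeasure haar2 A + e"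
proof -
  obtain U F where UF: "openin (prod_topology T T) U" "U \<in> sets haar2" "F \<in> sets haar2" "F \<subseteq> A" "A \<subseteq> U"
    "emeasure haar2 (U - F) < e"
    using sets_haar2_regular[OF A] e unfolding haar2_regular_def enclosed_def by blast
  have "emeasure haar2 U \<le> emeasure haar2 (A \<union> (U - F))"
    using UF(4) A UF(2,3) by (intro emeasure_mono) auto
  also have "\<dots> \<le> emeasure haar2 A + emeasure haar2 (U - F)"
    using A UF(2,3) by (intro emeasure_subadditive) auto
  also have "\<dots> \<le> emeasure haar2 A + e" using UF(6) by (intro add_left_mono less_imp_le)
  finally show thesis using that UF(1,2,5) by blast
qed

end

section \<open>Haar measure and outer measure under quotients\<close>

context profinite_quotient
begin

lemma preimage_l_coset:
  assumes x: "x \<in> carrier G" and A: "A \<subseteq> carrier Q"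
  shows "{y \<in> carrier G. \<pi> y \<in> \<pi> x <#\<^bsub>Q\<^esub> A} = x <# {y \<in> carrier G. \<pi> y \<in> A}"
proof -
  interpret \<pi>: group_hom G Q \<pi> using \<pi>_hom by unfold_locales
  have "\<pi> y \<in> \<pi> x <#\<^bsub>Q\<^esub> A \<longleftrightarrow> \<pi> (inv x \<otimes> y) \<in> A" if y: "y \<in> carrier G" for y
    using Q.l_coset_eq_preimage[OF \<pi>_carrier[OF x] A] \<pi>_carrier[OF y] \<pi>.hom_mult[OF inv_closed[OF x] y]
      \<pi>.hom_inv[OF x] by simp
  moreover have "x <# {y \<in> carrier G. \<pi> y \<in> A} = {y \<in> carrier G. inv x \<otimes> y \<in> {y \<in> carrier G. \<pi> y \<in> A}}"
    by (rule l_coset_eq_preimage[OF x]) blast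
  ultimately show ?thesis using x by blast
qed

lemma \<pi>_image_open_normal: "M \<in> open_normals \<Longrightarrow> \<pi> ` M \<in> Q.open_normals"
  using \<pi>_image_normal \<pi>_open unfolding open_normals_def Q.open_normals_def open_map_def by blast

lemma \<pi>_image_r_coset:
  assumes "M \<subseteq> carrier G" "x \<in> carrier G"
  shows "\<pi> ` (M #> x) = \<pi> ` M #>\<^bsub>Q\<^esub> \<pi> x"
proof -
  have "\<pi> (m \<otimes> x) = \<pi> m \<otimes>\<^bsub>Q\<^esub> \<pi> x" if "m \<in> M" for m
    using hom_mult[OF \<pi>_hom] assms that by blast
  then show ?thesis unfolding r_coset_def by auto
qed

lemma openin_preimage: "openin TQ U \<Longrightarrow> openin T {x \<in> carrier G. \<pi> x \<in> U}"
  unfolding openin_quotient_topology topspace_eq by blast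

lemma \<pi>_measurable: "\<pi> \<in> measurable haar Q.haar"
proof (rule measurable_measure_of[where \<Omega> = "carrier Q" and N = "{U. openin TQ U}" and \<mu> = Q.haar_outer and M = haar, folded Q.haar_def])
  show "\<pi> -` U \<inter> space haar \<in> sets haar" if "U \<in> {U. openin TQ U}" for U
  proof -
    have "\<pi> -` U \<inter> space haar = {x \<in> carrier G. \<pi> x \<in> U}" unfolding space_haar by blast
    then show ?thesis using openin_preimage[of U] that open_borel unfolding sets_haar by simp
  qed
  show "\<pi> \<in> space haar \<rightarrow> carrier Q" using \<pi>_carrier unfolding space_haar by blast
qed (rule Q.open_Pow)

lemma emeasure_distr_haar:
  assumes "A \<in> Q.borel_sets"
  shows "emeasure (distr haar Q.haar \<pi>) A = emeasure haar {x \<in> carrier G. \<pi> x \<in> A}"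
proof -
  have "\<pi> -` A \<inter> space haar = {x \<in> carrier G. \<pi> x \<in> A}" unfolding space_haar by blast
  then show ?thesis using emeasure_distr[OF \<pi>_measurable, of A] assms unfolding Q.sets_haar by simp
qed

text \<open>The image measure is invariant, so it agrees with Haar measure on unions of cosets. For an open set \<open>U\<close>,
  the coset core of its preimage with respect to \<open>M\<close> lies over the coset core of \<open>U\<close> with respect to the image of \<open>M\<close>, so
  exhausting the preimage exhausts \<open>U\<close>.\<close>

lemma distr_haar: "distr haar Q.haar \<pi> = Q.haar"
proof -
  let ?\<nu> = "distr haar Q.haar \<pi>"
  have sets: "sets ?\<nu> = Q.borel_sets" by (simp add: Q.sets_haar)
  have "{x \<in> carrier G. \<pi> x \<in> carrier Q} = carrier G" using \<pi>_carrier by blast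
  then have one: "emeasure ?\<nu> (carrier Q) = 1"
    using emeasure_distr_haar[OF Q.open_borel[OF Q.openin_carrier]] prob_haar by simp
  have inv: "emeasure ?\<nu> (X <#\<^bsub>Q\<^esub> A) = emeasure ?\<nu> A" if X: "X \<in> carrier Q" and A: "openin TQ A" for X A
  proof -
    obtain x where x: "x \<in> carrier G" "X = \<pi> x" using X unfolding carrier_FactGroup by blast
    have AQ: "A \<subseteq> carrier Q" using Q.openin_subset_carrier[OF A] .
    have op: "openin T {y \<in> carrier G. \<pi> y \<in> A}" using openin_preimage[OF A] .
    have "emeasure ?\<nu> (X <#\<^bsub>Q\<^esub> A) = emeasure haar (x <# {y \<in> carrier G. \<pi> y \<in> A})"
      using emeasure_distr_haar[OF Q.open_borel[OF Q.openin_l_coset[OF A X]]]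
      unfolding x(2) preimage_l_coset[OF x(1) AQ] .
    also have "\<dots> = emeasure haar {y \<in> carrier G. \<pi> y \<in> A}"
      using normalized_haar_measure_haar x(1) open_borel[OF op] unfolding normalized_haar_measure_def sets_haar
      by blast
    also have "\<dots> = emeasure ?\<nu> A" using emeasure_distr_haar[OF Q.open_borel[OF A]] by simp
    finally show ?thesis .
  qed
  have core: "emeasure ?\<nu> (Q.coset_core M U) = Q.coset_ratio M U" if "M \<in> Q.open_normals" for M U
    by (rule Q.emeasure_coset_core[OF sets one _ that]) (rule inv)
  have core_open: "openin TQ (Q.coset_core M U)" if "M \<in> Q.open_normals" for M U
    unfolding Q.coset_core_def using that by (rule Q.openin_Union_rcosets) blast
  have "emeasure ?\<nu> U = emeasure Q.haar U" if U: "openin TQ U" for U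
  proof -
    let ?V = "{x \<in> carrier G. \<pi> x \<in> U}"
    have V: "openin T ?V" by (rule openin_preimage[OF U])
    have \<nu>V: "emeasure ?\<nu> U = emeasure haar ?V" using emeasure_distr_haar[OF Q.open_borel[OF U]] .
    have "emeasure ?\<nu> U = Q.haar_content U"
    proof (rule antisym)
      have "haar_content ?V \<le> Q.haar_content U"
        unfolding haar_content_def
      proof (rule SUP_least)
        fix M assume M: "M \<in> open_normals"
        let ?M = "\<pi> ` M"
        have MQ: "?M \<in> Q.open_normals" by (rule \<pi>_image_open_normal[OF M])
        have sub: "coset_core M ?V \<subseteq> {x \<in> carrier G. \<pi> x \<in> Q.coset_core ?M U}"
        proof
          fix x assume "x \<in> coset_core M ?V"
          then obtain C where C: "C \<in> rcosets M" "C \<subseteq> ?V" "x \<in> C" unfolding coset_core_def by blast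
          have xG: "x \<in> carrier G" using C(2,3) by blast
          have "C = M #> x" by (rule rcos_of_elem[OF M C(1,3)])
          then have "?M #>\<^bsub>Q\<^esub> \<pi> x = \<pi> ` C"
            using \<pi>_image_r_coset[OF open_normalD(4)[OF M] xG] by (simp only:)
          moreover have "\<pi> ` C \<subseteq> U" using C(2) by (intro image_subsetI) blast
          ultimately have "?M #>\<^bsub>Q\<^esub> \<pi> x \<subseteq> U" by (simp only:)
          moreover have "?M #>\<^bsub>Q\<^esub> \<pi> x \<in> rcosets\<^bsub>Q\<^esub> ?M"
            by (rule Q.rcosetsI[OF Q.open_normalD(4)[OF MQ] \<pi>_carrier[OF xG]])
          moreover have "\<pi> x \<in> ?M #>\<^bsub>Q\<^esub> \<pi> x"
            by (rule Q.rcos_self[OF \<pi>_carrier[OF xG] Q.open_normalD(2)[OF MQ]])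
          ultimately have "\<pi> x \<in> Q.coset_core ?M U" unfolding Q.coset_core_def by blast
          then show "x \<in> {x \<in> carrier G. \<pi> x \<in> Q.coset_core ?M U}" using xG by simp
        qed
        have "coset_ratio M ?V \<le> haar_content (coset_core M ?V)"
          by (rule coset_ratio_le_content_core[OF M])
        also have "\<dots> \<le> haar_content {x \<in> carrier G. \<pi> x \<in> Q.coset_core ?M U}"
          by (rule haar_content_mono[OF sub])
        also have "\<dots> = emeasure ?\<nu> (Q.coset_core ?M U)"
          using emeasure_distr_haar[OF Q.open_borel[OF core_open[OF MQ]]]
            emeasure_open_eq_content[OF normalized_haar_measure_haar openin_preimage[OF core_open[OF MQ]]]
          by simp
        also have "\<dots> = Q.coset_ratio ?M U" by (rule core[OF MQ])
        also have "\<dots> \<le> Q.haar_content U" by (rule Q.coset_ratio_le_content[OF MQ])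
        finally show "coset_ratio M ?V \<le> Q.haar_content U" .
      qed
      then show "emeasure ?\<nu> U \<le> Q.haar_content U"
        unfolding \<nu>V using emeasure_open_eq_content[OF normalized_haar_measure_haar V] by simp
      show "Q.haar_content U \<le> emeasure ?\<nu> U"
        unfolding Q.haar_content_def
      proof (rule SUP_least)
        fix M assume M: "M \<in> Q.open_normals"
        have "emeasure ?\<nu> (Q.coset_core M U) \<le> emeasure ?\<nu> U"
          by (rule emeasure_mono[OF Q.coset_core_subset]) (unfold sets, rule Q.open_borel[OF U])
        then show "Q.coset_ratio M U \<le> emeasure ?\<nu> U" unfolding core[OF M] .
      qed
    qed
    also have "\<dots> = emeasure Q.haar U"
      using Q.emeasure_open_eq_content[OF Q.normalized_haar_measure_haar U] by simp
    finally show ?thesis .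
  qed
  then show ?thesis
    using sets Q.sets_haar one by (intro Q.measure_eq_if_eq_on_open) simp_all
qed

abbreviation "\<pi>2 \<equiv> (\<lambda>(x, y). (\<pi> x, \<pi> y))"

lemma distr_haar2: "distr haar2 Q.haar2 \<pi>2 = Q.haar2"
  using pair_measure_distr[OF \<pi>_measurable \<pi>_measurable] Q.sigma_finite_haar unfolding distr_haar by simp

lemma \<pi>2_measurable: "\<pi>2 \<in> measurable haar2 Q.haar2"
  using \<pi>_measurable by measurable

lemma emeasure_haar2_preimage:
  assumes "A \<in> sets Q.haar2"
  shows "emeasure Q.haar2 A = emeasure haar2 (\<pi>2 -` A \<inter> space haar2)"
    and "\<pi>2 -` A \<inter> space haar2 \<in> sets haar2"
  using emeasure_distr[OF \<pi>2_measurable assms] measurable_sets[OF \<pi>2_measurable assms]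
  unfolding distr_haar2 by simp_all

lemma outer_measure_preimage_le:
  assumes S: "\<And>x y. (x, y) \<in> S \<Longrightarrow> x \<in> carrier G \<and> y \<in> carrier G \<and> (\<pi> x, \<pi> y) \<in> S'"
  shows "outer_measure_of haar2 S \<le> outer_measure_of Q.haar2 S'"
  unfolding outer_measure_of_def[of Q.haar2]
proof (rule INF_greatest)
  fix A assume "A \<in> {A \<in> sets Q.haar2. S' \<subseteq> A}"
  then have A: "A \<in> sets Q.haar2" "S' \<subseteq> A" by simp_all
  have "S \<subseteq> \<pi>2 -` A \<inter> space haar2"
  proof (rule subrelI)
    fix x y assume xy: "(x, y) \<in> S"
    have "(\<pi> x, \<pi> y) \<in> A" by (rule subsetD[OF A(2)]) (use S[OF xy] in blast)
    then show "(x, y) \<in> \<pi>2 -` A \<inter> space haar2" using S[OF xy] by (simp add: space_haar2)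
  qed
  then show "outer_measure_of haar2 S \<le> emeasure Q.haar2 A"
    unfolding emeasure_haar2_preimage(1)[OF A(1)] outer_measure_of_def
    using emeasure_haar2_preimage(2)[OF A(1)] by (intro INF_lower) simp
qed

text \<open>A measurable cover of \<open>S\<close> is enlarged to an open set at cost \<open>e\<close> and then shrunk to the union of the rectangles
  \<open>Mx \<times> My\<close> over \<open>S\<close>. As \<open>S\<close> contains the preimage of \<open>S'\<close>, these rectangles contain the preimage of a union of coset rectangles
  that covers \<open>S'\<close>.\<close>

lemma outer_measure_preimage_ge:
  assumes S': "S' \<subseteq> carrier Q \<times> carrier Q"
    and closed: "closedin (prod_topology T T) S"
    and S: "\<And>x y. x \<in> carrier G \<Longrightarrow> y \<in> carrier G \<Longrightarrow> (\<pi> x, \<pi> y) \<in> S' \<Longrightarrow> (x, y) \<in> S"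
  shows "outer_measure_of Q.haar2 S' \<le> outer_measure_of haar2 S"
  unfolding outer_measure_of_def[of haar2]
proof (rule INF_greatest)
  fix A assume "A \<in> {A \<in> sets haar2. S \<subseteq> A}"
  then have A: "A \<in> sets haar2" "S \<subseteq> A" by simp_all
  show "outer_measure_of Q.haar2 S' \<le> emeasure haar2 A"
  proof (rule ennreal_le_epsilon)
    fix e :: real assume "0 < e"
    then obtain U where U: "openin (prod_topology T T) U" "U \<in> sets haar2" "A \<subseteq> U"
      "emeasure haar2 U \<le> emeasure haar2 A + e" using haar2_outer_regular[OF A(1)] by blast
    have comp: "compactin (prod_topology T T) S"
      using closedin_compact_space[OF _ closed] compact by (simp add: compact_space_prod_topology)
    have SU: "S \<subseteq> U" using A(2) U(3) by blast
    obtain M where M: "M \<in> open_normals" "\<And>x y. (x, y) \<in> S \<Longrightarrow> (M #> x) \<times> (M #> y) \<subseteq> U"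
      by (rule uniform_refinement_square[OF comp U(1) SU]) (rule that)
    let ?M = "\<pi> ` M"
    have MQ: "?M \<in> Q.open_normals" by (rule \<pi>_image_open_normal[OF M(1)])
    let ?R = "{(C, D). C \<in> rcosets\<^bsub>Q\<^esub> ?M \<and> D \<in> rcosets\<^bsub>Q\<^esub> ?M \<and> (C \<times> D) \<inter> S' \<noteq> {}}"
    let ?E = "\<Union>(C, D)\<in>?R. C \<times> D"
    have "?R \<subseteq> (rcosets\<^bsub>Q\<^esub> ?M) \<times> (rcosets\<^bsub>Q\<^esub> ?M)" by blast
    then have finR: "finite ?R" using Q.finite_rcosets[OF MQ] by (meson finite_SigmaI finite_subset)
    have E: "?E \<in> sets Q.haar2"
    proof (rule sets.finite_UN[OF finR])
      fix CD assume "CD \<in> ?R"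
      then obtain C D where CD: "CD = (C, D)" "C \<in> rcosets\<^bsub>Q\<^esub> ?M" "D \<in> rcosets\<^bsub>Q\<^esub> ?M" by blast
      have "C \<in> sets Q.haar" "D \<in> sets Q.haar"
        unfolding Q.sets_haar by (rule Q.open_borel[OF Q.openin_rcosets[OF MQ CD(2)]],
          rule Q.open_borel[OF Q.openin_rcosets[OF MQ CD(3)]])
      then show "(case CD of (C, D) \<Rightarrow> C \<times> D) \<in> sets Q.haar2" unfolding CD(1) prod.case by (rule pair_measureI)
    qed
    have SE: "S' \<subseteq> ?E"
    proof
      fix z assume z: "z \<in> S'"
      then obtain X Y where XY: "z = (X, Y)" "X \<in> carrier Q" "Y \<in> carrier Q" using S' by blast
      have "X \<in> ?M #>\<^bsub>Q\<^esub> X" "Y \<in> ?M #>\<^bsub>Q\<^esub> Y"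
        using Q.rcos_self[OF _ Q.open_normalD(2)[OF MQ]] XY(2,3) by blast+
      moreover have "?M #>\<^bsub>Q\<^esub> X \<in> rcosets\<^bsub>Q\<^esub> ?M" "?M #>\<^bsub>Q\<^esub> Y \<in> rcosets\<^bsub>Q\<^esub> ?M"
        using Q.rcosetsI[OF Q.open_normalD(4)[OF MQ]] XY(2,3) by blast+
      ultimately have "(?M #>\<^bsub>Q\<^esub> X, ?M #>\<^bsub>Q\<^esub> Y) \<in> ?R" "z \<in> (?M #>\<^bsub>Q\<^esub> X) \<times> (?M #>\<^bsub>Q\<^esub> Y)"
        using z XY(1) by auto
      then show "z \<in> ?E" by blast
    qed
    \<comment> \<open>elements of one coset downstairs lift to elements of one coset upstairs, because \<open>C\<close> is the image of \<open>M #> x\<close>\<close>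
    have lift: "\<exists>y\<in>carrier G. \<pi> y = Y \<and> x \<in> M #> y"
      if C: "C \<in> rcosets\<^bsub>Q\<^esub> ?M" "\<pi> x \<in> C" "Y \<in> C" and x: "x \<in> carrier G" for C x Y
    proof -
      have "C = ?M #>\<^bsub>Q\<^esub> \<pi> x" by (rule Q.rcos_of_elem[OF MQ C(1,2)])
      also have "\<dots> = \<pi> ` (M #> x)" using \<pi>_image_r_coset[OF open_normalD(4)[OF M(1)] x] by simp
      finally obtain y where y: "y \<in> M #> x" "Y = \<pi> y" using C(3) by blast
      have yG: "y \<in> carrier G" using y(1) r_coset_subset_G[OF open_normalD(4)[OF M(1)] x] by blast
      have "M #> y = M #> x" by (rule rcos_of_member[OF M(1) x y(1)])
      then have "x \<in> M #> y" using rcos_self[OF x open_normalD(2)[OF M(1)]] by simp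
      then show ?thesis using y(2) yG by blast
    qed
    have "\<pi>2 -` ?E \<inter> space haar2 \<subseteq> U"
    proof
      fix z assume zE: "z \<in> \<pi>2 -` ?E \<inter> space haar2"
      obtain x y where zxy: "z = (x, y)" by (cases z)
      have z: "x \<in> carrier G" "y \<in> carrier G" "(\<pi> x, \<pi> y) \<in> ?E"
        using zE unfolding space_haar2 zxy by simp_all
      from z(3) obtain C D where "(C, D) \<in> ?R" "(\<pi> x, \<pi> y) \<in> C \<times> D" by (rule UN_E) (simp only: split_paired_all prod.case)
      then obtain X Y where CD: "C \<in> rcosets\<^bsub>Q\<^esub> ?M" "D \<in> rcosets\<^bsub>Q\<^esub> ?M"
        "\<pi> x \<in> C" "\<pi> y \<in> D" "X \<in> C" "Y \<in> D" "(X, Y) \<in> S'" by blast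
      obtain x' where x': "x' \<in> carrier G" "\<pi> x' = X" "x \<in> M #> x'" using lift[OF CD(1,3,5) z(1)] by blast
      obtain y' where y': "y' \<in> carrier G" "\<pi> y' = Y" "y \<in> M #> y'" using lift[OF CD(2,4,6) z(2)] by blast
      have "(x', y') \<in> S" using S[OF x'(1) y'(1)] CD(7) unfolding x'(2) y'(2) .
      from M(2)[OF this] show "z \<in> U" using x'(3) y'(3) unfolding zxy by blast
    qed
    then have "emeasure haar2 (\<pi>2 -` ?E \<inter> space haar2) \<le> emeasure haar2 U" using U(2) by (rule emeasure_mono)
    then have "emeasure Q.haar2 ?E \<le> emeasure haar2 U" using emeasure_haar2_preimage(1)[OF E] by simp
    moreover have "outer_measure_of Q.haar2 S' \<le> emeasure Q.haar2 ?E"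
      unfolding outer_measure_of_def using E SE by (intro INF_lower) simp
    ultimately show "outer_measure_of Q.haar2 S' \<le> emeasure haar2 A + e"
      using U(4) by (meson order_trans)
  qed
qed

end

section \<open>Monotonicity of the exterior degree\<close>

lemma (in profinite_group) exterior_degree_eq:
  "exterior_degree p G T = enn2real (outer_measure_of haar2 (trivial_wedges p G T))"
  unfolding exterior_degree_def trivial_wedges_def haar_measure_eq ..

lemma (in profinite_group) outer_measure_finite: "outer_measure_of haar2 S < \<infinity>" if "S \<subseteq> carrier G \<times> carrier G"
proof -
  have "outer_measure_of haar2 S \<le> emeasure haar2 (carrier G \<times> carrier G)"
    unfolding outer_measure_of_def using that sets.top[of haar2] unfolding space_haar2
    by (intro INF_lower) simp
  also have "\<dots> < \<infinity>" unfolding emeasure_haar2_space by simp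
  finally show ?thesis .
qed

theorem theorem3p11:
  fixes p :: nat and G :: "('a, 'm) monoid_scheme" and T :: "'a topology" and N :: "'a set"
  assumes "prime p"
    and "pro_p_group p G T"
    and "N \<lhd> G"
    and "closedin T N"
  shows "exterior_degree p G T \<le> exterior_degree p (G Mod N) (quotient_topology G T N) \<and>
    (N \<subseteq> complete_exterior_center p G T \<longrightarrow>
      exterior_degree p G T = exterior_degree p (G Mod N) (quotient_topology G T N))"
proof -
  interpret profinite_quotient G T N
    by (rule profinite_quotient.intro[OF pro_p_group_profinite[OF assms(2)] profinite_quotient_axioms.intro[OF assms(3)]])
  let ?S = "trivial_wedges p G T" and ?S' = "trivial_wedges p Q TQ"
  have SG: "?S \<subseteq> carrier G \<times> carrier G" and SQ: "?S' \<subseteq> carrier Q \<times> carrier Q"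
    unfolding trivial_wedges_def by blast+
  have "x \<in> carrier G \<and> y \<in> carrier G \<and> (\<pi> x, \<pi> y) \<in> ?S'" if "(x, y) \<in> ?S" for x y
    using trivial_wedges_hom[OF assms(1) is_group topspace_eq Q_group topspace_TQ \<pi>_hom \<pi>_continuous that]
      SG that by blast
  then have le: "outer_measure_of haar2 ?S \<le> outer_measure_of Q.haar2 ?S'"
    by (rule outer_measure_preimage_le)
  have ge: "outer_measure_of Q.haar2 ?S' \<le> outer_measure_of haar2 ?S"
    if center: "N \<subseteq> complete_exterior_center p G T"
  proof (rule outer_measure_preimage_ge[OF SQ closedin_trivial_wedges[OF assms(1) is_group topspace_eq]])
    have "kernel G Q \<pi> \<subseteq> complete_exterior_center p G T"
      using rcos_eq_self_iff[OF normal_imp_subgroup[OF assms(3)]] center unfolding kernel_def by auto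
    then show "(x, y) \<in> ?S" if "x \<in> carrier G" "y \<in> carrier G" "(\<pi> x, \<pi> y) \<in> ?S'" for x y
      using trivial_wedges_lift[OF assms(1) is_group topspace_eq Q_group topspace_TQ \<pi>_hom \<pi>_surj
          \<pi>_continuous \<pi>_open _ that] by blast
  qed
  show ?thesis
    unfolding exterior_degree_eq Q.exterior_degree_eq
    using enn2real_mono[OF le] Q.outer_measure_finite[OF SQ] antisym[OF le ge] by simp
qed

end
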